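(* Let $\{h_\theta(x,y)\}_{|\theta|<1}$ be a family of joint probability densities on $\mathbb R^2$ with respect to Lebesgue measure such that $h_0(x,y)=f_0(x)g_0(y)$ for some univariate densities $f_0,g_0$. Suppose that $$\dot\ell_0(x,y):=\frac{\partial}{\partial\theta}\log h_\theta(x,y)\Big|_{\theta=0}$$ exists (where $h_0(x,y)>0$), that the family is quadratic mean differentiable at $\theta=0$ with score function $\dot\ell_0$, i.e. $$\int\int\Big(\sqrt{h_\theta(x,y)}-\sqrt{h_0(x,y)}-\tfrac12\theta\,\dot\ell_0(x,y)\sqrt{h_0(x,y)}\Big)^2dx\,dy=o(\theta^2)\quad(\theta\to0),$$ and that $\mathbb E_0[\dot\ell_0(X,Y)^2]>0$, where $\mathbb E_0$ is expectation under $(X,Y)\sim h_0$. Then Chatterjee's coefficient $\hat C_n$ has Pitman efficiency $e(\hat C_n)=0$; that is, in the sense of the definition of $e$ given in the context, the asymptotic correlation $\rho$ between $\sqrt n\,\hat C_n$ and the score statistic $\frac1{\sqrt n}\sum_{i=1}^n\dot\ell_0(X_i,Y_i)$ under $\theta=0$ is equal to $0$.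
   Context: $P_{n,\theta}$ denotes the law of an i.i.d. sample $(X_1,Y_1),\ldots,(X_n,Y_n)$ from $h_\theta$, i.e. the product measure with density $\prod_{i=1}^nh_\theta(x_i,y_i)$. Chatterjee's coefficient: when there are no ties among the $X_i$'s and among the $Y_i$'s (which holds a.s. here), sort $X_{(1)}<\cdots<X_{(n)}$, let $Y_{(i)}$ be the $Y$-sample value paired with $X_{(i)}$, and let $r_i=\#\{j:Y_j\le Y_{(i)}\}$. Then $$\hat C_n:=1-\frac{3\sum_{i=1}^{n-1}|r_{i+1}-r_i|}{n^2-1}.$$ Pitman efficiency: let $\tau_0^2:=\mathbb E_0[\dot\ell_0(X,Y)^2]$. For a statistic $T_n$, a function of $(X_1,Y_1),\ldots,(X_n,Y_n)$, such that under $\{P_{n,0}\}_{n\ge1}$ $$\Big(\sqrt n\,T_n,\ \frac1{\sqrt n}\sum_{i=1}^n\dot\ell_0(X_i,Y_i)\Big)\xrightarrow{d}N\left(\begin{pmatrix}0\\0\end{pmatrix},\begin{pmatrix}\sigma^2&\rho\sigma\tau_0\\\rho\sigma\tau_0&\tau_0^2\end{pmatrix}\right),$$ with $\sigma>0$, the Pitman efficiency of the test based on $\sqrt n\,T_n/\sigma$ with respect to the asymptotically optimal test, based on $\frac1{\tau_0\sqrt n}\sum_{i=1}^n\dot\ell_0(X_i,Y_i)$, is $e(T_n):=\rho^2$. *)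

theory Defs
  imports "HOL-Probability.Probability"
begin

definition prob_density :: "('a::euclidean_space \<Rightarrow> real) \<Rightarrow> bool" where
  "prob_density f \<longleftrightarrow>
     f \<in> borel_measurable borel \<and> (\<forall>z. 0 \<le> f z) \<and> (\<integral>\<^sup>+ z. ennreal (f z) \<partial>lborel) = 1"

text \<open>A parametric family is \<open>h \<theta> (x, y)\<close>; only the values at \<open>\<bar>\<theta>\<bar> < 1\<close> are meaningful.\<close>

definition pair_law :: "(real \<Rightarrow> real \<times> real \<Rightarrow> real) \<Rightarrow> real \<Rightarrow> (real \<times> real) measure" where
  "pair_law h \<theta> = density lborel (\<lambda>z. ennreal (h \<theta> z))"

definition sample_law ::
    "(real \<Rightarrow> real \<times> real \<Rightarrow> real) \<Rightarrow> nat \<Rightarrow> real \<Rightarrow> (nat \<Rightarrow> real \<times> real) measure" where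
  "sample_law h n \<theta> = PiM {..<n} (\<lambda>_. pair_law h \<theta>)"

text \<open>Differentiability of \<open>log h\<^sub>\<theta>\<close> at \<open>0\<close> includes that \<open>log h\<^sub>\<theta>\<close> is finite near \<open>0\<close>.
  Positivity must be required separately because \<open>ln\<close> is total, with \<open>ln 0 = 0\<close>.\<close>

definition log_density_differentiable :: "(real \<Rightarrow> real \<times> real \<Rightarrow> real) \<Rightarrow> bool" where
  "log_density_differentiable h \<longleftrightarrow>
     (\<forall>z. 0 < h 0 z \<longrightarrow>
        (\<forall>\<^sub>F \<theta> in nhds 0. 0 < h \<theta> z) \<and> (\<lambda>\<theta>. ln (h \<theta> z)) differentiable (at 0))"

text \<open>The value \<open>0\<close> off \<open>{h\<^sub>0 > 0}\<close> is immaterial, since \<open>{h\<^sub>0 = 0}\<close> is a null set under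
  \<open>h\<^sub>0\<close>; fixing it makes the score Borel measurable.\<close>

definition score :: "(real \<Rightarrow> real \<times> real \<Rightarrow> real) \<Rightarrow> real \<times> real \<Rightarrow> real" where
  "score h z = (if 0 < h 0 z then deriv (\<lambda>\<theta>. ln (h \<theta> z)) 0 else 0)"

text \<open>The integral is the extended nonnegative one, since the Bochner integral of a
  non-integrable function is \<open>0\<close> and would make the condition hold spuriously.\<close>

definition qmd_at_0 :: "(real \<Rightarrow> real \<times> real \<Rightarrow> real) \<Rightarrow> bool" where
  "qmd_at_0 h \<longleftrightarrow>
     ((\<lambda>\<theta>. (\<integral>\<^sup>+ z. ennreal ((sqrt (h \<theta> z) - sqrt (h 0 z)
                 - 1 / 2 * \<theta> * score h z * sqrt (h 0 z))\<^sup>2) \<partial>lborel) / ennreal (\<theta>\<^sup>2))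
        \<longlongrightarrow> 0) (at 0)"

definition fisher_information_0 :: "(real \<Rightarrow> real \<times> real \<Rightarrow> real) \<Rightarrow> real" where
  "fisher_information_0 h = (\<integral>z. (score h z)\<^sup>2 \<partial>pair_law h 0)"

text \<open>The sample is \<open>\<omega> 0, \<dots>, \<omega> (n - 1)\<close>, and positions and indices are counted from \<open>0\<close>.
  Ties among the first coordinates are broken by index.\<close>

definition chatterjee :: "nat \<Rightarrow> (nat \<Rightarrow> real \<times> real) \<Rightarrow> real" where
  "chatterjee n \<omega> =
     (let zs = sort_key fst (map \<omega> [0..<n]);
          r = (\<lambda>i. card {j. j < n \<and> snd (\<omega> j) \<le> snd (zs ! i)})
      in 1 - 3 * (\<Sum>i<n - 1. \<bar>real (r (i + 1)) - real (r i)\<bar>) / ((real n)\<^sup>2 - 1))"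

definition weakly_converges ::
    "(nat \<Rightarrow> 'a::topological_space measure) \<Rightarrow> 'a measure \<Rightarrow> bool" where
  "weakly_converges M N \<longleftrightarrow>
     (\<forall>f :: 'a \<Rightarrow> real. continuous_on UNIV f \<and> bounded (range f) \<longrightarrow>
        (\<lambda>n. \<integral>x. f x \<partial>M n) \<longlonglongrightarrow> (\<integral>x. f x \<partial>N))"

text \<open>The centred normal law with covariance matrix
  \<open>((\<sigma>\<^sup>2, \<rho> \<sigma> \<tau>), (\<rho> \<sigma> \<tau>, \<tau>\<^sup>2))\<close>, for \<open>\<bar>\<rho>\<bar> \<le> 1\<close>, as a linear image of two independent standard
  normals, so that the singular case \<open>\<bar>\<rho>\<bar> = 1\<close> is included.\<close>

definition bivariate_normal :: "real \<Rightarrow> real \<Rightarrow> real \<Rightarrow> (real \<times> real) measure" where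
  "bivariate_normal \<sigma> \<tau> \<rho> =
     distr (std_normal_distribution \<Otimes>\<^sub>M std_normal_distribution) borel
       (\<lambda>(u, v). (\<sigma> * u, \<tau> * (\<rho> * u + sqrt (1 - \<rho>\<^sup>2) * v)))"

definition has_pitman_efficiency ::
    "(real \<Rightarrow> real \<times> real \<Rightarrow> real) \<Rightarrow> (nat \<Rightarrow> (nat \<Rightarrow> real \<times> real) \<Rightarrow> real) \<Rightarrow> real \<Rightarrow> bool" where
  "has_pitman_efficiency h T e \<longleftrightarrow>
     (\<forall>n. T n \<in> borel_measurable (sample_law h n 0)) \<and>
     (\<exists>\<sigma> \<rho>. 0 < \<sigma> \<and> \<bar>\<rho>\<bar> \<le> 1 \<and>
        weakly_converges
          (\<lambda>n. distr (sample_law h n 0) borel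
             (\<lambda>\<omega>. (sqrt (real n) * T n \<omega>, (1 / sqrt (real n)) * (\<Sum>i<n. score h (\<omega> i)))))
          (bivariate_normal \<sigma> (sqrt (fisher_information_0 h)) \<rho>) \<and>
        e = \<rho>\<^sup>2)"

end

theory Submission
  imports Defs
begin

text \<open>Conditionally on the \<open>X\<close>-sample, the concomitants \<open>Y\<^sub>(\<^sub>i\<^sub>)\<close> are i.i.d., and after the quantile transform
  they are i.i.d. uniform variables \<open>U\<^sub>i\<close>. Counting \<open>\<bar>r\<^sub>i\<^sub>+\<^sub>1 - r\<^sub>i\<bar>\<close> as the number of \<open>U\<^sub>j\<close> between
  \<open>U\<^sub>i\<close> and \<open>U\<^sub>i\<^sub>+\<^sub>1\<close> and removing the projections gives
  \<open>sqrt n C\<^sub>n = - 3 / sqrt n \<Sum> d (U\<^sub>i, U\<^sub>i\<^sub>+\<^sub>1) + O (1 / sqrt n)\<close> in \<open>L\<^sup>1\<close>, where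
  \<open>d (u, v) = \<bar>u - v\<bar> + u (1 - u) + v (1 - v) - 2 / 3\<close> has mean zero in each argument. The score contributes
  \<open>e\<^sub>j (U\<^sub>j) = exp (i t l (x\<^sub>(\<^sub>j\<^sub>), U\<^sub>j) / sqrt n)\<close> to the joint characteristic function. Because \<open>d\<close> is
  degenerate in both arguments, a one-step recursion along \<open>j\<close> shows that the conditional
  characteristic function is \<open>(1 - c\<^sup>2 s\<^sub>d\<^sup>2 / 2) ^ (n - 1) \<Prod> E e\<^sub>j\<close> up to \<open>O (1 / sqrt n)\<close>, with \<open>c = - 3 s / sqrt n\<close> and
  \<open>s\<^sub>d\<^sup>2 = E d\<^sup>2\<close>. Averaging over the \<open>X\<close>-sample leaves the product of a Gaussian characteristic function
  and that of the score sum, so the two statistics are asymptotically independent.\<close>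

section \<open>Product measures\<close>

text \<open>The score factors \<open>e\<^sub>j\<close> are tied to the X-values, so after sorting by
  X they are not identically distributed. The argument therefore works for a fixed X-sample and
  keeps only errors that are symmetric in the observations: sums over j of
  \<open>\<delta>\<^sub>j\<close>, the mean distance of \<open>e\<^sub>j\<close> from 1, and of its
  square. Averaged over X, \<open>\<delta>\<^sub>j\<close> is of order 1 / sqrt n and its square of
  order 1 / n. The obstacle is a term of order 1 / n in every step, which n steps could accumulate
  to order 1. It is a mean-zero function of the preceding coordinate, and integrating out that
  coordinate too lowers it to order 1 / (n sqrt n). Degeneracy of d in the second argument removes
  the first-order term of a step; degeneracy in the first argument centres what is left. That the
  score has mean zero is no assumption of the theorem; it is extracted from quadratic mean
  differentiability. The limit in the plane comes from the one-dimensional continuity theorem,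
  applied to one coordinate at a time while a function of the other acts as a weight.\<close>

lemma distr_PiM_fun_upd:
  assumes I: "finite I" "j \<in> I" and M: "\<And>i. i \<in> I \<Longrightarrow> prob_space (M i)"
  shows "distr (PiM I M \<Otimes>\<^sub>M M j) (PiM I M) (\<lambda>(w, z). fun_upd w j z) = PiM I M"
proof -
  \<comment> \<open>\<open>product_prob_space\<close> wants a probability measure at every index,
    but only those in \<open>I\<close> are assumed to be such; the law \<open>M j\<close> fills the
    other indices.\<close>
  define M' where "M' i = (if i \<in> I then M i else M j)" for i
  have PM: "PiM I M = PiM I M'" by (rule PiM_cong) (auto simp: M'_def)
  have Mj: "M j = M' j" using I by (simp add: M'_def)
  interpret product_prob_space M' UNIV
    by (rule product_prob_spaceI) (auto simp: M'_def M I)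
  interpret PI: prob_space "PiM I M'"
    by (rule prob_space_PiM) (auto simp: M'_def M I)
  have meas: "(\<lambda>(w, z). fun_upd w j z) \<in> measurable (PiM I M' \<Otimes>\<^sub>M M' j) (PiM I M')"
    using I by (intro measurable_PiM_single') (auto simp: space_pair_measure space_PiM PiE_iff
      extensional_def split: if_splits)
  show ?thesis
    unfolding PM Mj
  proof (rule PiM_eqI)
    fix A assume A: "\<And>i. i \<in> I \<Longrightarrow> A i \<in> sets (M' i)"
    have As: "A i \<subseteq> space (M' i)" if "i \<in> I" for i
      using A[OF that] by (rule sets.sets_into_space)
    define B where "B i = (if i = j then space (M' j) else A i)" for i
    \<comment> \<open>The preimage of a box is a product: side \<open>j\<close> is tested on the new
      value \<open>z\<close> alone, so the old coordinate \<open>j\<close> becomes free.\<close>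
    have eq: "(\<lambda>(w, z). fun_upd w j z) -` Pi\<^sub>E I A \<inter> space (PiM I M' \<Otimes>\<^sub>M M' j) = Pi\<^sub>E I B \<times> A j"
      using As \<open>j \<in> I\<close>
      apply (auto simp: space_pair_measure space_PiM PiE_iff B_def extensional_def split: if_splits)
      by blast
    have B: "B i \<in> sets (M' i)" if "i \<in> I" for i
      using A[OF that] by (auto simp: B_def)
    have Aj: "A j \<in> sets (M' j)" using A I by auto
    have "emeasure (distr (PiM I M' \<Otimes>\<^sub>M M' j) (PiM I M') (\<lambda>(w, z). fun_upd w j z)) (Pi\<^sub>E I A)
        = emeasure (PiM I M') (Pi\<^sub>E I B) * emeasure (M' j) (A j)"
      using A B Aj I by (subst emeasure_distr[OF meas])
        (auto intro!: sets_PiM_I_finite simp: eq M.emeasure_pair_measure_Times)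
    also have "emeasure (PiM I M') (Pi\<^sub>E I B) = (\<Prod>i\<in>I. emeasure (M' i) (B i))"
      using B I by (intro emeasure_PiM) auto
    also have "\<dots> = (\<Prod>i\<in>I - {j}. emeasure (M' i) (A i))"
      using I by (subst prod.remove[of _ j]) (auto simp: B_def M.emeasure_space_1 intro!: prod.cong)
    also have "\<dots> * emeasure (M' j) (A j) = (\<Prod>i\<in>I. emeasure (M' i) (A i))"
      using I by (subst prod.remove[of I j]) (auto simp: mult.commute)
    finally show "emeasure (distr (PiM I M' \<Otimes>\<^sub>M M' j) (PiM I M') (\<lambda>(w, z). fun_upd w j z)) (Pi\<^sub>E I A)
        = (\<Prod>i\<in>I. emeasure (M' i) (A i))" .
  qed (use I in auto)
qed

text \<open>Resampling one coordinate: the inner integral plays the role of the conditional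
  expectation given all other coordinates. Every later step that integrates out a single variable
  goes through this identity.\<close>

lemma integral_PiM_fun_upd:
  fixes F :: "('i \<Rightarrow> 'a) \<Rightarrow> 'b::{banach, second_countable_topology}"
  assumes I: "finite I" "j \<in> I" and M: "\<And>i. i \<in> I \<Longrightarrow> prob_space (M i)"
    and F: "integrable (PiM I M) F"
  shows "(\<integral>w. F w \<partial>PiM I M) = (\<integral>w. (\<integral>z. F (fun_upd w j z) \<partial>M j) \<partial>PiM I M)"
proof -
  interpret P: prob_space "PiM I M" by (rule prob_space_PiM) (rule M)
  interpret Mj: prob_space "M j" using I M by simp
  interpret pair_sigma_finite "PiM I M" "M j" ..
  have meas: "(\<lambda>(w, z). fun_upd w j z) \<in> measurable (PiM I M \<Otimes>\<^sub>M M j) (PiM I M)"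
    using I by (intro measurable_PiM_single') (auto simp: space_pair_measure space_PiM PiE_iff
      extensional_def split: if_splits)
  have eq: "distr (PiM I M \<Otimes>\<^sub>M M j) (PiM I M) (\<lambda>p. fun_upd (fst p) j (snd p)) = PiM I M"
    using distr_PiM_fun_upd[of I j M] I M by (simp add: case_prod_beta')
  have Fm: "F \<in> borel_measurable (PiM I M)" using F by auto
  have int: "integrable (PiM I M \<Otimes>\<^sub>M M j) (\<lambda>(w, z). F (fun_upd w j z))"
    using F integrable_distr_eq[OF meas Fm] by (simp add: case_prod_beta' eq)
  have "(\<integral>w. F w \<partial>PiM I M) = (\<integral>p. (\<lambda>(w, z). F (fun_upd w j z)) p \<partial>(PiM I M \<Otimes>\<^sub>M M j))"
    using integral_distr[OF meas Fm] by (simp add: case_prod_beta' eq)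
  also have "\<dots> = (\<integral>w. (\<integral>z. F (fun_upd w j z) \<partial>M j) \<partial>PiM I M)"
    using integral_fst[OF int] by simp
  finally show ?thesis .
qed

text \<open>Serves to write a sample of pairs as an X-sample and an independent uniform sample
  pushed through the quantile function. Both laws agree on boxes, since the box indicator factorises
  over the indices and the product integral can be taken in \<open>u\<close> for fixed
  \<open>x\<close>, then in \<open>x\<close>.\<close>

lemma PiM_pair_distr:
  fixes A :: "'a measure" and B :: "'b measure" and g :: "'b \<Rightarrow> 'c"
  assumes I: "finite I" and A: "prob_space A" and B: "prob_space B"
    and g[measurable]: "g \<in> measurable B N"
  shows "PiM I (\<lambda>_. A \<Otimes>\<^sub>M distr B N g)
    = distr (PiM I (\<lambda>_. A) \<Otimes>\<^sub>M PiM I (\<lambda>_. B)) (PiM I (\<lambda>_. A \<Otimes>\<^sub>M N)) (\<lambda>(x, u). \<lambda>i\<in>I. (x i, g (u i)))"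
proof -
  interpret A: prob_space A by fact
  interpret B: prob_space B by fact
  interpret G: prob_space "distr B N g" by (rule B.prob_space_distr) simp
  interpret PA: product_prob_space "\<lambda>_. A" I by (rule product_prob_spaceI) (rule A)
  interpret PB: product_prob_space "\<lambda>_. B" I by (rule product_prob_spaceI) (rule B)
  interpret P1: prob_space "PiM I (\<lambda>_. A)" by (rule prob_space_PiM) (rule A)
  interpret AG: pair_prob_space A "distr B N g" ..
  interpret product_prob_space "\<lambda>_. A \<Otimes>\<^sub>M distr B N g" I
    by (rule product_prob_spaceI) unfold_locales
  define \<phi> where "\<phi> = (\<lambda>(x, u). \<lambda>i\<in>I. (x i :: 'a, g (u i)))"
  have meas[measurable]: "\<phi> \<in> measurable (PiM I (\<lambda>_. A) \<Otimes>\<^sub>M PiM I (\<lambda>_. B)) (PiM I (\<lambda>_. A \<Otimes>\<^sub>M N))"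
    unfolding \<phi>_def by measurable
  have "distr (PiM I (\<lambda>_. A) \<Otimes>\<^sub>M PiM I (\<lambda>_. B)) (PiM I (\<lambda>_. A \<Otimes>\<^sub>M N)) \<phi>
     = PiM I (\<lambda>_. A \<Otimes>\<^sub>M distr B N g)"
  proof (rule PiM_eqI[OF I])
    show "sets (distr (PiM I (\<lambda>_. A) \<Otimes>\<^sub>M PiM I (\<lambda>_. B)) (PiM I (\<lambda>_. A \<Otimes>\<^sub>M N)) \<phi>)
      = sets (PiM I (\<lambda>_. A \<Otimes>\<^sub>M distr B N g))"
      by (auto intro!: sets_PiM_cong sets_pair_measure_cong)
    fix E assume "\<And>i. i \<in> I \<Longrightarrow> E i \<in> sets (A \<Otimes>\<^sub>M distr B N g)"
    then have E: "E i \<in> sets (A \<Otimes>\<^sub>M N)" if "i \<in> I" for i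
      using that sets_pair_measure_cong[of A A "distr B N g" N] by auto
    define f where "f i = (\<lambda>x u. indicator (E i) (x, g u) :: ennreal)" for i
    have f: "(\<lambda>(x, u). f i x u) \<in> borel_measurable (A \<Otimes>\<^sub>M B)" if "i \<in> I" for i
      using E[OF that, measurable] by (simp add: f_def) measurable
    have f1: "f i x \<in> borel_measurable B" if "i \<in> I" "x \<in> space A" for i x
      using measurable_compose[OF measurable_Pair1'[OF that(2)] f[OF that(1)]] by simp
    have f2: "(\<lambda>x. \<integral>\<^sup>+u. f i x u \<partial>B) \<in> borel_measurable A" if "i \<in> I" for i
      using B.borel_measurable_nn_integral[OF f[OF that]] by simp
    have box: "Pi\<^sub>E I E \<in> sets (PiM I (\<lambda>_. A \<Otimes>\<^sub>M N))"
      using E I by (intro sets_PiM_I_finite) auto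
    \<comment> \<open>The sides \<open>E i\<close> need not be rectangles, so each factor couples
      \<open>x i\<close> with \<open>u i\<close>; only the factorisation over \<open>i\<close> is
      available.\<close>
    have ind: "indicator (Pi\<^sub>E I E) (\<phi> (x, u)) = (\<Prod>i\<in>I. f i (x i) (u i))" for x u
    proof (cases "\<forall>i\<in>I. (x i, g (u i)) \<in> E i")
      case True then show ?thesis by (auto simp: \<phi>_def f_def PiE_iff indicator_def)
    next
      case False
      then obtain i where "i \<in> I" "(x i, g (u i)) \<notin> E i" by auto
      then show ?thesis using I
        by (auto simp: \<phi>_def f_def PiE_iff indicator_def intro!: prod_zero[symmetric])
    qed
    have "emeasure (distr (PiM I (\<lambda>_. A) \<Otimes>\<^sub>M PiM I (\<lambda>_. B)) (PiM I (\<lambda>_. A \<Otimes>\<^sub>M N)) \<phi>) (Pi\<^sub>E I E)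
      = (\<integral>\<^sup>+z. indicator (Pi\<^sub>E I E) z \<partial>distr (PiM I (\<lambda>_. A) \<Otimes>\<^sub>M PiM I (\<lambda>_. B)) (PiM I (\<lambda>_. A \<Otimes>\<^sub>M N)) \<phi>)"
      using box by simp
    also have "\<dots> = (\<integral>\<^sup>+p. indicator (Pi\<^sub>E I E) (\<phi> p) \<partial>(PiM I (\<lambda>_. A) \<Otimes>\<^sub>M PiM I (\<lambda>_. B)))"
      using box by (intro nn_integral_distr) auto
    also have "\<dots> = (\<integral>\<^sup>+x. (\<integral>\<^sup>+u. indicator (Pi\<^sub>E I E) (\<phi> (x, u)) \<partial>PiM I (\<lambda>_. B)) \<partial>PiM I (\<lambda>_. A))"
      by (intro sigma_finite_measure.nn_integral_fst[symmetric] prob_space_imp_sigma_finite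
        prob_space_PiM B measurable_compose[OF meas] borel_measurable_indicator box)
    also have "\<dots> = (\<integral>\<^sup>+x. (\<Prod>i\<in>I. \<integral>\<^sup>+u. f i (x i) u \<partial>B) \<partial>PiM I (\<lambda>_. A))"
      unfolding ind
      by (intro nn_integral_cong PB.product_nn_integral_prod I f1) (auto simp: space_PiM)
    also have "\<dots> = (\<Prod>i\<in>I. \<integral>\<^sup>+x. (\<integral>\<^sup>+u. f i x u \<partial>B) \<partial>A)"
      by (intro PA.product_nn_integral_prod I f2) 
    also have "\<dots> = (\<Prod>i\<in>I. emeasure (A \<Otimes>\<^sub>M distr B N g) (E i))"
    proof (rule prod.cong[OF refl])
      fix i assume i: "i \<in> I"
      have "emeasure (A \<Otimes>\<^sub>M distr B N g) (E i)
          = (\<integral>\<^sup>+x. (\<integral>\<^sup>+y. indicator (E i) (x, y) \<partial>distr B N g) \<partial>A)"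
        using E[OF i] by (intro G.emeasure_pair_measure) simp
      also have "\<dots> = (\<integral>\<^sup>+x. (\<integral>\<^sup>+u. f i x u \<partial>B) \<partial>A)"
        using E[OF i, measurable] unfolding f_def
        by (intro nn_integral_cong nn_integral_distr) auto
      finally show "(\<integral>\<^sup>+x. (\<integral>\<^sup>+u. f i x u \<partial>B) \<partial>A) = emeasure (A \<Otimes>\<^sub>M distr B N g) (E i)" ..
    qed
    finally show "emeasure (distr (PiM I (\<lambda>_. A) \<Otimes>\<^sub>M PiM I (\<lambda>_. B)) (PiM I (\<lambda>_. A \<Otimes>\<^sub>M N)) \<phi>) (Pi\<^sub>E I E)
      = (\<Prod>i\<in>I. emeasure (A \<Otimes>\<^sub>M distr B N g) (E i))" .
  qed
  then show ?thesis by (simp add: \<phi>_def)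
qed

section \<open>Joint weak convergence to a product law\<close>

text \<open>The signed weights \<open>g\<close> are shifted to \<open>2 + g \<ge> 1\<close>, so that after normalisation the continuity theorem
  applies to genuine probability laws.\<close>

lemma char_weighted_imp_integral_conv:
  fixes M :: "nat \<Rightarrow> 'a measure" and A g :: "nat \<Rightarrow> 'a \<Rightarrow> real" and \<gamma> :: real and u :: "real \<Rightarrow> real"
  assumes M: "\<And>n. prob_space (M n)"
    and A[measurable]: "\<And>n. A n \<in> borel_measurable (M n)"
    and g[measurable]: "\<And>n. g n \<in> borel_measurable (M n)"
    and g1: "\<And>n x. \<bar>g n x\<bar> \<le> 1"
    and \<nu>: "real_distribution \<nu>"
    and cA: "\<And>s. (\<lambda>n. \<integral>x. iexp (s * A n x) \<partial>M n) \<longlonglongrightarrow> char \<nu> s"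
    and cg: "\<And>s. (\<lambda>n. \<integral>x. complex_of_real (g n x) * iexp (s * A n x) \<partial>M n) \<longlonglongrightarrow> complex_of_real \<gamma> * char \<nu> s"
    and u: "\<And>x. isCont u x" "\<And>x. \<bar>u x\<bar> \<le> K"
  shows "(\<lambda>n. \<integral>x. g n x * u (A n x) \<partial>M n) \<longlonglongrightarrow> \<gamma> * (\<integral>x. u x \<partial>\<nu>)"
proof -
  interpret M: prob_space "M n" for n by (rule M)
  interpret \<nu>: real_distribution \<nu> by (rule \<nu>)
  have [measurable]: "u \<in> borel_measurable borel"
    using u(1) by (intro borel_measurable_continuous_onI continuous_at_imp_continuous_on) auto
  have int_g: "integrable (M n) (g n)" for n
    using g1 by (intro M.integrable_const_bound[of _ 1]) auto
  have int_u: "integrable (M n) (\<lambda>x. u (A n x))" for n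
    using u(2) by (intro M.integrable_const_bound[of _ K]) auto
  have int_gu: "integrable (M n) (\<lambda>x. g n x * u (A n x))" for n
  proof (intro M.integrable_const_bound[of _ K] AE_I2)
    fix x show "norm (g n x * u (A n x)) \<le> K"
      using mult_mono[OF g1[of n x] u(2)[of "A n x"]] by (simp add: abs_mult)
  qed auto
  have int_e: "integrable (M n) (\<lambda>x. iexp (s * A n x))" for n s
    by (intro M.integrable_const_bound[of _ 1]) auto
  have int_ge: "integrable (M n) (\<lambda>x. complex_of_real (g n x) * iexp (s * A n x))" for n s
    using g1 by (intro M.integrable_const_bound[of _ 1]) (auto simp: norm_mult)
  define Z where "Z n = 2 + (\<integral>x. g n x \<partial>M n)" for n
  have Zge: "1 \<le> Z n" for n
  proof -
    have "(\<integral>x. - 1 \<partial>M n) \<le> (\<integral>x. g n x \<partial>M n)"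
      using g1[of n] int_g by (intro integral_mono) (auto simp: abs_le_iff minus_le_iff)
    then show ?thesis by (simp add: Z_def M.prob_space)
  qed
  have "(\<lambda>n. \<integral>x. complex_of_real (g n x) \<partial>M n) \<longlonglongrightarrow> complex_of_real \<gamma>"
    using cg[of 0] by (simp add: \<nu>.char_zero)
  \<comment> \<open>At frequency 0 the weighted hypothesis is a statement about the mean of
    \<open>g n\<close>.\<close>
  then have gl: "(\<lambda>n. \<integral>x. g n x \<partial>M n) \<longlonglongrightarrow> \<gamma>"
    by (simp add: tendsto_of_real_iff)
  have Zl: "Z \<longlonglongrightarrow> 2 + \<gamma>"
    unfolding Z_def by (intro tendsto_intros gl)
  have g\<gamma>: "1 \<le> 2 + \<gamma>"
    using Zge by (intro tendsto_lowerbound[OF Zl]) auto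
  define w where "w n x = (2 + g n x) / Z n" for n x
  have w0: "0 \<le> w n x" for n x
    using g1[of n x] Zge[of n] by (simp add: w_def abs_le_iff)
  have [measurable]: "w n \<in> borel_measurable (M n)" for n
    unfolding w_def by measurable
  have int_w: "integrable (M n) (w n)" for n
    unfolding w_def using int_g by auto
  have w1: "(\<integral>x. w n x \<partial>M n) = 1" for n
    using Zge[of n] int_g by (simp add: w_def M.prob_space Z_def)
  define Q where "Q n = density (M n) (\<lambda>x. ennreal (w n x))" for n
  have Q: "prob_space (Q n)" for n
  proof
    have "emeasure (Q n) (space (Q n)) = (\<integral>\<^sup>+x. ennreal (w n x) \<partial>M n)"
      unfolding Q_def by (subst emeasure_density) (auto intro!: nn_integral_cong)
    also have "\<dots> = 1"
      using nn_integral_eq_integral[OF int_w, of n] w0 w1 by simp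
    finally show "emeasure (Q n) (space (Q n)) = 1" .
  qed
  have AQ[measurable]: "A n \<in> borel_measurable (Q n)" for n
    by (simp add: Q_def)
  interpret Q: prob_space "Q n" for n by (rule Q)
  have chQ: "char (distr (Q n) borel (A n)) s
      = (2 * (\<integral>x. iexp (s * A n x) \<partial>M n) + (\<integral>x. complex_of_real (g n x) * iexp (s * A n x) \<partial>M n)) / of_real (Z n)" for n s
  proof -
    have "char (distr (Q n) borel (A n)) s = (\<integral>x. w n x *\<^sub>R iexp (s * A n x) \<partial>M n)"
      unfolding char_def by (simp add: integral_distr) (simp add: Q_def integral_density w0)
    also have "\<dots> = (\<integral>x. (2 * iexp (s * A n x) + complex_of_real (g n x) * iexp (s * A n x)) / of_real (Z n) \<partial>M n)"
      by (intro Bochner_Integration.integral_cong) (auto simp: w_def scaleR_conv_of_real field_simps)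
    also have "\<dots> = (2 * (\<integral>x. iexp (s * A n x) \<partial>M n) + (\<integral>x. complex_of_real (g n x) * iexp (s * A n x) \<partial>M n)) / of_real (Z n)"
      using int_e int_ge by simp
    finally show ?thesis .
  qed
  have nz: "complex_of_real (2 + \<gamma>) \<noteq> 0" using g\<gamma> by (subst of_real_eq_0_iff) simp
  \<comment> \<open>The reweighted laws have the same limit \<nu> whatever \<gamma> is: numerator
    and normalisation both converge to 2 + \<gamma> times the respective limit, and this factor
    cancels.\<close>
  have "(\<lambda>n. char (distr (Q n) borel (A n)) s) \<longlonglongrightarrow> (2 * char \<nu> s + of_real \<gamma> * char \<nu> s) / of_real (2 + \<gamma>)" for s
    unfolding chQ by (intro tendsto_intros cA cg Zl nz)
  moreover have "(2 * char \<nu> s + of_real \<gamma> * char \<nu> s) / of_real (2 + \<gamma>) = char \<nu> s" for s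
    using nz by (simp add: field_simps)
  ultimately have "weak_conv_m (\<lambda>n. distr (Q n) borel (A n)) \<nu>"
    by (intro levy_continuity \<nu> Q.real_distribution_distr) auto
  then have "(\<lambda>n. integral\<^sup>L (distr (Q n) borel (A n)) u) \<longlonglongrightarrow> integral\<^sup>L \<nu> u"
    using u by (intro weak_conv_imp_integral_bdd_continuous_conv \<nu> Q.real_distribution_distr) auto
  then have "(\<lambda>n. Z n * integral\<^sup>L (distr (Q n) borel (A n)) u) \<longlonglongrightarrow> (2 + \<gamma>) * integral\<^sup>L \<nu> u"
    by (intro tendsto_intros Zl)
  moreover have "Z n * integral\<^sup>L (distr (Q n) borel (A n)) u
      = 2 * (\<integral>x. u (A n x) \<partial>M n) + (\<integral>x. g n x * u (A n x) \<partial>M n)" for n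
  proof -
    have "integral\<^sup>L (distr (Q n) borel (A n)) u = (\<integral>x. w n x *\<^sub>R u (A n x) \<partial>M n)"
      by (simp add: integral_distr) (simp add: Q_def integral_density w0)
    also have "\<dots> = (\<integral>x. (2 * u (A n x) + g n x * u (A n x)) / Z n \<partial>M n)"
      by (intro Bochner_Integration.integral_cong) (auto simp: w_def field_simps)
    also have "\<dots> = (2 * (\<integral>x. u (A n x) \<partial>M n) + (\<integral>x. g n x * u (A n x) \<partial>M n)) / Z n"
      using int_u int_gu by simp
    finally show ?thesis using Zge[of n] by simp
  qed
  ultimately have l1: "(\<lambda>n. 2 * (\<integral>x. u (A n x) \<partial>M n) + (\<integral>x. g n x * u (A n x) \<partial>M n))
      \<longlonglongrightarrow> (2 + \<gamma>) * integral\<^sup>L \<nu> u" by simp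
  \<comment> \<open>Unweighted convergence is needed as well, to subtract the contribution of the
    shift by 2.\<close>
  have "weak_conv_m (\<lambda>n. distr (M n) borel (A n)) \<nu>"
    using cA by (intro levy_continuity \<nu> M.real_distribution_distr) (auto simp: char_def integral_distr)
  then have "(\<lambda>n. integral\<^sup>L (distr (M n) borel (A n)) u) \<longlonglongrightarrow> integral\<^sup>L \<nu> u"
    using u by (intro weak_conv_imp_integral_bdd_continuous_conv \<nu> M.real_distribution_distr) auto
  then have l2: "(\<lambda>n. \<integral>x. u (A n x) \<partial>M n) \<longlonglongrightarrow> integral\<^sup>L \<nu> u"
    by (simp add: integral_distr)
  have "(\<lambda>n. (2 * (\<integral>x. u (A n x) \<partial>M n) + (\<integral>x. g n x * u (A n x) \<partial>M n)) - 2 * (\<integral>x. u (A n x) \<partial>M n))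
      \<longlonglongrightarrow> (2 + \<gamma>) * integral\<^sup>L \<nu> u - 2 * integral\<^sup>L \<nu> u"
    by (intro tendsto_intros l1 l2)
  then show ?thesis by (simp add: algebra_simps)
qed

lemma (in real_distribution) char_uminus: "char M (- t) = cnj (char M t)"
  using Bochner_Integration.integral_cnj[of M "\<lambda>x. iexp (t * x)"] by (simp add: char_def exp_cnj mult.assoc)

section \<open>Compactly supported test functions\<close>

lemma bounded_compact_support:
  fixes u :: "real \<Rightarrow> real"
  assumes "continuous_on UNIV u" "\<And>x. L < \<bar>x\<bar> \<Longrightarrow> u x = 0"
  obtains K where "\<And>x. \<bar>u x\<bar> \<le> K"
proof -
  have "compact (u ` {-L..L})"
    using assms(1) by (intro compact_continuous_image) (auto intro: continuous_on_subset)
  then obtain K where K: "\<And>x. x \<in> {-L..L} \<Longrightarrow> \<bar>u x\<bar> \<le> K"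
    by (metis bounded_iff compact_imp_bounded imageI real_norm_def)
  have "\<bar>u x\<bar> \<le> \<bar>K\<bar>" for x
  proof (cases "L < \<bar>x\<bar>")
    case False
    then have "x \<in> {-L..L}" by auto
    then show ?thesis using K by (meson abs_ge_self order_trans)
  qed (use assms(2)[of x] in auto)
  then show ?thesis using that by blast
qed

text \<open>The trapezoid equal to 1 on [-R, R] and to 0 off [-R - 1, R + 1]: a continuous
  substitute for the indicator of a large interval, by which tightness is expressed.\<close>

definition cutoff :: "real \<Rightarrow> real \<Rightarrow> real" where
  "cutoff R x = max 0 (min 1 (R + 1 - \<bar>x\<bar>))"

lemma cutoff: "0 \<le> cutoff R x" "cutoff R x \<le> 1" "R + 1 < \<bar>x\<bar> \<Longrightarrow> cutoff R x = 0"
  "continuous_on UNIV (cutoff R)"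
  unfolding cutoff_def by (auto intro!: continuous_intros)

lemma cutoff_limit:
  assumes "real_distribution \<nu>"
  shows "(\<lambda>k. \<integral>x. cutoff (real k) x \<partial>\<nu>) \<longlonglongrightarrow> 1"
proof -
  interpret \<nu>: real_distribution \<nu> by fact
  have [measurable]: "cutoff R \<in> borel_measurable borel" for R
    by (intro borel_measurable_continuous_onI cutoff)
  have "(\<lambda>k. \<integral>x. cutoff (real k) x \<partial>\<nu>) \<longlonglongrightarrow> (\<integral>x. 1 \<partial>\<nu>)"
  proof (rule integral_dominated_convergence[where w="\<lambda>_. 1"])
    show "AE x in \<nu>. (\<lambda>k. cutoff (real k) x) \<longlonglongrightarrow> 1"
    proof (rule AE_I2)
      fix x :: real
      have "cutoff (real k) x = 1" if "k \<ge> nat \<lceil>\<bar>x\<bar>\<rceil>" for k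
        using that by (auto simp: cutoff_def nat_ceiling_le_eq)
      then have "\<forall>\<^sub>F k in sequentially. cutoff (real k) x = 1"
        by (rule eventually_sequentiallyI)
      then show "(\<lambda>k. cutoff (real k) x) \<longlonglongrightarrow> 1" by (rule tendsto_eventually)
    qed
  qed (use cutoff(1,2) in auto)
  then show ?thesis using \<nu>.prob_space by simp
qed

text \<open>The limit of the joint characteristic functions factorises. This is what allows the two
  coordinates to be handled in turn by the one-dimensional continuity theorem.\<close>

locale asymp_indep =
  fixes M :: "nat \<Rightarrow> 'a measure" and A B :: "nat \<Rightarrow> 'a \<Rightarrow> real" and \<alpha> \<beta> :: "real measure"
  assumes M: "\<And>n. prob_space (M n)"
    and A[measurable]: "\<And>n. A n \<in> borel_measurable (M n)"
    and B[measurable]: "\<And>n. B n \<in> borel_measurable (M n)"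
    and \<alpha>: "real_distribution \<alpha>" and \<beta>: "real_distribution \<beta>"
    and char_conv: "\<And>s t. (\<lambda>n. \<integral>x. iexp (s * A n x + t * B n x) \<partial>M n) \<longlonglongrightarrow> char \<alpha> s * char \<beta> t"
begin

sublocale M: prob_space "M n" for n by (rule M)
sublocale \<alpha>: real_distribution \<alpha> by (rule \<alpha>)
sublocale \<beta>: real_distribution \<beta> by (rule \<beta>)
sublocale \<alpha>\<beta>: pair_prob_space \<alpha> \<beta> ..

text \<open>First exchange: the exponential in \<open>A\<close> becomes a bounded continuous
  function of \<open>A\<close>, while the exponential in \<open>B\<close> is kept as the weight.
  Weights must be real and bounded by 1, hence the split into cosine and sine.\<close>

lemma conv_left:
  fixes u :: "real \<Rightarrow> real"
  assumes u: "\<And>x. isCont u x" "\<And>x. \<bar>u x\<bar> \<le> K"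
  shows "(\<lambda>n. \<integral>x. complex_of_real (u (A n x)) * iexp (t * B n x) \<partial>M n) \<longlonglongrightarrow> (\<integral>x. u x \<partial>\<alpha>) * char \<beta> t"
proof -
  have [measurable]: "u \<in> borel_measurable borel"
    using u(1) by (intro borel_measurable_continuous_onI continuous_at_imp_continuous_on) auto
  have cA: "(\<lambda>n. \<integral>x. iexp (s * A n x) \<partial>M n) \<longlonglongrightarrow> char \<alpha> s" for s
    using char_conv[of s 0] by (simp add: \<beta>.char_zero)
  have int: "integrable (M n) (\<lambda>x. iexp (s * A n x + t * B n x))" for n s t
    by (intro M.integrable_const_bound[of _ 1]) auto
  have K0: "0 \<le> K" using u(2)[of 0] by linarith
  have intu: "integrable (M n) (\<lambda>x. f x * u (A n x))"
    if "f \<in> borel_measurable (M n)" "\<And>x. \<bar>f x\<bar> \<le> 1" for f :: "'a \<Rightarrow> real" and n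
  proof (intro M.integrable_const_bound[of _ K] AE_I2)
    fix x show "norm (f x * u (A n x)) \<le> K"
      using mult_mono[OF that(2)[of x] u(2)[of "A n x"]] by (simp add: abs_mult)
  qed (use that in auto)
  \<comment> \<open>The real part is the average of a number and its conjugate, so this weight
    combines the frequencies \<open>t\<close> and \<open>- t\<close>, at both of which the joint
    characteristic function converges. The choice k = 1 yields the cosine, k = - \<i> the
    sine.\<close>
  have re: "(\<lambda>n. \<integral>x. complex_of_real (Re (k * iexp (t * B n x))) * iexp (s * A n x) \<partial>M n)
      \<longlonglongrightarrow> complex_of_real (Re (k * char \<beta> t)) * char \<alpha> s" for k s
  proof -
    let ?I = "\<lambda>t n. \<integral>x. iexp (s * A n x + t * B n x) \<partial>M n"
    have "(\<integral>x. complex_of_real (Re (k * iexp (t * B n x))) * iexp (s * A n x) \<partial>M n) = (k * ?I t n + cnj k * ?I (- t) n) / 2" for n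
    proof -
      have "(\<integral>x. complex_of_real (Re (k * iexp (t * B n x))) * iexp (s * A n x) \<partial>M n)
         = (\<integral>x. (k * iexp (s * A n x + t * B n x) + cnj k * iexp (s * A n x + (-t) * B n x)) / 2 \<partial>M n)"
        by (intro Bochner_Integration.integral_cong refl)
          (simp add: complex_eq_iff Re_exp Im_exp cos_add sin_add cos_diff sin_diff algebra_simps)
      then show ?thesis using int[of n s t] int[of n s "- t"]
        by (simp only: integral_divide_zero integral_mult_right_zero Bochner_Integration.integral_add integrable_mult_right)
    qed
    moreover have "(k * (char \<alpha> s * char \<beta> t) + cnj k * (char \<alpha> s * char \<beta> (-t))) / 2 = complex_of_real (Re (k * char \<beta> t)) * char \<alpha> s"
      by (simp add: \<beta>.char_uminus complex_eq_iff field_simps)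
    moreover have "(\<lambda>n. (k * ?I t n + cnj k * ?I (- t) n) / 2) \<longlonglongrightarrow> (k * (char \<alpha> s * char \<beta> t) + cnj k * (char \<alpha> s * char \<beta> (-t))) / 2"
      by (intro tendsto_intros char_conv) simp
    ultimately show ?thesis by (simp only:)
  qed
  have cosl: "(\<lambda>n. \<integral>x. complex_of_real (cos (t * B n x)) * iexp (s * A n x) \<partial>M n)
      \<longlonglongrightarrow> complex_of_real (Re (char \<beta> t)) * char \<alpha> s" for s
    using re[of 1 s] by (simp add: Re_exp)
  have sinl: "(\<lambda>n. \<integral>x. complex_of_real (sin (t * B n x)) * iexp (s * A n x) \<partial>M n)
      \<longlonglongrightarrow> complex_of_real (Im (char \<beta> t)) * char \<alpha> s" for s
    using re[of "- \<i>" s] by (simp add: Im_exp)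
  have c: "(\<lambda>n. \<integral>x. cos (t * B n x) * u (A n x) \<partial>M n) \<longlonglongrightarrow> Re (char \<beta> t) * (\<integral>x. u x \<partial>\<alpha>)"
    by (rule char_weighted_imp_integral_conv[OF M A _ _ \<alpha> cA cosl u]) auto
  have s: "(\<lambda>n. \<integral>x. sin (t * B n x) * u (A n x) \<partial>M n) \<longlonglongrightarrow> Im (char \<beta> t) * (\<integral>x. u x \<partial>\<alpha>)"
    by (rule char_weighted_imp_integral_conv[OF M A _ _ \<alpha> cA sinl u]) auto
  have "(\<integral>x. complex_of_real (u (A n x)) * iexp (t * B n x) \<partial>M n)
     = Complex (\<integral>x. cos (t * B n x) * u (A n x) \<partial>M n) (\<integral>x. sin (t * B n x) * u (A n x) \<partial>M n)" for n
  proof -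
    have i: "integrable (M n) (\<lambda>x. complex_of_real (u (A n x)) * iexp (t * B n x))"
      using u(2) by (intro M.integrable_const_bound[of _ K]) (auto simp: norm_mult)
    show ?thesis
      using integral_Re[OF i] integral_Im[OF i]
      by (simp add: complex_eq_iff Re_exp Im_exp mult.commute)
  qed
  moreover have "(\<lambda>n. Complex (\<integral>x. cos (t * B n x) * u (A n x) \<partial>M n) (\<integral>x. sin (t * B n x) * u (A n x) \<partial>M n))
     \<longlonglongrightarrow> Complex (Re (char \<beta> t) * (\<integral>x. u x \<partial>\<alpha>)) (Im (char \<beta> t) * (\<integral>x. u x \<partial>\<alpha>))"
    by (intro tendsto_Complex c s)
  moreover have "Complex (Re (char \<beta> t) * (\<integral>x. u x \<partial>\<alpha>)) (Im (char \<beta> t) * (\<integral>x. u x \<partial>\<alpha>)) = (\<integral>x. u x \<partial>\<alpha>) * char \<beta> t"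
    by (simp add: complex_eq_iff mult.commute)
  ultimately show ?thesis by simp
qed

text \<open>Measurability and boundedness are bundled with the convergence because they are what
  lets the integral of a sum be split, making this class closed under linear combinations.\<close>

definition conv :: "(real \<times> real \<Rightarrow> real) \<Rightarrow> bool" where
  "conv w \<longleftrightarrow> w \<in> borel_measurable borel \<and> (\<exists>K. \<forall>z. \<bar>w z\<bar> \<le> K) \<and>
     (\<lambda>n. \<integral>x. w (A n x, B n x) \<partial>M n) \<longlonglongrightarrow> (\<integral>z. w z \<partial>(\<alpha> \<Otimes>\<^sub>M \<beta>))"

lemma pair_borel[measurable_cong]: "sets (\<alpha> \<Otimes>\<^sub>M \<beta>) = sets borel"
  by (simp add: borel_prod[symmetric] cong: sets_pair_measure_cong)

lemma integrable_sample:
  assumes [measurable]: "w \<in> borel_measurable borel" and "\<And>z. \<bar>w z\<bar> \<le> (K::real)"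
  shows "integrable (M n) (\<lambda>x. w (A n x, B n x))"
  using assms(2) by (intro M.integrable_const_bound[of _ K]) auto

lemma integrable_limit:
  assumes [measurable]: "w \<in> borel_measurable borel" and "\<And>z. \<bar>w z\<bar> \<le> (K::real)"
  shows "integrable (\<alpha> \<Otimes>\<^sub>M \<beta>) w"
  using assms(2) by (intro \<alpha>\<beta>.integrable_const_bound[of _ K]) auto

lemma conv_add: assumes "conv w" "conv w'" shows "conv (\<lambda>z. w z + w' z)"
proof -
  obtain K K' where K: "\<And>z. \<bar>w z\<bar> \<le> K" "\<And>z. \<bar>w' z\<bar> \<le> K'" using assms unfolding conv_def by blast
  have m[measurable]: "w \<in> borel_measurable borel" "w' \<in> borel_measurable borel"
    using assms by (auto simp: conv_def)
  have "\<bar>w z + w' z\<bar> \<le> K + K'" for z using K[of z] by linarith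
  moreover note integrable_sample[OF m(1) K(1)] integrable_sample[OF m(2) K(2)]
    integrable_limit[OF m(1) K(1)] integrable_limit[OF m(2) K(2)]
  ultimately show ?thesis
    using assms by (auto simp: conv_def intro!: tendsto_add)
qed

lemma conv_cmult: assumes "conv w" shows "conv (\<lambda>z. c * w z)"
proof -
  obtain K where K: "\<And>z. \<bar>w z\<bar> \<le> K" using assms unfolding conv_def by blast
  then have "\<bar>c * w z\<bar> \<le> \<bar>c\<bar> * K" for z by (simp add: abs_mult mult_left_mono)
  then show ?thesis using assms by (auto simp: conv_def intro!: tendsto_mult)
qed

text \<open>Second exchange: now \<open>B\<close> is the variable and the function of
  \<open>A\<close> is the weight; \<open>conv_left\<close> supplies the weighted characteristic
  functions.\<close>

lemma conv_product:
  fixes u v :: "real \<Rightarrow> real"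
  assumes u: "\<And>x. isCont u x" "\<And>x. \<bar>u x\<bar> \<le> K" and v: "\<And>x. isCont v x" "\<And>x. \<bar>v x\<bar> \<le> L"
  shows "conv (\<lambda>(x, y). u x * v y)"
proof -
  have [measurable]: "u \<in> borel_measurable borel" "v \<in> borel_measurable borel"
    using u(1) v(1) by (auto intro!: borel_measurable_continuous_onI continuous_at_imp_continuous_on)
  have K0: "0 \<le> K" and L0: "0 \<le> L" using u(2)[of 0] v(2)[of 0] by linarith+
  have bd: "\<bar>u x * v y\<bar> \<le> K * L" for x y
    using mult_mono[OF u(2)[of x] v(2)[of y]] K0 by (simp add: abs_mult)
  \<comment> \<open>Scales the weight into [-1, 1]; the summand 1 keeps the divisor positive when K
    = 0.\<close>
  define u' where "u' x = u x / (K + 1)" for x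
  have u': "isCont u' x" "\<bar>u' x\<bar> \<le> 1" for x
    unfolding u'_def using u(2)[of x] u(1) K0 by (auto simp: abs_mult divide_le_eq intro!: continuous_intros)
  have [measurable]: "u' \<in> borel_measurable borel" unfolding u'_def by measurable
  have cB: "(\<lambda>n. \<integral>x. iexp (t * B n x) \<partial>M n) \<longlonglongrightarrow> char \<beta> t" for t
    using char_conv[of 0 t] by (simp add: \<alpha>.char_zero)
  have "(\<lambda>n. \<integral>x. u' (A n x) * v (B n x) \<partial>M n) \<longlonglongrightarrow> (\<integral>x. u' x \<partial>\<alpha>) * (\<integral>y. v y \<partial>\<beta>)"
    by (rule char_weighted_imp_integral_conv[OF M B _ _ \<beta> cB conv_left[of u' 1] v]) (use u' in auto)
  then have "(\<lambda>n. (K + 1) * (\<integral>x. u' (A n x) * v (B n x) \<partial>M n)) \<longlonglongrightarrow> (K + 1) * ((\<integral>x. u' x \<partial>\<alpha>) * (\<integral>y. v y \<partial>\<beta>))"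
    by (intro tendsto_intros)
  then have lim: "(\<lambda>n. \<integral>x. u (A n x) * v (B n x) \<partial>M n) \<longlonglongrightarrow> (\<integral>x. u x \<partial>\<alpha>) * (\<integral>y. v y \<partial>\<beta>)"
    using K0 by (simp add: u'_def)
  have i: "integrable (\<alpha> \<Otimes>\<^sub>M \<beta>) (\<lambda>(x, y). u x * v y)"
    using bd by (intro \<alpha>\<beta>.integrable_const_bound[of _ "K * L"])
      (auto simp: borel_prod[symmetric] cong: measurable_cong_sets)
  have "(\<integral>z. (case z of (x, y) \<Rightarrow> u x * v y) \<partial>(\<alpha> \<Otimes>\<^sub>M \<beta>)) = (\<integral>x. u x \<partial>\<alpha>) * (\<integral>y. v y \<partial>\<beta>)"
    using \<alpha>\<beta>.integral_fst[OF i] by simp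
  moreover have "(\<lambda>(x, y). u x * v y) \<in> borel_measurable borel"
    unfolding borel_prod[symmetric] by measurable
  ultimately show ?thesis using lim bd by (auto simp: conv_def)
qed

definition bump :: "real \<Rightarrow> (real \<Rightarrow> real) \<Rightarrow> bool" where
  "bump L u \<longleftrightarrow> continuous_on UNIV u \<and> (\<forall>x. L < \<bar>x\<bar> \<longrightarrow> u x = 0)"

text \<open>Quantifying over all bumps makes the class stable under multiplication by the
  coordinates: \<open>x * u x\<close> is a bump with the same support bound.\<close>

definition test :: "real \<Rightarrow> (real \<times> real \<Rightarrow> real) \<Rightarrow> bool" where
  "test L w \<longleftrightarrow> (\<forall>u v. bump L u \<longrightarrow> bump L v \<longrightarrow> conv (\<lambda>(x, y). w (x, y) * (u x * v y)))"

lemma testD: "test L w \<Longrightarrow> bump L u \<Longrightarrow> bump L v \<Longrightarrow> conv (\<lambda>(x, y). w (x, y) * (u x * v y))"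
  unfolding test_def by blast

lemma test_one: "test L (\<lambda>_. 1)"
  unfolding test_def
proof (intro allI impI)
  fix u v assume uv: "bump L u" "bump L v"
  obtain K where "\<And>x. \<bar>u x\<bar> \<le> K" using bounded_compact_support[of u L] uv unfolding bump_def by blast
  moreover obtain K' where "\<And>x. \<bar>v x\<bar> \<le> K'" using bounded_compact_support[of v L] uv unfolding bump_def by blast
  ultimately have "conv (\<lambda>(x, y). u x * v y)"
    using uv by (intro conv_product) (auto simp: bump_def continuous_on_eq_continuous_at)
  then show "conv (\<lambda>(x, y). 1 * (u x * v y))" by simp
qed

text \<open>In the linear case the factors x and y are absorbed into the bumps. The arbitrary
  \<open>f\<close> in the induction turns the product case into two successive uses of the induction
  hypotheses.\<close>

lemma test_mult_polynomial:
  assumes "real_polynomial_function p" "test L f"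
  shows "test L (\<lambda>z. f z * p z)"
  using assms
proof (induction p arbitrary: f)
  case (linear h)
  define a b where "a = h (1, 0)" and "b = h (0, 1)"
  interpret h: bounded_linear h by fact
  have h: "h (x, y) = x * a + y * b" for x y
  proof -
    have "(x, y) = x *\<^sub>R (1, 0) + y *\<^sub>R (0, 1)" by simp
    then have "h (x, y) = x *\<^sub>R h (1, 0) + y *\<^sub>R h (0, 1)" by (metis h.add h.scaleR)
    then show ?thesis by (simp add: a_def b_def)
  qed
  show ?case
    unfolding test_def
  proof (intro allI impI)
    fix u v assume uv: "bump L u" "bump L v"
    have "conv (\<lambda>z. a * (case z of (x, y) \<Rightarrow> f (x, y) * ((x * u x) * v y)) + b * (case z of (x, y) \<Rightarrow> f (x, y) * (u x * (y * v y))))"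
      using uv by (intro conv_add conv_cmult testD[OF linear(2)]) (auto simp: bump_def intro!: continuous_intros)
    moreover have "(\<lambda>z. a * (case z of (x, y) \<Rightarrow> f (x, y) * ((x * u x) * v y)) + b * (case z of (x, y) \<Rightarrow> f (x, y) * (u x * (y * v y))))
      = (\<lambda>(x, y). f (x, y) * h (x, y) * (u x * v y))"
      by (auto simp: h algebra_simps)
    ultimately show "conv (\<lambda>(x, y). f (x, y) * h (x, y) * (u x * v y))" by simp
  qed
next
  case (const c)
  show ?case
    unfolding test_def
  proof (intro allI impI)
    fix u v assume uv: "bump L u" "bump L v"
    have "conv (\<lambda>z. c * (case z of (x, y) \<Rightarrow> f (x, y) * (u x * v y)))"
      by (intro conv_cmult testD[OF const] uv)
    then show "conv (\<lambda>(x, y). f (x, y) * c * (u x * v y))"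
      by (simp add: case_prod_beta' mult_ac)
  qed
next
  case (add p q)
  note t = add.IH(1)[OF add.prems] add.IH(2)[OF add.prems]
  show ?case
    unfolding test_def
  proof (intro allI impI)
    fix u v assume uv: "bump L u" "bump L v"
    have "conv (\<lambda>z. (case z of (x, y) \<Rightarrow> f (x, y) * p (x, y) * (u x * v y)) + (case z of (x, y) \<Rightarrow> f (x, y) * q (x, y) * (u x * v y)))"
      by (intro conv_add testD[OF t(1)] testD[OF t(2)] uv)
    then show "conv (\<lambda>(x, y). f (x, y) * (p (x, y) + q (x, y)) * (u x * v y))"
      by (simp add: case_prod_beta' algebra_simps)
  qed
next
  case (mult p q)
  show ?case using mult.IH(2)[OF mult.IH(1)[OF mult.prems]] by (simp add: mult.assoc)
qed

text \<open>Stone-Weierstrass replaces \<open>f\<close> on a large square by a polynomial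
  \<open>p\<close>, for which convergence is known after multiplication by the cutoff
  \<open>c\<close>. The mass missed by the cutoff is small in the limit law, hence also in the
  sample laws for large n, since \<open>c\<close> is itself a test function of class
  \<open>conv\<close>.\<close>

lemma conv_continuous:
  fixes f :: "real \<times> real \<Rightarrow> real"
  assumes f: "continuous_on UNIV f" and K: "\<And>z. \<bar>f z\<bar> \<le> K"
  shows "(\<lambda>n. \<integral>x. f (A n x, B n x) \<partial>M n) \<longlonglongrightarrow> (\<integral>z. f z \<partial>(\<alpha> \<Otimes>\<^sub>M \<beta>))"
proof (rule LIMSEQ_I)
  fix e :: real assume e: "0 < e"
  have K0: "0 \<le> K" using K[of 0] by linarith
  have fm[measurable]: "f \<in> borel_measurable borel" by (intro borel_measurable_continuous_onI f)
  \<comment> \<open>The three differences at the end add up to less than 2 (K + 1) d, which is e /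
    2.\<close>
  define d where "d = e / (4 * (K + 1))"
  have d: "0 < d" "4 * (K + 1) * d = e" using e K0 by (auto simp: d_def field_simps)
  have "(\<lambda>k. (\<integral>x. cutoff (real k) x \<partial>\<alpha>) * (\<integral>x. cutoff (real k) x \<partial>\<beta>)) \<longlonglongrightarrow> 1 * 1"
    by (intro tendsto_mult cutoff_limit \<alpha> \<beta>)
  then have "\<forall>\<^sub>F k in sequentially. 1 - d / 2 < (\<integral>x. cutoff (real k) x \<partial>\<alpha>) * (\<integral>x. cutoff (real k) x \<partial>\<beta>)"
    using d by (intro order_tendstoD) auto
  then obtain k where k: "1 - d / 2 < (\<integral>x. cutoff (real k) x \<partial>\<alpha>) * (\<integral>x. cutoff (real k) x \<partial>\<beta>)"
    by (auto simp: eventually_sequentially)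
  define R where "R = real k"
  define c where "c = (\<lambda>(x, y). cutoff R x * cutoff R y)"
  define S where "S = {-(R+1)..R+1} \<times> {-(R+1)..R+1}"
  have "compact S" unfolding S_def by (intro compact_Times) auto
  then obtain p where p: "real_polynomial_function p" "\<And>z. z \<in> S \<Longrightarrow> \<bar>f z - p z\<bar> < d / 2"
    using Stone_Weierstrass_real_polynomial_function[of S f "d / 2"] d f
    by (metis continuous_on_subset half_gt_zero top_greatest)
  have "test (R + 1) (\<lambda>z. 1 * p z)"
    by (rule test_mult_polynomial[OF p(1) test_one])
  then have t: "test (R + 1) p" by simp
  define H where "H z = p z * c z" for z
  have "conv (\<lambda>(x, y). p (x, y) * (cutoff R x * cutoff R y))"
    by (rule testD[OF t]) (auto simp: bump_def intro: cutoff)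
  then have convH: "conv H" by (simp add: H_def[abs_def] c_def case_prod_beta')
  have cc: "\<bar>cutoff R x\<bar> \<le> 1" for x using cutoff(1,2)[of R x] by simp
  have convc: "conv c"
    unfolding c_def using cutoff(4)[of R] cc
    by (intro conv_product[of _ 1 _ 1]) (auto simp: continuous_on_eq_continuous_at)
  have cm: "c \<in> borel_measurable borel" and Hm: "H \<in> borel_measurable borel"
    using convc convH by (auto simp: conv_def)
  obtain KH where KH: "\<And>z. \<bar>H z\<bar> \<le> KH" using convH unfolding conv_def by blast
  have c01: "0 \<le> c z" "c z \<le> 1" for z
    by (auto simp: c_def cutoff mult_le_one split: prod.split)
  have cK: "\<bar>c z\<bar> \<le> 1" for z using c01[of z] by simp
  \<comment> \<open>Valid on the whole plane although \<open>p\<close> is close to \<open>f\<close>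
    only on \<open>S\<close>, because \<open>c\<close> vanishes off \<open>S\<close>.\<close>
  have key: "\<bar>f z - H z\<bar> \<le> K * (1 - c z) + d / 2" for z
  proof (cases "z \<in> S")
    case True
    have "\<bar>f z - H z\<bar> = \<bar>f z * (1 - c z) + (f z - p z) * c z\<bar>" by (simp add: H_def algebra_simps)
    also have "\<dots> \<le> \<bar>f z\<bar> * (1 - c z) + \<bar>f z - p z\<bar> * c z"
      using c01[of z] abs_triangle_ineq[of "f z * (1 - c z)" "(f z - p z) * c z"] by (simp add: abs_mult)
    also have "\<dots> \<le> K * (1 - c z) + d / 2 * 1"
      using c01[of z] K[of z] p(2)[OF True] d by (intro add_mono mult_mono) auto
    finally show ?thesis by simp
  next
    case False
    then have "c z = 0" by (auto simp: S_def c_def cutoff_def split: prod.split)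
    then show ?thesis using K[of z] d by (simp add: H_def)
  qed
  note ints = integrable_sample[OF fm K] integrable_sample[OF Hm KH] integrable_sample[OF cm cK]
  note intl = integrable_limit[OF fm K] integrable_limit[OF Hm KH] integrable_limit[OF cm cK]
  define Tn where "Tn w n = (\<integral>x. w (A n x, B n x) \<partial>M n)" for w :: "real \<times> real \<Rightarrow> real" and n
  define T where "T w = (\<integral>z. w z \<partial>(\<alpha> \<Otimes>\<^sub>M \<beta>))" for w :: "real \<times> real \<Rightarrow> real"
  have b1: "\<bar>Tn f n - Tn H n\<bar> \<le> K * (1 - Tn c n) + d / 2" for n
  proof -
    have "\<bar>Tn f n - Tn H n\<bar> = \<bar>\<integral>x. f (A n x, B n x) - H (A n x, B n x) \<partial>M n\<bar>"
      unfolding Tn_def by (subst Bochner_Integration.integral_diff) (use ints in auto)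
    also have "\<dots> \<le> (\<integral>x. K * (1 - c (A n x, B n x)) + d / 2 \<partial>M n)"
      using ints key by (intro order_trans[OF integral_abs_bound] integral_mono) auto
    also have "\<dots> = K * (1 - Tn c n) + d / 2"
      using ints by (simp add: Tn_def M.prob_space)
    finally show ?thesis .
  qed
  have b2: "\<bar>T f - T H\<bar> \<le> K * (1 - T c) + d / 2"
  proof -
    have "\<bar>T f - T H\<bar> = \<bar>\<integral>z. f z - H z \<partial>(\<alpha> \<Otimes>\<^sub>M \<beta>)\<bar>"
      unfolding T_def by (subst Bochner_Integration.integral_diff) (use intl in auto)
    also have "\<dots> \<le> (\<integral>z. K * (1 - c z) + d / 2 \<partial>(\<alpha> \<Otimes>\<^sub>M \<beta>))"
      using intl key by (intro order_trans[OF integral_abs_bound] integral_mono) auto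
    also have "\<dots> = K * (1 - T c) + d / 2"
      using intl by (simp add: T_def \<alpha>\<beta>.prob_space)
    finally show ?thesis .
  qed
  have Tc: "1 - d / 2 < T c"
  proof -
    have i: "integrable (\<alpha> \<Otimes>\<^sub>M \<beta>) (\<lambda>(x, y). cutoff R x * cutoff R y)"
      using intl(3) by (simp add: c_def)
    have "T c = (\<integral>x. cutoff R x \<partial>\<alpha>) * (\<integral>x. cutoff R x \<partial>\<beta>)"
      using \<alpha>\<beta>.integral_fst[OF i] by (simp add: T_def c_def)
    then show ?thesis using k by (simp add: R_def)
  qed
  have "Tn c \<longlonglongrightarrow> T c" "Tn H \<longlonglongrightarrow> T H"
    using convc convH by (auto simp: conv_def Tn_def[abs_def] T_def)
  then have "\<forall>\<^sub>F n in sequentially. T c - d / 2 < Tn c n \<and> dist (Tn H n) (T H) < d"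
    using d by (intro eventually_conj order_tendstoD(1) tendstoD) auto
  then obtain N where N: "\<And>n. n \<ge> N \<Longrightarrow> T c - d / 2 < Tn c n \<and> dist (Tn H n) (T H) < d"
    by (auto simp: eventually_sequentially)
  have "norm (Tn f n - T f) < e" if "n \<ge> N" for n
  proof -
    have "K * (1 - Tn c n) \<le> K * d" "K * (1 - T c) \<le> K * d"
      using N[OF that] Tc K0 d by (auto intro!: mult_left_mono)
    then have "\<bar>Tn f n - T f\<bar> < 2 * (K * d) + 2 * d"
      using b1[of n] b2 N[OF that] unfolding dist_real_def by linarith
    also have "\<dots> \<le> 4 * (K + 1) * d" using mult_nonneg_nonneg[OF K0 less_imp_le[OF d(1)]] d(1) by (simp add: ring_distribs)
    finally show ?thesis using d by simp
  qed
  then show "\<exists>N. \<forall>n\<ge>N. norm ((\<integral>x. f (A n x, B n x) \<partial>M n) - (\<integral>z. f z \<partial>(\<alpha> \<Otimes>\<^sub>M \<beta>))) < e"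
    unfolding Tn_def T_def by blast
qed

end

section \<open>The score\<close>

text \<open>The n-th power is the characteristic function of a normalised i.i.d. sum, realised by
  the coordinates of an infinite product of the law of \<open>f\<close>. The central limit theorem
  divides by \<open>sqrt (n * \<tau>\<^sup>2)\<close>, which moves the factor \<tau> into the
  frequency.\<close>

lemma iid_char_conv:
  fixes f :: "'a \<Rightarrow> real"
  assumes P: "prob_space P" and f[measurable]: "f \<in> borel_measurable P"
    and sq: "integrable P (\<lambda>x. (f x)\<^sup>2)" and mean: "(\<integral>x. f x \<partial>P) = 0"
    and var: "(\<integral>x. (f x)\<^sup>2 \<partial>P) = \<tau>\<^sup>2" and \<tau>: "0 < \<tau>"
  shows "(\<lambda>n. (\<integral>x. iexp (t * f x / sqrt n) \<partial>P) ^ n) \<longlonglongrightarrow> char std_normal_distribution (t * \<tau>)"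
proof -
  interpret P0: prob_space P by fact
  define \<mu> where "\<mu> = distr P borel f"
  interpret \<mu>: real_distribution \<mu> unfolding \<mu>_def by (rule P0.real_distribution_distr) simp
  have sets\<mu>: "sets \<mu> = sets borel" by (simp add: \<mu>_def)
  interpret product_prob_space "\<lambda>_. \<mu>" "UNIV :: nat set"
    by (rule product_prob_spaceI) unfold_locales
  define M where "M = PiM (UNIV :: nat set) (\<lambda>_. \<mu>)"
  interpret M: prob_space M unfolding M_def by (rule prob_space_PiM) unfold_locales
  have c[measurable]: "(\<lambda>w. w i) \<in> measurable M borel" for i
    using measurable_component_singleton[of i UNIV "\<lambda>_. \<mu>"] sets\<mu> by (simp add: M_def cong: measurable_cong_sets)
  have X: "distr M borel (\<lambda>w. w i) = \<mu>" for i
    using PiM_component[of i] unfolding M_def[symmetric]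
    by (subst distr_cong[of M M borel \<mu> "\<lambda>w. w i" "\<lambda>w. w i"]) (auto simp: sets\<mu>)
  have sM: "sets M = sets (PiM (UNIV :: nat set) (\<lambda>_. borel :: real measure))"
    unfolding M_def by (intro sets_PiM_cong) (auto simp: sets\<mu>)
  have "distr M (PiM UNIV (\<lambda>_. borel)) (\<lambda>x. x) = M" by (intro distr_id2) (simp add: sM)
  then have indep: "M.indep_vars (\<lambda>_. borel) (\<lambda>i w. w i) (UNIV :: nat set)"
    by (subst M.indep_vars_iff_distr_eq_PiM) (auto simp: X restrict_UNIV, simp add: M_def)
  have m1: "(\<integral>w. w n \<partial>M) = 0" for n
    using integral_distr[OF c, of "\<lambda>x. x" n] mean by (simp add: X \<mu>_def integral_distr)
  have sq\<mu>: "integrable \<mu> (\<lambda>x. x\<^sup>2)" using sq by (simp add: \<mu>_def integrable_distr_eq)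
  have m2: "integrable M (\<lambda>w. (w n)\<^sup>2)" for n
    using integrable_distr_eq[OF c, of "\<lambda>x. x\<^sup>2" n] sq\<mu> by (simp add: X)
  have m3: "(\<integral>w. (w n)\<^sup>2 \<partial>M) = \<tau>\<^sup>2" for n
    using integral_distr[OF c, of "\<lambda>x. x\<^sup>2" n] var by (simp add: X \<mu>_def integral_distr)
  have "weak_conv_m (\<lambda>n. distr M borel (\<lambda>x. (\<Sum>i<n. x i) / sqrt (n * \<tau>\<^sup>2))) std_normal_distribution"
    by (rule M.central_limit_theorem_zero_mean[OF indep m1 \<tau> m2 _ X]) (simp add: m1 m3)
  then have lim: "(\<lambda>n. char (distr M borel (\<lambda>x. (\<Sum>i<n. x i) / sqrt (n * \<tau>\<^sup>2))) (t * \<tau>)) \<longlonglongrightarrow> char std_normal_distribution (t * \<tau>)"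
    by (intro levy_continuity1 M.real_distribution_distr real_dist_normal_dist) auto
  have "char (distr M borel (\<lambda>x. (\<Sum>i<n. x i) / sqrt (n * \<tau>\<^sup>2))) (t * \<tau>) = (\<integral>x. iexp (t * f x / sqrt n) \<partial>P) ^ n" for n :: nat
  proof -
    have "char (distr M borel (\<lambda>x. (\<Sum>i<n. x i) / sqrt (n * \<tau>\<^sup>2))) (t * \<tau>) = char (distr M borel (\<lambda>x. \<Sum>i<n. x i)) (t / sqrt n)"
      using \<tau> by (simp add: char_def integral_distr real_sqrt_mult)
    also have "\<dots> = (\<Prod>i<n. char (distr M borel (\<lambda>x. x i)) (t / sqrt n))"
      by (rule M.char_distr_sum[OF M.indep_vars_subset[OF indep]]) simp
    also have "\<dots> = (\<integral>x. iexp (t * f x / sqrt n) \<partial>P) ^ n"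
      by (simp add: X) (simp add: \<mu>_def char_def integral_distr)
    finally show ?thesis .
  qed
  then show ?thesis using lim by simp
qed

lemma prob_space_density: "prob_density f \<Longrightarrow> prob_space (density lborel (\<lambda>z. ennreal (f z)))"
  by (rule prob_spaceI) (simp add: prob_density_def emeasure_density cong: nn_integral_cong)

locale qmd_family =
  fixes h :: "real \<Rightarrow> real \<times> real \<Rightarrow> real"
  assumes dens: "\<And>\<theta>. \<bar>\<theta>\<bar> < 1 \<Longrightarrow> prob_density (h \<theta>)"
    and ldd: "log_density_differentiable h"
    and qmd: "qmd_at_0 h"
    and fi: "0 < fisher_information_0 h"
begin

lemma h_meas[measurable]: "\<bar>\<theta>\<bar> < 1 \<Longrightarrow> h \<theta> \<in> borel_measurable borel"
  using dens by (simp add: prob_density_def)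

lemma h_nonneg: "\<bar>\<theta>\<bar> < 1 \<Longrightarrow> 0 \<le> h \<theta> z"
  using dens unfolding prob_density_def by blast

text \<open>Nonzero parameters tending to 0; the 2 in the denominator keeps all of them below 1,
  where \<open>h\<close> is known to be a density.\<close>

definition step_seq :: "nat \<Rightarrow> real" where "step_seq k = 1 / (real k + 2)"

lemma step_seq: "0 < step_seq k" "step_seq k < 1" "\<bar>step_seq k\<bar> < 1"
  by (auto simp: step_seq_def)

lemma step_seq_lim: "filterlim step_seq (at 0) sequentially"
proof -
  have "step_seq \<longlonglongrightarrow> 0"
    unfolding step_seq_def using LIMSEQ_ignore_initial_segment[OF lim_inverse_n', of 2] by (simp add: add_ac)
  then show ?thesis using step_seq by (intro filterlim_atI) (auto simp: eventually_sequentially less_imp_neq[THEN not_sym])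
qed

text \<open>A pointwise limit of difference quotients along \<open>step_seq\<close>, each of which
  is Borel. Where \<open>h 0\<close> vanishes both sides are 0 by convention.\<close>

lemma score_meas: "score h \<in> borel_measurable borel"
proof (rule borel_measurable_LIMSEQ_real)
  define f where "f k z = (if 0 < h 0 z then (ln (h (step_seq k) z) - ln (h 0 z)) / step_seq k else 0)" for k z
  have [measurable]: "h 0 \<in> borel_measurable borel" "h (step_seq k) \<in> borel_measurable borel" for k
    using step_seq(3) by (auto intro: h_meas)
  show "f k \<in> borel_measurable borel" for k unfolding f_def by measurable
  show "(\<lambda>k. f k z) \<longlonglongrightarrow> score h z" for z
  proof (cases "0 < h 0 z")
    case True
    then have "(\<lambda>\<theta>. ln (h \<theta> z)) differentiable (at 0)" using ldd unfolding log_density_differentiable_def by blast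
    then have "DERIV (\<lambda>\<theta>. ln (h \<theta> z)) 0 :> deriv (\<lambda>\<theta>. ln (h \<theta> z)) 0"
      by (metis DERIV_imp_deriv real_differentiable_def)
    then have "((\<lambda>t. (ln (h (0 + t) z) - ln (h 0 z)) / t) \<longlongrightarrow> deriv (\<lambda>\<theta>. ln (h \<theta> z)) 0) (at 0)"
      by (simp add: DERIV_def)
    from filterlim_compose[OF this step_seq_lim] True show ?thesis by (simp add: f_def score_def)
  qed (simp add: f_def score_def)
qed

lemma prob_pair: "prob_space (pair_law h 0)"
  unfolding pair_law_def by (rule prob_space_density) (simp add: dens)

lemma sets_pair: "sets (pair_law h 0) = sets borel" by (simp add: pair_law_def)

lemma score_meas_pair: "score h \<in> borel_measurable (pair_law h 0)"
  using score_meas by (simp add: sets_pair cong: measurable_cong_sets)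

text \<open>The Bochner integral of a non-integrable function is 0, so positive Fisher information
  already forces square integrability.\<close>

lemma score_sq: "integrable (pair_law h 0) (\<lambda>z. (score h z)\<^sup>2)"
  using fi not_integrable_integral_eq[of "pair_law h 0" "\<lambda>z. (score h z)\<^sup>2"] unfolding fisher_information_0_def by fastforce

text \<open>With a = \<open>sqrt (h 0)\<close>, write \<open>sqrt (h \<theta>)\<close> as a +
  \<theta> u + r, where the squared norm of r is o(\<open>\<theta>\<^sup>2\<close>). All densities
  have integral 1, so comparing squared norms gives 0 = 2 \<theta> <a, u> + 2 <a, r> +
  O(\<open>\<theta>\<^sup>2\<close>). Division by \<theta> leaves <a, u> = 0, and 2 <a, u> is the
  mean of the score.\<close>

lemma score_mean: "(\<integral>z. score h z \<partial>pair_law h 0) = 0"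
proof -
  interpret pair: prob_space "pair_law h 0" by (rule prob_pair)
  have m0[measurable]: "h 0 \<in> borel_measurable borel" "h (step_seq k) \<in> borel_measurable borel" for k
    using step_seq(3) by (auto intro: h_meas)
  note [measurable] = score_meas
  have nn: "0 \<le> h 0 z" "0 \<le> h (step_seq k) z" for z k using h_nonneg step_seq(3) by auto
  \<comment> \<open>\<open>u\<close> is the derivative of the square root of the density in
    quadratic mean.\<close>
  define a u where "a z = sqrt (h 0 z)" and "u z = score h z * a z / 2" for z
  have [measurable]: "a \<in> borel_measurable borel" unfolding a_def[abs_def] by measurable
  have [measurable]: "u \<in> borel_measurable borel" unfolding u_def[abs_def] by measurable
  have a2: "(a z)\<^sup>2 = h 0 z" for z using nn by (simp add: a_def)
  have hint: "integrable lborel (h \<theta>)" "(\<integral>z. h \<theta> z \<partial>lborel) = 1" if "\<bar>\<theta>\<bar> < 1" for \<theta>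
  proof -
    have "(\<integral>\<^sup>+z. ennreal (h \<theta> z) \<partial>lborel) = ennreal 1" using dens[OF that] by (simp add: prob_density_def)
    then have "has_bochner_integral lborel (h \<theta>) 1"
      using h_nonneg[OF that] h_meas[OF that] by (intro has_bochner_integral_nn_integral) auto
    then show "integrable lborel (h \<theta>)" "(\<integral>z. h \<theta> z \<partial>lborel) = 1" by (auto simp: has_bochner_integral_iff)
  qed
  have ia: "integrable lborel (\<lambda>z. (a z)\<^sup>2)" "(\<integral>z. (a z)\<^sup>2 \<partial>lborel) = 1" using hint[of 0] by (simp_all add: a2)
  have isc: "integrable (pair_law h 0) (score h)"
    by (rule pair.square_integrable_imp_integrable[OF score_meas_pair score_sq])
  have iu: "integrable lborel (\<lambda>z. (u z)\<^sup>2)"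
  proof -
    have "integrable lborel (\<lambda>z. h 0 z *\<^sub>R (score h z)\<^sup>2)"
      using score_sq nn unfolding pair_law_def by (subst (asm) integrable_density) auto
    then have "integrable lborel (\<lambda>z. (1 / 4) * (h 0 z *\<^sub>R (score h z)\<^sup>2))" by (rule integrable_mult_right)
    then show ?thesis by (simp add: u_def power_mult_distrib power_divide a2 mult.commute)
  qed
  have iau: "integrable lborel (\<lambda>z. a z * u z)" "(\<integral>z. score h z \<partial>pair_law h 0) = 2 * (\<integral>z. a z * u z \<partial>lborel)"
  proof -
    have eq: "h 0 z *\<^sub>R score h z = 2 * (a z * u z)" for z by (simp add: u_def a2[symmetric] power2_eq_square)
    have "integrable lborel (\<lambda>z. h 0 z *\<^sub>R score h z)"
      using isc nn unfolding pair_law_def by (subst (asm) integrable_density) auto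
    then show "integrable lborel (\<lambda>z. a z * u z)" unfolding eq by simp
    have "(\<integral>z. score h z \<partial>pair_law h 0) = (\<integral>z. h 0 z *\<^sub>R score h z \<partial>lborel)"
      using nn unfolding pair_law_def by (subst integral_density) auto
    then show "(\<integral>z. score h z \<partial>pair_law h 0) = 2 * (\<integral>z. a z * u z \<partial>lborel)" unfolding eq by simp
  qed
  define r where "r k z = sqrt (h (step_seq k) z) - a z - step_seq k * u z" for k z
  have rm[measurable]: "r k \<in> borel_measurable borel" for k unfolding r_def[abs_def] by measurable
  define Q where "Q k = (\<integral>\<^sup>+z. ennreal ((r k z)\<^sup>2) \<partial>lborel) / ennreal ((step_seq k)\<^sup>2)" for k
  have Ql: "Q \<longlonglongrightarrow> 0"
    using filterlim_compose[OF qmd[unfolded qmd_at_0_def] step_seq_lim]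
    by (simp add: Q_def[abs_def] r_def u_def a_def mult_ac)
  \<comment> \<open>The extended integral may be infinite for some \<open>k\<close>; only from here
    on is the remainder known to be square integrable.\<close>
  have ev: "\<forall>\<^sub>F k in sequentially. Q k < 1" using Ql by (rule order_tendstoD) simp
  define q where "q k = enn2real (Q k)" for k
  have ql: "q \<longlonglongrightarrow> 0" using tendsto_enn2real[of Q 0] Ql by (simp add: q_def[abs_def])
  define K where "K = (\<integral>z. (u z)\<^sup>2 \<partial>lborel)"
  \<comment> \<open>The free parameter \<epsilon> comes from the weighted inequality 2 |a r| \<le>
    \<theta> \<epsilon> \<open>a\<^sup>2\<close> + \<open>r\<^sup>2\<close> / (\<theta> \<epsilon>).
    Afterwards \<open>k\<close> tends to infinity for fixed \<epsilon>, and \<epsilon> to 0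
    last.\<close>
  have main: "\<bar>2 * (\<integral>z. a z * u z \<partial>lborel)\<bar> \<le> \<epsilon> + q k / \<epsilon> + 2 * step_seq k * K + 2 * step_seq k * q k"
    if \<epsilon>: "0 < \<epsilon>" and k: "Q k < 1" for \<epsilon> k
  proof -
    define \<theta> where "\<theta> = step_seq k"
    have \<theta>: "0 < \<theta>" "\<bar>\<theta>\<bar> < 1" using step_seq[of k] by (auto simp: \<theta>_def)
    have "(\<integral>\<^sup>+z. ennreal ((r k z)\<^sup>2) \<partial>lborel) = Q k * ennreal (\<theta>\<^sup>2)"
      unfolding Q_def \<theta>_def[symmetric] using \<theta> by (simp add: ennreal_divide_times ennreal_mult_divide_eq)
    also have "Q k = ennreal (q k)" unfolding q_def using k by (intro ennreal_enn2real[symmetric]) (auto simp: less_top[symmetric] top_unique dest: order_less_trans[OF _ ennreal_one_less_top])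
    also have "\<dots> * ennreal (\<theta>\<^sup>2) = ennreal (q k * \<theta>\<^sup>2)" by (simp add: ennreal_mult q_def)
    finally have "has_bochner_integral lborel (\<lambda>z. (r k z)\<^sup>2) (q k * \<theta>\<^sup>2)"
      by (intro has_bochner_integral_nn_integral) (auto simp: q_def)
    then have ir: "integrable lborel (\<lambda>z. (r k z)\<^sup>2)" "(\<integral>z. (r k z)\<^sup>2 \<partial>lborel) = q k * \<theta>\<^sup>2" by (auto simp: has_bochner_integral_iff)
    have iar: "integrable lborel (\<lambda>z. a z * r k z)"
    proof (rule Bochner_Integration.integrable_bound[OF Bochner_Integration.integrable_add[OF ia(1) ir(1)]])
      show "AE z in lborel. norm (a z * r k z) \<le> norm ((a z)\<^sup>2 + (r k z)\<^sup>2)"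
      proof (rule AE_I2)
        fix z
        have "2 * \<bar>a z\<bar> * \<bar>r k z\<bar> \<le> (a z)\<^sup>2 + (r k z)\<^sup>2" using sum_squares_bound[of "\<bar>a z\<bar>" "\<bar>r k z\<bar>"] by simp
        moreover have "0 \<le> \<bar>a z\<bar> * \<bar>r k z\<bar>" by simp
        ultimately have "\<bar>a z\<bar> * \<bar>r k z\<bar> \<le> (a z)\<^sup>2 + (r k z)\<^sup>2" by linarith
        then show "norm (a z * r k z) \<le> norm ((a z)\<^sup>2 + (r k z)\<^sup>2)" by (simp add: abs_mult)
      qed
    qed simp
    define v where "v z = \<theta> * u z + r k z" for z
    have [measurable]: "v \<in> borel_measurable borel" unfolding v_def[abs_def] by measurable
    have vb: "(v z)\<^sup>2 \<le> 2 * \<theta>\<^sup>2 * (u z)\<^sup>2 + 2 * (r k z)\<^sup>2" for z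
      using sum_squares_bound[of "\<theta> * u z" "r k z"] by (simp add: v_def power2_sum power_mult_distrib)
    have iv: "integrable lborel (\<lambda>z. (v z)\<^sup>2)"
      by (rule Bochner_Integration.integrable_bound[of _ "\<lambda>z. 2 * \<theta>\<^sup>2 * (u z)\<^sup>2 + 2 * (r k z)\<^sup>2"])
        (use iu ir(1) vb in \<open>auto intro: order_trans[OF _ abs_ge_self]\<close>)
    have eq: "h \<theta> z - h 0 z = 2 * \<theta> * (a z * u z) + 2 * (a z * r k z) + (v z)\<^sup>2" for z
    proof -
      have "h \<theta> z = (a z + v z)\<^sup>2" using nn(2)[of k z] by (simp add: v_def r_def \<theta>_def)
      then show ?thesis by (simp add: a2[symmetric] v_def power2_eq_square algebra_simps)
    qed
    \<comment> \<open>Normalisation of the two densities is the only source of the identity for <a,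
      u>.\<close>
    have "0 = (\<integral>z. h \<theta> z - h 0 z \<partial>lborel)" using hint[OF \<theta>(2)] hint[of 0] by simp
    also have "\<dots> = 2 * \<theta> * (\<integral>z. a z * u z \<partial>lborel) + 2 * (\<integral>z. a z * r k z \<partial>lborel) + (\<integral>z. (v z)\<^sup>2 \<partial>lborel)"
      unfolding eq using iau iar iv by simp
    finally have z: "2 * \<theta> * (\<integral>z. a z * u z \<partial>lborel) = - (2 * (\<integral>z. a z * r k z \<partial>lborel)) - (\<integral>z. (v z)\<^sup>2 \<partial>lborel)" by simp
    have ar: "\<bar>2 * (\<integral>z. a z * r k z \<partial>lborel)\<bar> \<le> \<theta> * \<epsilon> + q k * \<theta> / \<epsilon>"
    proof -
      have "\<bar>\<integral>z. 2 * (a z * r k z) \<partial>lborel\<bar> \<le> (\<integral>z. \<theta> * \<epsilon> * (a z)\<^sup>2 + (r k z)\<^sup>2 / (\<theta> * \<epsilon>) \<partial>lborel)"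
      proof (rule order_trans[OF integral_abs_bound integral_mono])
        fix z
        define s where "s = sqrt (\<theta> * \<epsilon>)"
        have s: "0 < s" "s\<^sup>2 = \<theta> * \<epsilon>" using \<theta> \<epsilon> by (auto simp: s_def)
        have "2 * (s * \<bar>a z\<bar>) * (\<bar>r k z\<bar> / s) \<le> (s * \<bar>a z\<bar>)\<^sup>2 + (\<bar>r k z\<bar> / s)\<^sup>2" by (rule sum_squares_bound)
        then show "\<bar>2 * (a z * r k z)\<bar> \<le> \<theta> * \<epsilon> * (a z)\<^sup>2 + (r k z)\<^sup>2 / (\<theta> * \<epsilon>)"
          using s by (simp add: abs_mult power_mult_distrib power_divide)
      qed (use iar ia(1) ir(1) in auto)
      also have "\<dots> = \<theta> * \<epsilon> + q k * \<theta>\<^sup>2 / (\<theta> * \<epsilon>)"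
        using ia ir by simp
      also have "\<dots> = \<theta> * \<epsilon> + q k * \<theta> / \<epsilon>" using \<theta> by (simp add: power2_eq_square)
      finally show ?thesis by simp
    qed
    have vv: "\<bar>\<integral>z. (v z)\<^sup>2 \<partial>lborel\<bar> \<le> 2 * \<theta>\<^sup>2 * K + 2 * (q k * \<theta>\<^sup>2)"
    proof -
      have "(\<integral>z. (v z)\<^sup>2 \<partial>lborel) \<le> (\<integral>z. 2 * \<theta>\<^sup>2 * (u z)\<^sup>2 + 2 * (r k z)\<^sup>2 \<partial>lborel)"
        using iu ir(1) iv vb by (intro integral_mono) auto
      also have "\<dots> = 2 * \<theta>\<^sup>2 * K + 2 * (q k * \<theta>\<^sup>2)" using iu ir by (simp add: K_def)
      finally show ?thesis by simp
    qed
    have "\<theta> * \<bar>2 * (\<integral>z. a z * u z \<partial>lborel)\<bar> = \<bar>2 * \<theta> * (\<integral>z. a z * u z \<partial>lborel)\<bar>" using \<theta> by (simp add: abs_mult)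
    also have "\<dots> \<le> (\<theta> * \<epsilon> + q k * \<theta> / \<epsilon>) + (2 * \<theta>\<^sup>2 * K + 2 * (q k * \<theta>\<^sup>2))"
      unfolding z using ar vv by linarith
    also have "\<dots> = \<theta> * (\<epsilon> + q k / \<epsilon> + 2 * \<theta> * K + 2 * \<theta> * q k)"
      by (simp add: algebra_simps power2_eq_square)
    finally show ?thesis using \<theta>(1) by (simp add: \<theta>_def mult_le_cancel_left_pos)
  qed
  have "\<bar>2 * (\<integral>z. a z * u z \<partial>lborel)\<bar> \<le> \<epsilon>" if \<epsilon>: "0 < \<epsilon>" for \<epsilon>
  proof (rule tendsto_lowerbound)
    have "step_seq \<longlonglongrightarrow> 0" using step_seq_lim by (simp add: filterlim_at)
    then show "(\<lambda>k. \<epsilon> + q k / \<epsilon> + 2 * step_seq k * K + 2 * step_seq k * q k) \<longlonglongrightarrow> \<epsilon>"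
      by (auto intro!: tendsto_eq_intros ql simp: \<epsilon>[THEN less_imp_neq, THEN not_sym])
    show "\<forall>\<^sub>F k in sequentially. \<bar>2 * (\<integral>z. a z * u z \<partial>lborel)\<bar> \<le> \<epsilon> + q k / \<epsilon> + 2 * step_seq k * K + 2 * step_seq k * q k"
      using ev by eventually_elim (rule main[OF \<epsilon>])
  qed simp
  then have "\<bar>2 * (\<integral>z. a z * u z \<partial>lborel)\<bar> \<le> 0" by (rule field_le_epsilon[of _ 0, simplified])
  then show ?thesis by (simp add: iau)
qed

end

section \<open>Characteristic functions of degenerate kernels\<close>

lemma cis_bounds:
  fixes u :: real
  shows "norm (cis u - 1) \<le> \<bar>u\<bar>" "norm (cis u - (1 + \<i> * u - u\<^sup>2 / 2)) \<le> \<bar>u\<bar> ^ 3 / 6"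
  using iexp_approx1[of u 0] iexp_approx1[of u 2]
  by (simp_all add: cis_conv_exp numeral_2_eq_2 numeral_3_eq_3 power_mult_distrib algebra_simps)

text \<open>Bookkeeping for \<open>step_bound\<close>: a = i c, b = \<open>c\<^sup>2\<close>, v =
  \<open>var2 x\<close>, k = \<open>kvar\<close>. The factor 0 holds the place of the mean of
  \<open>d x\<close>, which vanishes by degeneracy.\<close>

lemma step_identity:
  fixes E F A B R a b v k :: complex
  assumes "E = F + a * 0 + a * A - b / 2 * v - b / 2 * B + R"
  shows "E - F * (1 - b * k / 2) - (a * A - b / 2 * (v - k)) = b * k / 2 * (F - 1) + (- (b / 2) * B) + R"
  by (simp add: assms field_simps)

lemma (in prob_space) integral_norm_bound_dominated:
  fixes f :: "'a \<Rightarrow> complex"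
  assumes "f \<in> borel_measurable M" "g \<in> borel_measurable M"
    "\<And>x. x \<in> space M \<Longrightarrow> norm (f x) \<le> c * g x" "\<And>x. x \<in> space M \<Longrightarrow> 0 \<le> g x \<and> g x \<le> K" "0 \<le> c"
  shows "norm (\<integral>x. f x \<partial>M) \<le> c * (\<integral>x. g x \<partial>M)"
proof -
  have ig: "integrable M g" using assms by (intro integrable_const_bound[of _ K]) auto
  have "norm (\<integral>x. f x \<partial>M) \<le> (\<integral>x. norm (f x) \<partial>M)" by simp
  also have "\<dots> \<le> (\<integral>x. c * g x \<partial>M)"
  proof (rule integral_mono)
    show "integrable M (\<lambda>x. c * g x)" using ig by simp
    have "norm (f x) \<le> c * K" if "x \<in> space M" for x
      using assms(3)[OF that] assms(4)[OF that] assms(5) mult_left_mono[of "g x" K c] by linarith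
    then show "integrable M (\<lambda>x. norm (f x))"
      using assms by (intro integrable_const_bound[of _ "c * K"]) auto
  qed (use assms in auto)
  finally show ?thesis by simp
qed

text \<open>The two degeneracies act at different places: \<open>d_right\<close> removes the
  first-order term when the later coordinate is integrated out, \<open>d_left\<close> makes the
  remaining leading term centred in the earlier one.\<close>

locale degenerate_kernel = prob_space N for N :: "'a measure" +
  fixes d :: "'a \<Rightarrow> 'a \<Rightarrow> real"
  assumes d_meas[measurable]: "(\<lambda>(x, y). d x y) \<in> borel_measurable (N \<Otimes>\<^sub>M N)"
    and d_bound: "\<And>x y. x \<in> space N \<Longrightarrow> y \<in> space N \<Longrightarrow> \<bar>d x y\<bar> \<le> 1"
    and d_right: "\<And>x. x \<in> space N \<Longrightarrow> (\<integral>y. d x y \<partial>N) = 0"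
    and d_left: "\<And>y. y \<in> space N \<Longrightarrow> (\<integral>x. d x y \<partial>N) = 0"
begin

definition var2 :: "'a \<Rightarrow> real" where "var2 x = (\<integral>y. (d x y)\<^sup>2 \<partial>N)"

definition kvar :: real where "kvar = (\<integral>x. var2 x \<partial>N)"

lemma d_meas2[measurable]: "x \<in> space N \<Longrightarrow> d x \<in> borel_measurable N"
  using measurable_compose[OF measurable_Pair1' d_meas] by simp

lemma var2_meas[measurable]: "var2 \<in> borel_measurable N"
  unfolding var2_def[abs_def] by measurable

lemma d_sq: "x \<in> space N \<Longrightarrow> y \<in> space N \<Longrightarrow> (d x y)\<^sup>2 \<le> 1"
  using d_bound[of x y] by (simp add: abs_square_le_1)

lemma var2: assumes "x \<in> space N" shows "0 \<le> var2 x" "var2 x \<le> 1"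
proof -
  show "0 \<le> var2 x" by (simp add: var2_def)
  show "var2 x \<le> 1" unfolding var2_def
    using assms d_sq by (intro integral_le_const integrable_const_bound[of _ 1] AE_I2) auto
qed

lemma kvar: "0 \<le> kvar" "kvar \<le> 1"
proof -
  show "0 \<le> kvar" unfolding kvar_def using var2 by (intro integral_nonneg_AE AE_I2) auto
  show "kvar \<le> 1" unfolding kvar_def
    using var2 by (intro integral_le_const integrable_const_bound[of _ 1] AE_I2) auto
qed

text \<open>\<open>lead\<close> is too large to be an error term by itself, but it has mean zero, so integrating out the
  preceding coordinate as well gains another factor of order \<open>c\<close>.\<close>

definition lead :: "real \<Rightarrow> ('a \<Rightarrow> complex) \<Rightarrow> 'a \<Rightarrow> complex" where
  "lead c e x = \<i> * c * (\<integral>y. (e y - 1) * d x y \<partial>N) - c\<^sup>2 / 2 * (var2 x - kvar)"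

context
  fixes e :: "'a \<Rightarrow> complex"
  assumes e_meas[measurable]: "e \<in> borel_measurable N"
    and e_norm: "\<And>x. norm (e x) = 1"
begin

lemma e1_bound: "0 \<le> norm (e x - 1) \<and> norm (e x - 1) \<le> 2"
  using norm_triangle_ineq4[of "e x" 1] e_norm[of x] by simp

lemma lead_meas: "lead c e \<in> borel_measurable N"
  unfolding lead_def[abs_def] by measurable

lemma int_e: "integrable N e" "integrable N (\<lambda>x. e x - 1)" "integrable N (\<lambda>x. norm (e x - 1))"
  using e_norm e1_bound by (auto intro!: integrable_const_bound[of _ 2])

text \<open>By Fubini \<open>x\<close> is integrated first, and \<open>d_left\<close> annihilates
  the integral for each \<open>y\<close>; the other part is centred since \<open>kvar\<close> is the
  mean of \<open>var2\<close>.\<close>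

lemma integral_lead: "(\<integral>x. lead c e x \<partial>N) = 0"
proof -
  interpret NN: pair_prob_space N N ..
  have i: "integrable (N \<Otimes>\<^sub>M N) (\<lambda>(x, y). (e y - 1) * complex_of_real (d x y))"
  proof (rule NN.integrable_const_bound[of _ 2])
    show "AE z in N \<Otimes>\<^sub>M N. norm (case z of (x, y) \<Rightarrow> (e y - 1) * complex_of_real (d x y)) \<le> 2"
    proof (rule AE_I2, clarsimp simp: space_pair_measure norm_mult)
      fix x y assume "x \<in> space N" "y \<in> space N"
      then show "cmod (e y - 1) * \<bar>d x y\<bar> \<le> 2"
        using mult_mono[OF conjunct2[OF e1_bound[of y]] d_bound[of x y]] by simp
    qed
  qed measurable
  have "(\<integral>x. (\<integral>y. (e y - 1) * complex_of_real (d x y) \<partial>N) \<partial>N)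
      = (\<integral>y. (\<integral>x. (e y - 1) * complex_of_real (d x y) \<partial>N) \<partial>N)"
    using NN.Fubini_integral[OF i] by simp
  also have "\<dots> = (\<integral>y. 0 \<partial>N)"
    using d_left by (intro Bochner_Integration.integral_cong refl) simp
  finally have 1: "(\<integral>x. (\<integral>y. (e y - 1) * complex_of_real (d x y) \<partial>N) \<partial>N) = 0" by simp
  have i1: "integrable N (\<lambda>x. \<integral>y. (e y - 1) * complex_of_real (d x y) \<partial>N)"
    using NN.integrable_fst[OF i] by simp
  have i2: "integrable N var2" using var2 by (intro integrable_const_bound[of _ 1]) auto
  have "(\<integral>x. complex_of_real (var2 x - kvar) \<partial>N) = 0"
    using i2 by (subst integral_complex_of_real) (simp add: kvar_def prob_space)
  then show ?thesis
    unfolding lead_def using i1 i2 1 by simp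
qed

lemma integral_e_d_bound:
  assumes x: "x \<in> space N"
  shows "norm (\<integral>y. (e y - 1) * d x y \<partial>N) \<le> (\<integral>y. norm (e y - 1) \<partial>N)"
proof -
  have "norm ((e y - 1) * complex_of_real (d x y)) \<le> 1 * norm (e y - 1)" if "y \<in> space N" for y
    using mult_left_mono[OF d_bound[OF x that], of "norm (e y - 1)"] by (simp add: norm_mult)
  from integral_norm_bound_dominated[OF _ _ this e1_bound] show ?thesis using x by simp
qed

lemma lead_bound:
  assumes x: "x \<in> space N"
  shows "norm (lead c e x) \<le> \<bar>c\<bar> * (\<integral>y. norm (e y - 1) \<partial>N) + c\<^sup>2 / 2"
proof -
  have "\<bar>var2 x - kvar\<bar> \<le> 1" using var2[OF x] kvar by auto
  then have "norm (complex_of_real (c\<^sup>2 / 2 * (var2 x - kvar))) \<le> c\<^sup>2 / 2 * 1"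
    unfolding norm_of_real abs_mult by (intro mult_mono) auto
  moreover have "norm (\<i> * c * (\<integral>y. (e y - 1) * d x y \<partial>N)) \<le> \<bar>c\<bar> * (\<integral>y. norm (e y - 1) \<partial>N)"
    using integral_e_d_bound[OF x] by (simp add: norm_mult mult_left_mono)
  ultimately show ?thesis
    unfolding lead_def by (intro order_trans[OF norm_triangle_ineq4] add_mono) (simp_all add: field_simps)
qed

text \<open>Expand \<open>cis\<close> to second order and write e = 1 + (e - 1). The pure
  first-order term has mean zero, its product with e - 1 and the fluctuation of \<open>var2\<close>
  form \<open>lead\<close>. The error \<open>c\<^sup>2\<close> \<delta> is made of two halves: one
  from multiplying \<open>kvar\<close> by the integral of \<open>e\<close> instead of by 1, one from
  (e - 1) \<open>d\<^sup>2\<close>. The cubic term is the Taylor remainder.\<close>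

lemma step_bound:
  assumes x: "x \<in> space N"
  shows "norm ((\<integral>y. e y * cis (c * d x y) \<partial>N) - (\<integral>y. e y \<partial>N) * (1 - c\<^sup>2 * kvar / 2) - lead c e x)
    \<le> c\<^sup>2 * (\<integral>y. norm (e y - 1) \<partial>N) + \<bar>c\<bar> ^ 3 / 6"
proof -
  note [measurable] = d_meas2[OF x]
  let ?\<delta> = "\<integral>y. norm (e y - 1) \<partial>N"
  define \<rho> where "\<rho> y = cis (c * d x y) - (1 + \<i> * (c * d x y) - (c * d x y)\<^sup>2 / 2)" for y
  have [measurable]: "(\<lambda>y. cis (c * d x y)) \<in> borel_measurable N"
    unfolding cis_conv_exp by measurable
  have \<rho>m[measurable]: "\<rho> \<in> borel_measurable N" unfolding \<rho>_def[abs_def] by measurable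
  have \<rho>b: "norm (\<rho> y) \<le> \<bar>c\<bar> ^ 3 / 6" if "y \<in> space N" for y
  proof -
    have "\<bar>c * d x y\<bar> ^ 3 \<le> \<bar>c\<bar> ^ 3"
      using mult_left_mono[OF d_bound[OF x that], of "\<bar>c\<bar>"] by (intro power_mono) (auto simp: abs_mult)
    then have "\<bar>c * d x y\<bar> ^ 3 / 6 \<le> \<bar>c\<bar> ^ 3 / 6" by (rule divide_right_mono) simp
    then show ?thesis using cis_bounds(2)[of "c * d x y"] unfolding \<rho>_def by linarith
  qed
  have bnd: "integrable N f" if "f \<in> borel_measurable N" "\<And>y. y \<in> space N \<Longrightarrow> norm (f y) \<le> K"
    for f :: "'a \<Rightarrow> complex" and K
    using that by (intro integrable_const_bound[of _ K]) auto
  have nd: "norm (complex_of_real (d x y)) \<le> 1" "norm (complex_of_real ((d x y)\<^sup>2)) \<le> 1" if "y \<in> space N" for y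
    using d_bound[OF x that] d_sq[OF x that] by (simp_all only: norm_of_real abs_power2)
  have ne: "norm (e y - 1) \<le> 2" "norm (e y) \<le> 1" for y using e1_bound e_norm by auto
  have id1: "integrable N (\<lambda>y. complex_of_real (d x y))"
    using nd by (intro bnd[of _ 1]) auto
  have id2: "integrable N (\<lambda>y. (e y - 1) * complex_of_real (d x y))"
    using mult_mono[OF ne(1) nd(1)] by (intro bnd[of _ 2]) (auto simp: norm_mult)
  have id3: "integrable N (\<lambda>y. complex_of_real ((d x y)\<^sup>2))"
    using nd by (intro bnd[of _ 1]) auto
  have id4: "integrable N (\<lambda>y. (e y - 1) * complex_of_real ((d x y)\<^sup>2))"
    using mult_mono[OF ne(1) nd(2)] by (intro bnd[of _ 2]) (auto simp: norm_mult)
  have id5: "integrable N (\<lambda>y. e y * \<rho> y)"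
    using mult_mono[OF ne(2) \<rho>b] by (intro bnd[of _ "\<bar>c\<bar> ^ 3 / 6"]) (auto simp: norm_mult)
  have "(\<integral>y. e y * cis (c * d x y) \<partial>N)
    = (\<integral>y. e y + \<i> * c * complex_of_real (d x y) + \<i> * c * ((e y - 1) * complex_of_real (d x y))
         - c\<^sup>2 / 2 * complex_of_real ((d x y)\<^sup>2) - c\<^sup>2 / 2 * ((e y - 1) * complex_of_real ((d x y)\<^sup>2)) + e y * \<rho> y \<partial>N)"
    by (intro Bochner_Integration.integral_cong refl) (simp add: \<rho>_def algebra_simps power_mult_distrib)
  also have "\<dots> = (\<integral>y. e y \<partial>N) + \<i> * c * (\<integral>y. complex_of_real (d x y) \<partial>N) + \<i> * c * (\<integral>y. (e y - 1) * complex_of_real (d x y) \<partial>N)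
         - c\<^sup>2 / 2 * (\<integral>y. complex_of_real ((d x y)\<^sup>2) \<partial>N) - c\<^sup>2 / 2 * (\<integral>y. (e y - 1) * complex_of_real ((d x y)\<^sup>2) \<partial>N) + (\<integral>y. e y * \<rho> y \<partial>N)"
    using int_e(1) id1 id2 id3 id4 id5 by simp
  also have "(\<integral>y. complex_of_real (d x y) \<partial>N) = 0" using d_right[OF x] by simp
  also have "(\<integral>y. complex_of_real ((d x y)\<^sup>2) \<partial>N) = var2 x"
    by (simp only: integral_complex_of_real var2_def)
  finally have eq: "(\<integral>y. e y * cis (c * d x y) \<partial>N) - (\<integral>y. e y \<partial>N) * (1 - c\<^sup>2 * kvar / 2) - lead c e x
     = c\<^sup>2 * kvar / 2 * ((\<integral>y. e y \<partial>N) - 1) + (- (c\<^sup>2 / 2) * (\<integral>y. (e y - 1) * complex_of_real ((d x y)\<^sup>2) \<partial>N)) + (\<integral>y. e y * \<rho> y \<partial>N)"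
    unfolding lead_def of_real_diff of_real_minus of_real_mult of_real_divide of_real_numeral of_real_power of_real_1
    by (rule step_identity)
  have \<delta>0: "0 \<le> ?\<delta>" by simp
  have 1: "norm (c\<^sup>2 * kvar / 2 * ((\<integral>y. e y \<partial>N) - 1)) \<le> c\<^sup>2 / 2 * ?\<delta>"
  proof -
    have "(\<integral>y. e y \<partial>N) - 1 = (\<integral>y. e y - 1 \<partial>N)" using int_e by (simp add: prob_space)
    then have "norm ((\<integral>y. e y \<partial>N) - 1) \<le> ?\<delta>" by simp
    moreover have "c\<^sup>2 * kvar / 2 \<le> c\<^sup>2 / 2" using kvar mult_left_mono[of kvar 1 "c\<^sup>2"] by simp
    ultimately have "(c\<^sup>2 * kvar / 2) * norm ((\<integral>y. e y \<partial>N) - 1) \<le> c\<^sup>2 / 2 * ?\<delta>"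
      using kvar by (intro mult_mono) auto
    then show ?thesis using kvar by (simp add: norm_mult norm_divide norm_power)
  qed
  have 2: "norm (- (c\<^sup>2 / 2) * (\<integral>y. (e y - 1) * complex_of_real ((d x y)\<^sup>2) \<partial>N)) \<le> c\<^sup>2 / 2 * ?\<delta>"
  proof -
    have "norm ((e y - 1) * complex_of_real ((d x y)\<^sup>2)) \<le> 1 * norm (e y - 1)" if "y \<in> space N" for y
      using mult_left_mono[OF nd(2)[OF that], of "norm (e y - 1)"] by (simp add: norm_mult)
    from integral_norm_bound_dominated[OF _ _ this e1_bound]
    have "norm (\<integral>y. (e y - 1) * complex_of_real ((d x y)\<^sup>2) \<partial>N) \<le> ?\<delta>" by simp
    from mult_left_mono[OF this, of "c\<^sup>2 / 2"] show ?thesis by (simp add: norm_mult norm_divide norm_power)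
  qed
  have 3: "norm (\<integral>y. e y * \<rho> y \<partial>N) \<le> \<bar>c\<bar> ^ 3 / 6"
  proof -
    have "norm (e y * \<rho> y) \<le> (\<bar>c\<bar> ^ 3 / 6) * 1" if "y \<in> space N" for y
      using \<rho>b[OF that] e_norm[of y] by (simp add: norm_mult)
    from integral_norm_bound_dominated[OF _ _ this, where K=1] show ?thesis by (simp add: prob_space)
  qed
  show ?thesis
    unfolding eq
    using norm_triangle_ineq[of "c\<^sup>2 * kvar / 2 * ((\<integral>y. e y \<partial>N) - 1) + (- (c\<^sup>2 / 2) * (\<integral>y. (e y - 1) * complex_of_real ((d x y)\<^sup>2) \<partial>N))" "\<integral>y. e y * \<rho> y \<partial>N"]
      norm_triangle_ineq[of "c\<^sup>2 * kvar / 2 * ((\<integral>y. e y \<partial>N) - 1)" "- (c\<^sup>2 / 2) * (\<integral>y. (e y - 1) * complex_of_real ((d x y)\<^sup>2) \<partial>N)"]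
      1 2 3 by linarith
qed

text \<open>As \<open>f\<close> has mean zero, the factor \<open>e x * cis (\<theta> x)\<close> may
  be replaced by its difference from 1, and that is at most |e - 1| + |\<theta>|.\<close>

lemma mean_zero_bound:
  assumes f[measurable]: "f \<in> borel_measurable N" and f0: "(\<integral>x. f x \<partial>N) = 0"
    and fb: "\<And>x. x \<in> space N \<Longrightarrow> norm (f x) \<le> (K::real)"
    and \<theta>[measurable]: "\<theta> \<in> borel_measurable N" and \<theta>b: "\<And>x. x \<in> space N \<Longrightarrow> \<bar>\<theta> x\<bar> \<le> c"
  shows "norm (\<integral>x. e x * cis (\<theta> x) * f x \<partial>N) \<le> K * ((\<integral>y. norm (e y - 1) \<partial>N) + c)"
proof -
  obtain x0 where "x0 \<in> space N" using not_empty by auto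
  then have K0: "0 \<le> K" and c0: "0 \<le> c" using fb[of x0] \<theta>b[of x0] norm_ge_zero[of "f x0"] by linarith+
  have [measurable]: "(\<lambda>y. cis (\<theta> y)) \<in> borel_measurable N"
    unfolding cis_conv_exp by measurable
  have i: "integrable N f" "integrable N (\<lambda>x. e x * cis (\<theta> x) * f x)"
    using fb e_norm by (auto intro!: integrable_const_bound[of _ K] simp: norm_mult)
  have "(\<integral>x. e x * cis (\<theta> x) * f x \<partial>N) = (\<integral>x. e x * cis (\<theta> x) * f x \<partial>N) - (\<integral>x. f x \<partial>N)"
    by (simp add: f0)
  also have "\<dots> = (\<integral>x. (e x * cis (\<theta> x) - 1) * f x \<partial>N)"
    by (subst Bochner_Integration.integral_diff[symmetric]) (use i in \<open>auto simp: algebra_simps\<close>)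
  also have "norm \<dots> \<le> K * (\<integral>x. norm (e x - 1) + c \<partial>N)"
  proof (rule integral_norm_bound_dominated)
    fix x assume x: "x \<in> space N"
    have eq: "e x * cis (\<theta> x) - 1 = (e x - 1) * cis (\<theta> x) + (cis (\<theta> x) - 1)" by (simp add: algebra_simps)
    have "norm (e x * cis (\<theta> x) - 1) \<le> norm ((e x - 1) * cis (\<theta> x)) + norm (cis (\<theta> x) - 1)"
      unfolding eq by (rule norm_triangle_ineq)
    also have "\<dots> \<le> norm (e x - 1) + c"
      using cis_bounds(1)[of "\<theta> x"] \<theta>b[OF x] by (simp add: norm_mult)
    finally have "norm (e x * cis (\<theta> x) - 1) \<le> norm (e x - 1) + c" .
    then show "norm ((e x * cis (\<theta> x) - 1) * f x) \<le> K * (norm (e x - 1) + c)"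
      unfolding norm_mult mult.commute[of K] using c0 by (intro mult_mono fb[OF x]) auto
    show "0 \<le> norm (e x - 1) + c \<and> norm (e x - 1) + c \<le> 2 + c" using e1_bound[of x] c0 by simp
  qed (use K0 in auto)
  also have "(\<integral>x. norm (e x - 1) + c \<partial>N) = (\<integral>x. norm (e x - 1) \<partial>N) + c"
    using int_e(3) by (simp add: prob_space)
  finally show ?thesis .
qed

end

section \<open>Recursion along the sequence\<close>

context
  fixes e :: "nat \<Rightarrow> 'a \<Rightarrow> complex" and n :: nat and c :: real
  assumes em[measurable]: "\<And>j. j < n \<Longrightarrow> e j \<in> borel_measurable N"
    and en: "\<And>j x. j < n \<Longrightarrow> norm (e j x) = 1"
begin

text \<open>The integrand of the joint characteristic function cut down to the first
  \<open>k\<close> coordinates. For k = 0 and k = 1 the truncated \<open>k - 1\<close> makes the sum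
  empty.\<close>

definition walk :: "nat \<Rightarrow> (nat \<Rightarrow> 'a) \<Rightarrow> complex" where
  "walk k w = (\<Prod>j<k. e j (w j)) * cis (c * (\<Sum>j<k - 1. d (w j) (w (Suc j))))"

text \<open>The phase added when coordinate \<open>k\<close> takes the value \<open>z\<close>; the
  first coordinate has no predecessor and adds none.\<close>

definition angle :: "nat \<Rightarrow> (nat \<Rightarrow> 'a) \<Rightarrow> 'a \<Rightarrow> real" where
  "angle k w z = (if k = 0 then 0 else c * d (w (k - 1)) z)"

abbreviation P :: "(nat \<Rightarrow> 'a) measure" where "P \<equiv> PiM {..<n} (\<lambda>_. N)"

interpretation P: prob_space P by (rule prob_space_PiM) (rule prob_space_axioms)

lemma coord_d_meas:
  assumes "i < n" "j < n" shows "(\<lambda>w. d (w i) (w j)) \<in> borel_measurable P"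
proof -
  have "(\<lambda>w. (w i, w j)) \<in> measurable P (N \<Otimes>\<^sub>M N)"
    using assms by (intro measurable_Pair measurable_component_singleton) auto
  from measurable_compose[OF this d_meas] show ?thesis by simp
qed

lemma walk_meas:
  assumes "k \<le> n" shows "walk k \<in> borel_measurable P"
proof -
  have e: "(\<lambda>w. e j (w j)) \<in> borel_measurable P" if "j < k" for j
    using that assms by (intro measurable_compose[of "\<lambda>w. w j" P N, OF measurable_component_singleton em]) auto
  show ?thesis
    unfolding walk_def[abs_def] cis_conv_exp using assms
    by (intro borel_measurable_times borel_measurable_prod e borel_measurable_exp measurable_compose[OF _ borel_measurable_of_real]
       borel_measurable_const borel_measurable_sum coord_d_meas) auto
qed

lemma walk_norm: "k \<le> n \<Longrightarrow> norm (walk k w) = 1"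
  unfolding walk_def norm_mult prod_norm[symmetric] by (simp add: en)

lemma walk_integrable: "k \<le> n \<Longrightarrow> integrable P (walk k)"
  by (intro P.integrable_const_bound[of _ 1] walk_meas) (simp_all add: walk_norm)

text \<open>\<open>walk k\<close> reads only coordinates below \<open>k\<close>, so it is unaffected
  by the update and can be pulled out of the inner integral after resampling coordinate
  \<open>k\<close>.\<close>

lemma walk_step:
  "walk (Suc k) (fun_upd w k z) = walk k w * (e k z * cis (angle k w z))"
proof (cases k)
  case 0 then show ?thesis by (simp add: walk_def angle_def)
next
  case (Suc m)
  have "(\<Prod>j<k. e j (if j = k then z else w j)) = (\<Prod>j<k. e j (w j))"
    by (intro prod.cong) auto
  moreover have "(\<Sum>j<m. d (if j = k then z else w j) (if Suc j = k then z else w (Suc j))) = (\<Sum>j<m. d (w j) (w (Suc j)))"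
    using Suc by (intro sum.cong) auto
  ultimately show ?thesis
    using Suc by (simp add: walk_def angle_def fun_upd_def distrib_left cis_mult[symmetric] mult_ac)
qed

lemma space_P: "w \<in> space P \<Longrightarrow> j < n \<Longrightarrow> w j \<in> space N"
  by (auto simp: space_PiM)

lemma resample:
  fixes F :: "(nat \<Rightarrow> 'a) \<Rightarrow> complex"
  assumes "integrable P F" "j < n"
  shows "(\<integral>w. F w \<partial>P) = (\<integral>w. (\<integral>z. F (fun_upd w j z) \<partial>N) \<partial>P)"
  using assms by (intro integral_PiM_fun_upd prob_space_axioms) auto

abbreviation "\<delta> j \<equiv> (\<integral>y. norm (e j y - 1) \<partial>N)"

text \<open>Where the leading term gains its missing factor: given the earlier coordinates,
  coordinate \<open>k\<close> enters through a mean-zero function times a factor close to 1, and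
  \<open>mean_zero_bound\<close> applies.\<close>

lemma walk_mean_zero:
  assumes k: "Suc k \<le> n" and f: "f \<in> borel_measurable N" "(\<integral>x. f x \<partial>N) = 0"
    and fb: "\<And>x. x \<in> space N \<Longrightarrow> norm (f x) \<le> (K::real)"
  shows "norm (\<integral>w. walk (Suc k) w * f (w k) \<partial>P) \<le> K * (\<delta> k + \<bar>c\<bar>)"
proof -
  have i: "integrable P (\<lambda>w. walk (Suc k) w * f (w k))"
  proof (intro P.integrable_const_bound[of _ K] AE_I2 borel_measurable_times walk_meas)
    show "(\<lambda>w. f (w k)) \<in> borel_measurable P"
      using k by (intro measurable_compose[of "\<lambda>w. w k" P N, OF measurable_component_singleton f(1)]) auto
  qed (use k fb space_P in \<open>auto simp: norm_mult walk_norm\<close>)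
  have "(\<integral>w. walk (Suc k) w * f (w k) \<partial>P) = (\<integral>w. (\<integral>z. walk (Suc k) (fun_upd w k z) * f ((fun_upd w k z) k) \<partial>N) \<partial>P)"
    by (rule resample[OF i]) (use k in auto)
  also have "\<dots> = (\<integral>w. walk k w * (\<integral>z. e k z * cis (angle k w z) * f z \<partial>N) \<partial>P)"
    by (simp add: walk_step mult.assoc)
  also have "norm \<dots> \<le> K * (\<delta> k + \<bar>c\<bar>)"
  proof (rule order_trans[OF integral_norm_bound], rule P.integral_le_const)
    have b: "norm (\<integral>z. e k z * cis (angle k w z) * f z \<partial>N) \<le> K * (\<delta> k + \<bar>c\<bar>)"
      if w: "w \<in> space P" for w
    proof (rule mean_zero_bound[OF _ _ f fb])
      have w: "k \<noteq> 0 \<Longrightarrow> w (k - 1) \<in> space N" using space_P[OF w] k by simp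
      show "(\<lambda>z. angle k w z) \<in> borel_measurable N"
        using d_meas2[OF w] by (cases "k = 0") (auto simp: angle_def)
      show "\<bar>angle k w x\<bar> \<le> \<bar>c\<bar>" if "x \<in> space N" for x
        using d_bound[OF w that] by (auto simp: angle_def abs_mult mult_left_le)
    qed (use k em en in auto)
    then show "AE w in P. norm (walk k w * (\<integral>z. e k z * cis (angle k w z) * f z \<partial>N)) \<le> K * (\<delta> k + \<bar>c\<bar>)"
      using k by (intro AE_I2) (simp add: norm_mult walk_norm)
    have meas: "(\<lambda>w. \<integral>z. e k z * cis (angle k w z) * f z \<partial>N) \<in> borel_measurable P"
    proof (rule borel_measurable_lebesgue_integral)
      have 1: "(\<lambda>p. e k (snd p)) \<in> borel_measurable (P \<Otimes>\<^sub>M N)" "(\<lambda>p. f (snd p)) \<in> borel_measurable (P \<Otimes>\<^sub>M N)"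
        using k by (auto intro!: measurable_compose[OF measurable_snd] f em)
      have 2: "(\<lambda>p. angle k (fst p) (snd p)) \<in> borel_measurable (P \<Otimes>\<^sub>M N)"
      proof (cases "k = 0")
        case False
        have "(\<lambda>p. (fst p (k - 1), snd p)) \<in> measurable (P \<Otimes>\<^sub>M N) (N \<Otimes>\<^sub>M N)"
          using False k by (intro measurable_Pair measurable_compose[OF measurable_fst measurable_component_singleton] measurable_snd) auto
        from measurable_compose[OF this d_meas] show ?thesis using False by (simp add: angle_def)
      qed (simp add: angle_def)
      show "(\<lambda>(w, z). e k z * cis (angle k w z) * f z) \<in> borel_measurable (P \<Otimes>\<^sub>M N)"
        unfolding cis_conv_exp case_prod_beta'
        by (intro borel_measurable_times 1 measurable_compose[OF 2]) measurable
    qed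
    show "integrable P (\<lambda>w. norm (walk k w * (\<integral>z. e k z * cis (angle k w z) * f z \<partial>N)))"
      using b k by (intro integrable_norm P.integrable_const_bound[of _ "K * (\<delta> k + \<bar>c\<bar>)"] AE_I2 borel_measurable_times walk_meas meas)
        (auto simp: norm_mult walk_norm)
  qed
  finally show ?thesis .
qed

abbreviation "\<phi> j \<equiv> (\<integral>y. e j y \<partial>N)"

text \<open>Integrating out the last coordinate leaves \<open>J\<close> at its predecessor.
  \<open>J\<close> is a constant plus the centred \<open>L\<close> plus a small \<open>r\<close>;
  the constant drives the recursion, \<open>L\<close> is handled by integrating out the predecessor,
  \<open>r\<close> by its supremum. When c, \<delta> k and \<delta> (Suc k) are of order 1 / sqrt n,
  every error term is of order 1 / (n sqrt n).\<close>

lemma walk_recursion: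
  assumes k: "Suc (Suc k) \<le> n"
  shows "norm ((\<integral>w. walk (Suc (Suc k)) w \<partial>P) - \<phi> (Suc k) * (1 - c\<^sup>2 * kvar / 2) * (\<integral>w. walk (Suc k) w \<partial>P))
    \<le> \<bar>c\<bar> * ((\<delta> k)\<^sup>2 + (\<delta> (Suc k))\<^sup>2) + 2 * c\<^sup>2 * (\<delta> k + \<delta> (Suc k)) + \<bar>c\<bar> ^ 3"
proof -
  note ek = em[of "Suc k"] en[of "Suc k"]
  define J where "J x = (\<integral>y. e (Suc k) y * cis (c * d x y) \<partial>N)" for x
  define L where "L = lead c (e (Suc k))"
  define r where "r x = J x - \<phi> (Suc k) * (1 - c\<^sup>2 * kvar / 2) - L x" for x
  have Jm[measurable]: "J \<in> borel_measurable N"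
  proof -
    have [measurable]: "e (Suc k) \<in> borel_measurable N" using k by (intro em) simp
    show ?thesis unfolding J_def[abs_def] cis_conv_exp by measurable
  qed
  have Lm[measurable]: "L \<in> borel_measurable N"
    unfolding L_def using k by (intro lead_meas ek) auto
  have rm: "r \<in> borel_measurable N" unfolding r_def[abs_def] by measurable
  have Lb: "norm (L x) \<le> \<bar>c\<bar> * \<delta> (Suc k) + c\<^sup>2 / 2" if "x \<in> space N" for x
    unfolding L_def using that k by (intro lead_bound ek) auto
  have L0: "(\<integral>x. L x \<partial>N) = 0" unfolding L_def using k by (intro integral_lead ek) auto
  have rb: "norm (r x) \<le> c\<^sup>2 * \<delta> (Suc k) + \<bar>c\<bar> ^ 3 / 6" if "x \<in> space N" for x
    unfolding r_def J_def L_def using that k by (intro step_bound ek) auto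
  have km: "(\<lambda>w. w k) \<in> measurable P N" using k by (intro measurable_component_singleton) auto
  have wi: "integrable P (\<lambda>w. walk (Suc k) w * f (w k))"
    if "f \<in> borel_measurable N" "\<And>x. x \<in> space N \<Longrightarrow> norm (f x) \<le> B" for f :: "'a \<Rightarrow> complex" and B
    using k that space_P by (intro P.integrable_const_bound[of _ B] AE_I2 borel_measurable_times walk_meas measurable_compose[OF km])
      (auto simp: norm_mult walk_norm)
  have "(\<integral>w. walk (Suc (Suc k)) w \<partial>P) = (\<integral>w. (\<integral>z. walk (Suc (Suc k)) (fun_upd w (Suc k) z) \<partial>N) \<partial>P)"
    using k by (intro resample walk_integrable) auto
  also have "\<dots> = (\<integral>w. walk (Suc k) w * J (w k) \<partial>P)"
    by (simp add: walk_step J_def angle_def)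
  also have "\<dots> = (\<integral>w. \<phi> (Suc k) * (1 - c\<^sup>2 * kvar / 2) * walk (Suc k) w + walk (Suc k) w * L (w k) + walk (Suc k) w * r (w k) \<partial>P)"
    by (intro Bochner_Integration.integral_cong refl) (simp add: r_def algebra_simps)
  also have "\<dots> = \<phi> (Suc k) * (1 - c\<^sup>2 * kvar / 2) * (\<integral>w. walk (Suc k) w \<partial>P) + (\<integral>w. walk (Suc k) w * L (w k) \<partial>P) + (\<integral>w. walk (Suc k) w * r (w k) \<partial>P)"
    using walk_integrable[of "Suc k"] wi[OF Lm Lb] wi[OF rm rb] k by simp
  finally have eq: "(\<integral>w. walk (Suc (Suc k)) w \<partial>P) - \<phi> (Suc k) * (1 - c\<^sup>2 * kvar / 2) * (\<integral>w. walk (Suc k) w \<partial>P)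
     = (\<integral>w. walk (Suc k) w * L (w k) \<partial>P) + (\<integral>w. walk (Suc k) w * r (w k) \<partial>P)" by simp
  have 1: "norm (\<integral>w. walk (Suc k) w * L (w k) \<partial>P) \<le> (\<bar>c\<bar> * \<delta> (Suc k) + c\<^sup>2 / 2) * (\<delta> k + \<bar>c\<bar>)"
    using k by (intro walk_mean_zero Lm L0 Lb) auto
  have 2: "norm (\<integral>w. walk (Suc k) w * r (w k) \<partial>P) \<le> c\<^sup>2 * \<delta> (Suc k) + \<bar>c\<bar> ^ 3 / 6"
    using k rb space_P integrable_norm[OF wi[OF rm rb]]
    by (intro order_trans[OF integral_norm_bound] P.integral_le_const AE_I2) (auto simp: norm_mult walk_norm)
  have \<delta>0: "0 \<le> \<delta> k" "0 \<le> \<delta> (Suc k)" by simp_all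
  \<comment> \<open>Trading the product of neighbours for squares makes the accumulated error
    independent of the order in which the \<open>e j\<close> are arranged.\<close>
  have "\<delta> k * \<delta> (Suc k) \<le> (\<delta> k)\<^sup>2 + (\<delta> (Suc k))\<^sup>2"
    using sum_squares_bound[of "\<delta> k" "\<delta> (Suc k)"] mult_nonneg_nonneg[OF \<delta>0] by linarith
  from mult_left_mono[OF this, of "\<bar>c\<bar>"]
  have "\<bar>c\<bar> * (\<delta> k * \<delta> (Suc k)) \<le> \<bar>c\<bar> * ((\<delta> k)\<^sup>2 + (\<delta> (Suc k))\<^sup>2)" by simp
  moreover have "(\<bar>c\<bar> * \<delta> (Suc k) + c\<^sup>2 / 2) * (\<delta> k + \<bar>c\<bar>) = \<bar>c\<bar> * (\<delta> k * \<delta> (Suc k)) + c\<^sup>2 * \<delta> (Suc k) + c\<^sup>2 / 2 * \<delta> k + \<bar>c\<bar> ^ 3 / 2"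
  proof -
    have c2: "c\<^sup>2 = \<bar>c\<bar>\<^sup>2" by simp
    show ?thesis unfolding c2 by (simp add: algebra_simps power2_eq_square power3_eq_cube del: abs_mult_self_eq abs_mult_self)
  qed
  moreover have "0 \<le> c\<^sup>2 * \<delta> k" "0 \<le> \<bar>c\<bar> ^ 3" by simp_all
  moreover have "2 * c\<^sup>2 * (\<delta> k + \<delta> (Suc k)) = 2 * (c\<^sup>2 * \<delta> k) + 2 * (c\<^sup>2 * \<delta> (Suc k))"
    "c\<^sup>2 / 2 * \<delta> k = (c\<^sup>2 * \<delta> k) / 2" by (simp_all add: algebra_simps)
  ultimately show ?thesis
    unfolding eq using norm_triangle_ineq[of "\<integral>w. walk (Suc k) w * L (w k) \<partial>P" "\<integral>w. walk (Suc k) w * r (w k) \<partial>P"] 1 2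
    by linarith
qed

lemma norm_phi: "j < n \<Longrightarrow> norm (\<phi> j) \<le> 1"
  by (rule order_trans[OF integral_norm_bound]) (simp add: en prob_space)

text \<open>The recursion charges each index twice, once as \<open>Suc k\<close> and once as
  \<open>k\<close>. The subtracted terms are the share of the last index that has not been charged
  yet; with them the induction closes exactly. The condition on \<open>c\<close> keeps the
  contraction factor in [0, 1], so earlier errors do not grow.\<close>

lemma walk_bound:
  assumes c: "c\<^sup>2 \<le> 2" and k: "Suc k \<le> n"
  shows "norm ((\<integral>w. walk (Suc k) w \<partial>P) - (1 - c\<^sup>2 * kvar / 2) ^ k * (\<Prod>j<Suc k. \<phi> j))
    \<le> 2 * \<bar>c\<bar> * (\<Sum>j<Suc k. (\<delta> j)\<^sup>2) + 4 * c\<^sup>2 * (\<Sum>j<Suc k. \<delta> j) + k * \<bar>c\<bar> ^ 3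
       - \<bar>c\<bar> * (\<delta> k)\<^sup>2 - 2 * c\<^sup>2 * \<delta> k"
  using k
proof (induction k)
  case 0
  then have e0: "e 0 \<in> borel_measurable N" "\<And>x. norm (e 0 x) = 1" using em en by auto
  have [measurable]: "e 0 \<in> borel_measurable N" by (rule e0)
  have "(\<integral>w. walk (Suc 0) w \<partial>P) = (\<integral>w. (\<integral>z. walk (Suc 0) (fun_upd w 0 z) \<partial>N) \<partial>P)"
    using 0 by (intro resample walk_integrable) auto
  also have "\<dots> = \<phi> 0" unfolding walk_step by (simp add: walk_def angle_def P.prob_space)
  finally show ?case by simp
next
  case (Suc k)
  define b where "b = 1 - c\<^sup>2 * kvar / 2"
  have b1: "\<bar>b\<bar> \<le> 1"
    using c kvar mult_mono[of "c\<^sup>2" 2 kvar 1] mult_nonneg_nonneg[of "c\<^sup>2" kvar] unfolding b_def abs_le_iff by simp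
  let ?v = "\<lambda>k. \<integral>w. walk k w \<partial>P"
  have cb: "1 - (complex_of_real c)\<^sup>2 * complex_of_real kvar / 2 = complex_of_real b" by (simp add: b_def)
  have "?v (Suc (Suc k)) - b ^ Suc k * (\<Prod>j<Suc (Suc k). \<phi> j)
     = (?v (Suc (Suc k)) - \<phi> (Suc k) * b * ?v (Suc k)) + \<phi> (Suc k) * b * (?v (Suc k) - b ^ k * (\<Prod>j<Suc k. \<phi> j))"
    by (simp add: algebra_simps)
  then have A: "norm (?v (Suc (Suc k)) - b ^ Suc k * (\<Prod>j<Suc (Suc k). \<phi> j))
     \<le> norm (?v (Suc (Suc k)) - \<phi> (Suc k) * b * ?v (Suc k)) + norm (\<phi> (Suc k) * b * (?v (Suc k) - b ^ k * (\<Prod>j<Suc k. \<phi> j)))"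
    by (metis norm_triangle_ineq)
  have B: "norm (\<phi> (Suc k) * b * (?v (Suc k) - b ^ k * (\<Prod>j<Suc k. \<phi> j))) \<le> 1 * norm (?v (Suc k) - b ^ k * (\<Prod>j<Suc k. \<phi> j))"
    unfolding norm_mult[of "\<phi> (Suc k) * b"]
    using mult_mono[OF norm_phi[of "Suc k"], of "\<bar>b\<bar>" 1] b1 Suc.prems by (intro mult_right_mono) (auto simp: norm_mult)
  have C: "norm (?v (Suc (Suc k)) - \<phi> (Suc k) * b * ?v (Suc k))
    \<le> \<bar>c\<bar> * ((\<delta> k)\<^sup>2 + (\<delta> (Suc k))\<^sup>2) + 2 * c\<^sup>2 * (\<delta> k + \<delta> (Suc k)) + \<bar>c\<bar> ^ 3"
    using walk_recursion[OF Suc.prems] by (simp add: cb)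
  have D: "norm (?v (Suc k) - b ^ k * (\<Prod>j<Suc k. \<phi> j)) \<le> 2 * \<bar>c\<bar> * (\<Sum>j<Suc k. (\<delta> j)\<^sup>2) + 4 * c\<^sup>2 * (\<Sum>j<Suc k. \<delta> j) + k * \<bar>c\<bar> ^ 3
       - \<bar>c\<bar> * (\<delta> k)\<^sup>2 - 2 * c\<^sup>2 * \<delta> k"
    using Suc by (simp add: cb)
  have "norm (?v (Suc (Suc k)) - b ^ Suc k * (\<Prod>j<Suc (Suc k). \<phi> j)) \<le>
       2 * \<bar>c\<bar> * (\<Sum>j<Suc (Suc k). (\<delta> j)\<^sup>2) + 4 * c\<^sup>2 * (\<Sum>j<Suc (Suc k). \<delta> j) + Suc k * \<bar>c\<bar> ^ 3
       - \<bar>c\<bar> * (\<delta> (Suc k))\<^sup>2 - 2 * c\<^sup>2 * \<delta> (Suc k)"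
    unfolding sum.lessThan_Suc[of _ "Suc k"] distrib_left of_nat_Suc distrib_right
    using A B C D unfolding distrib_left by linarith
  then show ?case unfolding b_def by simp
qed

lemma walk_char:
  assumes c: "c\<^sup>2 \<le> 2" and n: "0 < n"
  shows "norm ((\<integral>w. walk n w \<partial>P) - (1 - c\<^sup>2 * kvar / 2) ^ (n - 1) * (\<Prod>j<n. \<phi> j))
    \<le> 2 * \<bar>c\<bar> * (\<Sum>j<n. (\<delta> j)\<^sup>2) + 4 * c\<^sup>2 * (\<Sum>j<n. \<delta> j) + n * \<bar>c\<bar> ^ 3"
proof -
  obtain k where k: "n = Suc k" using n by (cases n) auto
  have "0 \<le> \<bar>c\<bar> * (\<delta> k)\<^sup>2" "0 \<le> 2 * c\<^sup>2 * \<delta> k" "k * \<bar>c\<bar> ^ 3 \<le> n * \<bar>c\<bar> ^ 3"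
    by (auto simp: k intro!: mult_right_mono)
  moreover have "norm ((\<integral>w. walk n w \<partial>P) - (1 - c\<^sup>2 * kvar / 2) ^ (n - 1) * (\<Prod>j<n. \<phi> j))
    \<le> 2 * \<bar>c\<bar> * (\<Sum>j<n. (\<delta> j)\<^sup>2) + 4 * c\<^sup>2 * (\<Sum>j<n. \<delta> j) + k * \<bar>c\<bar> ^ 3 - \<bar>c\<bar> * (\<delta> k)\<^sup>2 - 2 * c\<^sup>2 * \<delta> k"
    using walk_bound[OF c, of k] k by simp
  ultimately show ?thesis by linarith
qed

end

end

section \<open>The uniform kernel and rank sums\<close>

text \<open>Restricting the space to the open interval puts every sample point strictly between 0
  and 1, where the quantile function is well behaved.\<close>

abbreviation unif :: "real measure" where
  "unif \<equiv> restrict_space lborel {0<..<1}"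

lemma space_unif: "space unif = {0<..<1}"
  by (simp add: space_restrict_space)

lemma prob_space_unif: "prob_space unif"
  by (auto simp: emeasure_restrict_space space_restrict_space intro!: prob_spaceI)

interpretation unif: prob_space unif by (rule prob_space_unif)

lemma unif_id[measurable]: "(\<lambda>x. x) \<in> measurable unif borel"
  by (rule measurable_restrict_space1) simp

lemma unif_fun: "f \<in> borel_measurable borel \<Longrightarrow> f \<in> measurable unif borel"
  by (rule measurable_compose[OF unif_id])

lemma unif_fst[measurable]: "fst \<in> measurable (unif \<Otimes>\<^sub>M M) borel"
  by (rule measurable_compose[OF measurable_fst unif_id])

lemma unif_snd[measurable]: "snd \<in> measurable (M \<Otimes>\<^sub>M unif) borel"
  by (rule measurable_compose[OF measurable_snd unif_id])

lemma unif_coord: "j \<in> I \<Longrightarrow> (\<lambda>w. w j) \<in> borel_measurable (PiM I (\<lambda>_. unif))"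
  by (rule measurable_compose[of "\<lambda>w. w j" _ unif, OF measurable_component_singleton unif_id])

lemma integral_unif:
  fixes f :: "real \<Rightarrow> real"
  assumes f: "f \<in> borel_measurable borel" and b: "\<And>x. 0 < x \<Longrightarrow> x < 1 \<Longrightarrow> \<bar>f x\<bar> \<le> K"
    and i: "(f has_integral I) {0..1}"
  shows "(\<integral>x. f x \<partial>unif) = I"
proof -
  have "integrable unif f"
    using f b by (intro unif.integrable_const_bound[of _ K] unif_fun) (auto simp: space_unif)
  then have s: "set_integrable lborel {0<..<1} f"
    by (simp add: integrable_restrict_space set_integrable_def)
  have "(\<integral>x. f x \<partial>unif) = set_lebesgue_integral lborel {0<..<1} f"
    by (simp add: integral_restrict_space set_lebesgue_integral_def)
  also have "\<dots> = integral {0<..<1} f" by (rule set_borel_integral_eq_integral(2)[OF s])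
  also have "\<dots> = I" using i integral_open_interval_real[of 0 1 f] by (simp add: integral_unique)
  finally show ?thesis .
qed

section \<open>The kernel and its projections\<close>

definition hump :: "real \<Rightarrow> real" where "hump u = u * (1 - u)"

text \<open>Hoeffding remainder of |u - v| for independent uniforms: each one-variable projection is
  1/2 - \<open>hump\<close>, the mean is 1/3, and the constant is - 1/2 - 1/2 + 1/3.\<close>

definition kern :: "real \<Rightarrow> real \<Rightarrow> real" where
  "kern u v = \<bar>u - v\<bar> + hump u + hump v - 2 / 3"

text \<open>Indicator of the half-open interval with end points \<open>a\<close> and
  \<open>b\<close>, upper end included. The form as a difference matches that of two ranks.\<close>

definition between :: "real \<Rightarrow> real \<Rightarrow> real \<Rightarrow> real" where
  "between a b z = \<bar>of_bool (z \<le> a) - of_bool (z \<le> b)\<bar>"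

text \<open>The degenerate part of the Hoeffding decomposition of \<open>between\<close> for independent uniform \<open>(a, b)\<close> and \<open>z\<close>.\<close>

definition between_rem :: "real \<Rightarrow> real \<Rightarrow> real \<Rightarrow> real" where
  "between_rem a b z = between a b z - \<bar>a - b\<bar> - 2 * hump z + 1 / 3"

lemma [measurable]: "hump \<in> borel_measurable borel"
  unfolding hump_def[abs_def] by measurable

lemma hump_bounds: "0 \<le> u \<Longrightarrow> u \<le> 1 \<Longrightarrow> 0 \<le> hump u \<and> hump u \<le> 1 / 4"
proof -
  assume "0 \<le> u" "u \<le> 1"
  moreover have "0 \<le> (u - 1 / 2)\<^sup>2" by simp
  ultimately show ?thesis
    using mult_nonneg_nonneg[of u "1 - u"] by (auto simp: hump_def power2_eq_square algebra_simps)
qed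

lemma hump_abs: "0 < u \<Longrightarrow> u < 1 \<Longrightarrow> \<bar>hump u\<bar> \<le> 1"
  using hump_bounds[of u] by auto

lemma integral_hump: "(\<integral>u. hump u \<partial>unif) = 1 / 6"
proof (rule integral_unif[where K=1])
  have "((\<lambda>u. u * (1 - u)) has_integral (1\<^sup>2 / 2 - 1 ^ 3 / 3 - (0\<^sup>2 / 2 - 0 ^ 3 / 3))) {0..1::real}"
    by (rule fundamental_theorem_of_calculus)
      (auto intro!: derivative_eq_intros simp: has_real_derivative_iff_has_vector_derivative[symmetric] algebra_simps power2_eq_square)
  then show "(hump has_integral 1 / 6) {0..1}" by (simp add: hump_def[abs_def])
  show "\<bar>hump x\<bar> \<le> 1" if "0 < x" "x < 1" for x using hump_bounds[of x] that by auto
qed simp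

lemma integral_absdiff:
  assumes "0 < u" "u < 1" shows "(\<integral>v. \<bar>u - v\<bar> \<partial>unif) = 1 / 2 - hump u"
proof (rule integral_unif[where K=1])
  have 1: "((\<lambda>v. u - v) has_integral (u * u - u\<^sup>2 / 2 - (u * 0 - 0\<^sup>2 / 2))) {0..u}"
    using assms by (intro fundamental_theorem_of_calculus[of 0 u "\<lambda>v. u * v - v\<^sup>2 / 2"])
      (auto intro!: derivative_eq_intros simp: has_real_derivative_iff_has_vector_derivative[symmetric])
  have 1: "((\<lambda>v. \<bar>u - v\<bar>) has_integral (u * u - u\<^sup>2 / 2)) {0..u}"
    by (rule has_integral_eq[OF _ 1[simplified]]) auto
  have 2: "((\<lambda>v. v - u) has_integral (1\<^sup>2 / 2 - u * 1 - (u\<^sup>2 / 2 - u * u))) {u..1}"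
    using assms by (intro fundamental_theorem_of_calculus[of u 1 "\<lambda>v. v\<^sup>2 / 2 - u * v"])
      (auto intro!: derivative_eq_intros simp: has_real_derivative_iff_has_vector_derivative[symmetric])
  have 2: "((\<lambda>v. \<bar>u - v\<bar>) has_integral (1\<^sup>2 / 2 - u * 1 - (u\<^sup>2 / 2 - u * u))) {u..1}"
    by (rule has_integral_eq[OF _ 2]) auto
  have 3: "((\<lambda>v. \<bar>u - v\<bar>) has_integral (u * u - u\<^sup>2 / 2 + (1\<^sup>2 / 2 - u * 1 - (u\<^sup>2 / 2 - u * u)))) {0..1}"
    using assms by (intro has_integral_combine[OF _ _ 1 2]) auto
  have 4: "u * u - u\<^sup>2 / 2 + (1\<^sup>2 / 2 - u * 1 - (u\<^sup>2 / 2 - u * u)) = 1 / 2 - hump u"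
    by (simp add: hump_def power2_eq_square algebra_simps)
  show "((\<lambda>v. \<bar>u - v\<bar>) has_integral (1 / 2 - hump u)) {0..1}" using 3 unfolding 4 .
qed (use assms in auto)

lemma integral_unif_indicator:
  assumes "S \<in> sets borel" "S \<subseteq> {0<..<1}"
  shows "(\<integral>x. indicator S x \<partial>unif) = measure lborel S"
proof -
  have "S \<in> sets unif" using assms by (auto simp: sets_restrict_space)
  then show ?thesis using assms by (simp add: measure_restrict_space space_unif Int_absorb2)
qed

lemma integral_of_bool_le:
  assumes "0 < z" "z < 1"
  shows "(\<integral>a. of_bool (z \<le> a) \<partial>unif) = 1 - z"
proof -
  have "(\<integral>a. of_bool (z \<le> a) \<partial>unif) = (\<integral>a. indicator {z..<1} a \<partial>unif)"
    by (intro Bochner_Integration.integral_cong refl) (simp add: space_unif indicator_def)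
  also have "\<dots> = 1 - z" using assms by (subst integral_unif_indicator) auto
  finally show ?thesis .
qed

lemma between_eq: "between a b z = of_bool (z \<le> a) + of_bool (z \<le> b) - 2 * (of_bool (z \<le> a) * of_bool (z \<le> b))"
  by (simp add: between_def)

lemma between_bounds: "0 \<le> between a b z" "between a b z \<le> 1" "\<bar>between a b z\<bar> \<le> 1"
  by (auto simp: between_def)

lemma integral_between:
  assumes "0 < a" "a < 1" "0 < b" "b < 1" shows "(\<integral>z. between a b z \<partial>unif) = \<bar>a - b\<bar>"
proof -
  have "between a b = indicator {min a b<..max a b}" by (auto simp: between_def indicator_def fun_eq_iff)
  then show ?thesis using assms by (simp only:) (subst integral_unif_indicator, auto)
qed

lemma integrable_unif:
  fixes f :: "real \<Rightarrow> real"
  assumes "f \<in> borel_measurable borel" "\<And>x. 0 < x \<Longrightarrow> x < 1 \<Longrightarrow> \<bar>f x\<bar> \<le> K"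
  shows "integrable unif f"
  using assms by (intro unif.integrable_const_bound[of _ K] unif_fun) (auto simp: space_unif)

lemma integral_between_rem_z:
  assumes "0 < a" "a < 1" "0 < b" "b < 1" shows "(\<integral>z. between_rem a b z \<partial>unif) = 0"
proof -
  have m: "between a b \<in> borel_measurable borel" unfolding between_def[abs_def] by measurable
  have "integrable unif (between a b)" by (intro integrable_unif[of _ 1] m between_bounds)
  moreover have "integrable unif hump" by (intro integrable_unif[of _ 1] hump_abs) auto
  ultimately show ?thesis
    unfolding between_rem_def using integral_between[OF assms] integral_hump unif.prob_space by simp
qed

text \<open>Both \<open>a\<close> and \<open>b\<close> must be integrated out; the mean over
  \<open>b\<close> alone is in general not zero. This decides which pairs of terms are orthogonal
  later on.\<close>

lemma integral_between_rem_ab: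
  assumes z: "0 < z" "z < 1" shows "(\<integral>a. (\<integral>b. between_rem a b z \<partial>unif) \<partial>unif) = 0"
proof -
  have ib: "integrable unif (\<lambda>b. of_bool (z \<le> b) :: real)" by (intro integrable_unif[of _ 1]) auto
  have ia: "integrable unif (\<lambda>b. \<bar>a - b\<bar>)" if "0 < a" "a < 1" for a
    using that by (intro integrable_unif[of _ 1]) auto
  have ih: "integrable unif hump" by (intro integrable_unif[of _ 1] hump_abs) auto
  have 1: "(\<integral>b. between_rem a b z \<partial>unif) = of_bool (z \<le> a) + (1 - z) - 2 * (of_bool (z \<le> a) * (1 - z)) - (1 / 2 - hump a) - 2 * hump z + 1 / 3"
    if "0 < a" "a < 1" for a
    unfolding between_rem_def between_eq
    using ib ia[OF that] integral_of_bool_le[OF z] integral_absdiff[OF that] unif.prob_space by simp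
  have "(\<integral>a. (\<integral>b. between_rem a b z \<partial>unif) \<partial>unif)
      = (\<integral>a. of_bool (z \<le> a) + (1 - z) - 2 * (of_bool (z \<le> a) * (1 - z)) - (1 / 2 - hump a) - 2 * hump z + 1 / 3 \<partial>unif)"
    by (intro Bochner_Integration.integral_cong refl 1) (auto simp: space_unif)
  also have "\<dots> = (1 - z) + (1 - z) - 2 * ((1 - z) * (1 - z)) - (1 / 2 - 1 / 6) - 2 * hump z + 1 / 3"
    using ib ih integral_of_bool_le[OF z] integral_hump unif.prob_space by simp
  also have "\<dots> = 0" by (simp add: hump_def algebra_simps)
  finally show ?thesis .
qed

lemma between_rem_bound:
  assumes "0 < a" "a < 1" "0 < b" "b < 1" "0 < z" "z < 1" shows "\<bar>between_rem a b z\<bar> \<le> 2"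
  using assms between_bounds[of a b z] hump_bounds[of z] unfolding between_rem_def by linarith

lemma kern_bounds:
  assumes "0 < u" "u < 1" "0 < v" "v < 1" shows "\<bar>kern u v\<bar> \<le> 1"
  using hump_bounds[of u] hump_bounds[of v] assms
proof -
  have *: "\<bar>kern u v\<bar> \<le> 1" if "0 < v" "v \<le> u" "u < 1" for u v
  proof -
    \<comment> \<open>For v \<le> u completing the squares removes the absolute value and shows that
      the values lie in [-2/3, 1/3].\<close>
    have "kern u v = 1 - (1 - u)\<^sup>2 - v\<^sup>2 - 2 / 3"
      using that by (simp add: kern_def hump_def power2_eq_square algebra_simps)
    moreover have "(1 - u)\<^sup>2 \<le> (1 - v)\<^sup>2" using that by (intro power_mono) auto
    moreover have "(1 - v)\<^sup>2 + v\<^sup>2 = 1 - 2 * hump v" by (simp add: hump_def power2_eq_square algebra_simps)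
    moreover have "0 \<le> hump v" using hump_bounds[of v] that by auto
    moreover have "0 \<le> (1 - u)\<^sup>2" "0 \<le> v\<^sup>2" by simp_all
    ultimately show ?thesis by linarith
  qed
  have "kern u v = kern v u" by (simp add: kern_def abs_minus_commute)
  then show ?thesis using *[of u v] *[of v u] assms by (cases "v \<le> u") auto
qed

lemma kern_integral: assumes "0 < u" "u < 1" shows "(\<integral>v. kern u v \<partial>unif) = 0"
proof -
  have ih: "integrable unif hump" by (intro integrable_unif[of _ 1] hump_abs) auto
  have ia: "integrable unif (\<lambda>b. \<bar>u - b\<bar>)"
    using assms by (intro integrable_unif[of _ 1]) auto
  show ?thesis
    unfolding kern_def using ih ia integral_absdiff[OF assms] integral_hump unif.prob_space by simp
qed

interpretation kern: degenerate_kernel unif kern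
proof
  show "(\<lambda>(x, y). kern x y) \<in> borel_measurable (unif \<Otimes>\<^sub>M unif)"
    unfolding kern_def by measurable
  show "(\<integral>x. kern x y \<partial>unif) = 0" if "y \<in> space unif" for y
    using kern_integral[of y] that by (simp add: space_unif kern_def abs_minus_commute add_ac)
qed (auto simp: space_unif kern_bounds kern_integral)

text \<open>Needed for a nondegenerate limit. On the corner where both arguments are at most 1/10
  the kernel is at most 3/10 - 2/3, hence below -1/3, so its second moment is at least
  \<open>p\<^sup>2\<close> / 9 with p the mass of (0, 1/10].\<close>

lemma kvar_pos: "0 < kern.kvar"
proof -
  have m: "(\<lambda>v. (kern u v)\<^sup>2) \<in> borel_measurable borel" for u unfolding kern_def by measurable
  have ind: "(\<lambda>v::real. of_bool (v \<le> 1 / 10) :: real) \<in> borel_measurable borel" by measurable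
  define p where "p = (\<integral>v. of_bool (v \<le> 1 / 10) \<partial>unif :: real)"
  have p: "0 < p"
  proof -
    have "1 - p = (\<integral>v. 1 - of_bool (v \<le> 1 / 10) \<partial>unif)"
      unfolding p_def using integrable_unif[OF ind, of 1] unif.prob_space by simp
    also have "\<dots> \<le> (\<integral>v. of_bool (1 / 10 \<le> v) \<partial>unif)"
      by (intro integral_mono integrable_unif[of _ 1] Bochner_Integration.integrable_diff) auto
    also have "\<dots> = 9 / 10" using integral_of_bool_le[of "1 / 10"] by simp
    finally show ?thesis by simp
  qed
  have low: "(1 / 9) * of_bool (u \<le> 1 / 10) * of_bool (v \<le> 1 / 10) \<le> (kern u v)\<^sup>2"
    if "0 < u" "0 < v" for u v
  proof (cases "u \<le> 1 / 10 \<and> v \<le> 1 / 10")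
    case True
    have "hump u \<le> u * 1" "hump v \<le> v * 1" unfolding hump_def using that by (intro mult_left_mono; simp)+
    then have "kern u v \<le> - 1 / 3" using True that unfolding kern_def by linarith
    then have "(1 / 3)\<^sup>2 \<le> (- kern u v)\<^sup>2" by (intro power_mono) auto
    then show ?thesis using True by (simp add: power2_eq_square)
  qed auto
  have v: "(p / 9) * of_bool (u \<le> 1 / 10) \<le> kern.var2 u" if u: "0 < u" "u < 1" for u
  proof -
    have "(\<integral>v. (1 / 9) * of_bool (u \<le> 1 / 10) * of_bool (v \<le> 1 / 10) \<partial>unif) \<le> (\<integral>v. (kern u v)\<^sup>2 \<partial>unif)"
      using low u kern_bounds[OF u]
      by (intro integral_mono integrable_unif[OF m, of _ 1] integrable_unif[of _ 1]) (auto simp: space_unif abs_square_le_1)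
    moreover have "(\<integral>v. (1 / 9) * of_bool (u \<le> 1 / 10) * of_bool (v \<le> 1 / 10) \<partial>unif) = (p / 9) * of_bool (u \<le> 1 / 10)"
      unfolding p_def by (simp add: integral_mult_right_zero)
    ultimately show ?thesis by (simp only: kern.var2_def)
  qed
  have iv: "integrable unif kern.var2"
    using kern.var2 by (intro unif.integrable_const_bound[of _ 1]) auto
  have "(p / 9) * p = (\<integral>u. (p / 9) * of_bool (u \<le> 1 / 10) \<partial>unif)" unfolding p_def by simp
  also have "\<dots> \<le> kern.kvar"
    unfolding kern.kvar_def
  proof (rule integral_mono[OF _ iv])
    show "integrable unif (\<lambda>u. (p / 9) * of_bool (u \<le> 1 / 10))"
      using p by (intro integrable_unif[of _ "p / 9"]) auto
  qed (use v in \<open>auto simp: space_unif\<close>)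
  finally have "(p / 9) * p \<le> kern.kvar" .
  moreover have "0 < (p / 9) * p" using p by simp
  ultimately show ?thesis by linarith
qed

section \<open>Second moment of the degenerate remainder\<close>

context
  fixes n :: nat
begin

abbreviation unif_sample :: "(nat \<Rightarrow> real) measure" where "unif_sample \<equiv> PiM {..<n} (\<lambda>_. unif)"

interpretation U: prob_space unif_sample by (rule prob_space_PiM) (rule prob_space_unif)

lemma space_unif_sample: "w \<in> space unif_sample \<Longrightarrow> j < n \<Longrightarrow> 0 < w j \<and> w j < 1"
  using PiE_mem[of w "{..<n}" "\<lambda>_. {0<..<1}" j] by (simp add: space_PiM space_unif)

text \<open>A gap (i, i + 1) together with an observation j at neither of its ends, so that three
  independent coordinates are involved.\<close>

definition free_pairs :: "(nat \<times> nat) set" where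
  "free_pairs = {(i, j). Suc i < n \<and> j < n \<and> j \<noteq> i \<and> j \<noteq> Suc i}"

text \<open>The pairs whose terms may be correlated with that of (i, j): either the same j with an
  equal or overlapping gap, or j at an end of the other gap while the other point is at an end of
  this one. Truncation of \<open>i - 1\<close> or \<open>j - 1\<close> at 0 only repeats
  members.\<close>

definition near_pairs :: "nat \<times> nat \<Rightarrow> (nat \<times> nat) set" where
  "near_pairs = (\<lambda>(i, j). {(i - 1, j), (i, j), (Suc i, j), (j, i), (j, Suc i), (j - 1, i), (j - 1, Suc i)})"

definition rem_term :: "nat \<times> nat \<Rightarrow> (nat \<Rightarrow> real) \<Rightarrow> real" where
  "rem_term = (\<lambda>(i, j) w. between_rem (w i) (w (Suc i)) (w j))"

lemma between_rem_meas:
  assumes [measurable]: "f \<in> borel_measurable M" "g \<in> borel_measurable M" "k \<in> borel_measurable M"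
  shows "(\<lambda>x. between_rem (f x) (g x) (k x)) \<in> borel_measurable M"
  unfolding between_rem_def between_def by measurable

lemma rem_term_meas: assumes "p \<in> free_pairs" shows "rem_term p \<in> borel_measurable unif_sample"
proof -
  obtain i j where p: "p = (i, j)" by (cases p)
  then show ?thesis
    using assms unfolding p rem_term_def prod.case by (intro between_rem_meas unif_coord) (simp_all add: free_pairs_def)
qed

lemma rem_term_bound: "p \<in> free_pairs \<Longrightarrow> w \<in> space unif_sample \<Longrightarrow> \<bar>rem_term p w\<bar> \<le> 2"
  unfolding rem_term_def free_pairs_def using space_unif_sample[of w] by (cases p) (simp add: between_rem_bound)

lemma rem_term_prod_bound:
  assumes "p \<in> free_pairs" "q \<in> free_pairs" "w \<in> space unif_sample"
  shows "\<bar>rem_term p w * rem_term q w\<bar> \<le> 4"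
  using mult_mono[OF rem_term_bound[OF assms(1,3)] rem_term_bound[OF assms(2,3)]] by (simp add: abs_mult)

lemma rem_term_prod_integrable: "p \<in> free_pairs \<Longrightarrow> q \<in> free_pairs \<Longrightarrow> integrable unif_sample (\<lambda>w. rem_term p w * rem_term q w)"
  by (intro U.integrable_const_bound[of _ 4] AE_I2 borel_measurable_times rem_term_meas) (simp_all add: rem_term_prod_bound del: abs_mult)

lemma resample_unif:
  fixes F :: "(nat \<Rightarrow> real) \<Rightarrow> real"
  assumes "integrable unif_sample F" "j < n"
  shows "(\<integral>w. F w \<partial>unif_sample) = (\<integral>w. (\<integral>z. F (fun_upd w j z) \<partial>unif) \<partial>unif_sample)"
  using assms by (intro integral_PiM_fun_upd prob_space_unif) auto

text \<open>If coordinate \<open>j\<close> does not occur in the second term, integrating it out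
  annihilates the first.\<close>

lemma rem_term_orthogonal_z:
  assumes p: "(i, j) \<in> free_pairs" and q: "(i', j') \<in> free_pairs" and j: "j \<noteq> i'" "j \<noteq> Suc i'" "j \<noteq> j'"
  shows "(\<integral>w. rem_term (i, j) w * rem_term (i', j') w \<partial>unif_sample) = 0"
proof -
  have "(\<integral>w. rem_term (i, j) w * rem_term (i', j') w \<partial>unif_sample)
      = (\<integral>w. (\<integral>z. rem_term (i, j) (fun_upd w j z) * rem_term (i', j') (fun_upd w j z) \<partial>unif) \<partial>unif_sample)"
    using p by (intro resample_unif rem_term_prod_integrable p q) (auto simp: free_pairs_def)
  also have "\<dots> = (\<integral>w. (\<integral>z. between_rem (w i) (w (Suc i)) z \<partial>unif) * rem_term (i', j') w \<partial>unif_sample)"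
    using p j by (auto simp: rem_term_def free_pairs_def)
  also have "\<dots> = (\<integral>w. 0 \<partial>unif_sample)"
    using p space_unif_sample by (intro Bochner_Integration.integral_cong refl) (auto simp: free_pairs_def integral_between_rem_z)
  finally show ?thesis by simp
qed

text \<open>With a common \<open>j\<close> and disjoint gaps, neither end of the first gap occurs in
  the second term. Both ends are integrated out in turn, \<open>Suc i\<close> before
  \<open>i\<close>.\<close>

lemma rem_term_orthogonal_ab:
  assumes p: "(i, j) \<in> free_pairs" and q: "(i', j) \<in> free_pairs" and i: "i' \<noteq> i" "i' \<noteq> Suc i" "i \<noteq> Suc i'"
  shows "(\<integral>w. rem_term (i, j) w * rem_term (i', j) w \<partial>unif_sample) = 0"
proof -
  have n: "i < n" "Suc i < n" "j < n" "j \<noteq> i" "j \<noteq> Suc i" "i' < n" "Suc i' < n" using p q by (simp_all add: free_pairs_def)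
  let ?F = "\<lambda>w. (\<integral>b. between_rem (w i) b (w j) \<partial>unif) * rem_term (i', j) w"
  have bd: "\<bar>\<integral>b. between_rem a b z \<partial>unif\<bar> \<le> 2" if "0 < a" "a < 1" "0 < z" "z < 1" for a z
  proof -
    have "(\<lambda>b. between_rem a b z) \<in> borel_measurable borel" by (intro between_rem_meas) auto
    then have i: "integrable unif (\<lambda>b. between_rem a b z)" using that by (intro integrable_unif[of _ 2] between_rem_bound)
    show ?thesis
    proof (rule order_trans[OF integral_abs_bound], rule unif.integral_le_const)
      show "integrable unif (\<lambda>b. \<bar>between_rem a b z\<bar>)" using i by simp
      show "AE b in unif. \<bar>between_rem a b z\<bar> \<le> 2" using that by (intro AE_I2 between_rem_bound) (simp_all add: space_unif)
    qed
  qed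
  have mF: "(\<lambda>w. \<integral>b. between_rem (w i) b (w j) \<partial>unif) \<in> borel_measurable unif_sample"
  proof (rule unif.borel_measurable_lebesgue_integral)
    show "(\<lambda>(w, b). between_rem (w i) b (w j)) \<in> borel_measurable (unif_sample \<Otimes>\<^sub>M unif)"
      unfolding case_prod_beta' using n
      by (intro between_rem_meas measurable_compose[OF measurable_fst] unif_coord unif_snd) auto
  qed
  have "(\<integral>w. rem_term (i, j) w * rem_term (i', j) w \<partial>unif_sample)
      = (\<integral>w. (\<integral>b. rem_term (i, j) (fun_upd w (Suc i) b) * rem_term (i', j) (fun_upd w (Suc i) b) \<partial>unif) \<partial>unif_sample)"
    using n by (intro resample_unif rem_term_prod_integrable p q)
  also have "\<dots> = (\<integral>w. ?F w \<partial>unif_sample)"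
    using n i by (simp add: rem_term_def)
  also have "\<dots> = (\<integral>w. (\<integral>a. ?F (fun_upd w i a) \<partial>unif) \<partial>unif_sample)"
  proof (rule resample_unif)
    show "integrable unif_sample ?F"
    proof (intro U.integrable_const_bound[of _ 4] AE_I2 borel_measurable_times mF rem_term_meas q)
      fix w assume "w \<in> space unif_sample"
      then have "\<bar>\<integral>b. between_rem (w i) b (w j) \<partial>unif\<bar> \<le> 2" "\<bar>rem_term (i', j) w\<bar> \<le> 2"
        using bd[of "w i" "w j"] space_unif_sample[of w i] space_unif_sample[of w j] rem_term_bound[OF q] n by simp_all
      then have "\<bar>\<integral>b. between_rem (w i) b (w j) \<partial>unif\<bar> * \<bar>rem_term (i', j) w\<bar> \<le> 2 * 2" by (intro mult_mono) auto
      then show "norm (?F w) \<le> 4" unfolding real_norm_def abs_mult by simp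
    qed
  qed fact
  also have "\<dots> = (\<integral>w. (\<integral>a. \<integral>b. between_rem a b (w j) \<partial>unif \<partial>unif) * rem_term (i', j) w \<partial>unif_sample)"
    using n i by (simp add: rem_term_def)
  also have "\<dots> = (\<integral>w. 0 \<partial>unif_sample)"
  proof (rule Bochner_Integration.integral_cong[OF refl])
    fix w assume "w \<in> space unif_sample"
    then have "0 < w j" "w j < 1" using space_unif_sample n(3) by auto
    then show "(\<integral>a. \<integral>b. between_rem a b (w j) \<partial>unif \<partial>unif) * rem_term (i', j) w = 0" by (simp only: integral_between_rem_ab mult_zero_left)
  qed
  finally show ?thesis by simp
qed

lemma rem_term_orthogonal:
  assumes p: "p \<in> free_pairs" and q: "q \<in> free_pairs" and "q \<notin> near_pairs p"
  shows "(\<integral>w. rem_term p w * rem_term q w \<partial>unif_sample) = 0"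
proof -
  obtain i j i' j' where pq: "p = (i, j)" "q = (i', j')" using surj_pair[of p] surj_pair[of q] by blast
  have nn: "\<not> (j = j' \<and> (i' = i - 1 \<or> i' = i \<or> i' = Suc i))" "\<not> ((j' = i \<or> j' = Suc i) \<and> (i' = j \<or> i' = j - 1))"
    using assms(3) unfolding near_pairs_def pq prod.case by blast+
  \<comment> \<open>If each of j and j' is met by the other term, then either j = j', or each lies
    at an end of the other gap; \<open>near_pairs\<close> covers all of this except j = j' with
    disjoint gaps.\<close>
  have dj: "(j \<noteq> i' \<and> j \<noteq> Suc i' \<and> j \<noteq> j') \<or> (j' \<noteq> i \<and> j' \<noteq> Suc i \<and> j' \<noteq> j) \<or> (j = j' \<and> i' \<noteq> i \<and> i' \<noteq> Suc i \<and> i \<noteq> Suc i')"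
    using nn by presburger
  consider "j \<noteq> i'" "j \<noteq> Suc i'" "j \<noteq> j'" | "j' \<noteq> i" "j' \<noteq> Suc i" "j' \<noteq> j"
    | "j = j'" "i' \<noteq> i" "i' \<noteq> Suc i" "i \<noteq> Suc i'"
    using dj by blast
  then show ?thesis
  proof cases
    case 1 then show ?thesis using p q unfolding pq by (intro rem_term_orthogonal_z)
  next
    case 2
    then have "(\<integral>w. rem_term q w * rem_term p w \<partial>unif_sample) = 0" using p q unfolding pq by (intro rem_term_orthogonal_z)
    then show ?thesis by (simp add: mult.commute)
  next
    case 3 then show ?thesis using p q unfolding pq by (auto intro!: rem_term_orthogonal_ab)
  qed
qed

lemma finite_free_pairs: "finite free_pairs" "card free_pairs \<le> n * n"
proof -
  have sub: "free_pairs \<subseteq> {..<n} \<times> {..<n}" by (auto simp: free_pairs_def)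
  then show "finite free_pairs" by (rule finite_subset) simp
  show "card free_pairs \<le> n * n" using card_mono[OF _ sub] by simp
qed

lemma near_pairs_card: "finite (near_pairs p)" "card (near_pairs p) \<le> 7"
proof -
  obtain i j where p: "p = (i, j)" by (cases p)
  show "finite (near_pairs p)" by (simp add: p near_pairs_def)
  have "near_pairs p = set [(i - 1, j), (i, j), (Suc i, j), (j, i), (j, Suc i), (j - 1, i), (j - 1, Suc i)]"
    by (simp add: p near_pairs_def)
  then have "card (near_pairs p) \<le> length [(i - 1, j), (i, j), (Suc i, j), (j, i), (j, Suc i), (j - 1, i), (j - 1, Suc i)]"
    by (metis card_length)
  then show "card (near_pairs p) \<le> 7" by simp
qed

definition rem_sum :: "(nat \<Rightarrow> real) \<Rightarrow> real" where "rem_sum w = (\<Sum>p\<in>free_pairs. rem_term p w)"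

lemma rem_sum_meas: "rem_sum \<in> borel_measurable unif_sample"
  unfolding rem_sum_def[abs_def] by (intro borel_measurable_sum rem_term_meas)

text \<open>Each of the at most \<open>n\<^sup>2\<close> terms is correlated with at most 7 others,
  itself included, and every product is at most 4; this gives the 28.\<close>

lemma rem_sum_sq: "integrable unif_sample (\<lambda>w. (rem_sum w)\<^sup>2)" "(\<integral>w. (rem_sum w)\<^sup>2 \<partial>unif_sample) \<le> 28 * (real n)\<^sup>2"
proof -
  have eq: "(rem_sum w)\<^sup>2 = (\<Sum>p\<in>free_pairs. \<Sum>q\<in>free_pairs. rem_term p w * rem_term q w)" for w
    by (simp add: rem_sum_def power2_eq_square sum_product)
  show "integrable unif_sample (\<lambda>w. (rem_sum w)\<^sup>2)"
    unfolding eq by (intro Bochner_Integration.integrable_sum rem_term_prod_integrable)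
  have "(\<integral>w. (rem_sum w)\<^sup>2 \<partial>unif_sample) = (\<Sum>p\<in>free_pairs. \<Sum>q\<in>free_pairs. \<integral>w. rem_term p w * rem_term q w \<partial>unif_sample)"
    unfolding eq using rem_term_prod_integrable by (simp add: Bochner_Integration.integral_sum Bochner_Integration.integrable_sum)
  also have "\<dots> \<le> (\<Sum>p\<in>free_pairs. 28)"
  proof (rule sum_mono)
    fix p assume p: "p \<in> free_pairs"
    have "(\<Sum>q\<in>free_pairs. \<integral>w. rem_term p w * rem_term q w \<partial>unif_sample) = (\<Sum>q\<in>free_pairs \<inter> near_pairs p. \<integral>w. rem_term p w * rem_term q w \<partial>unif_sample)"
      using finite_free_pairs p rem_term_orthogonal by (intro sum.mono_neutral_right) auto
    also have "\<dots> \<le> (\<Sum>q\<in>free_pairs \<inter> near_pairs p. 4)"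
    proof (intro sum_mono U.integral_le_const rem_term_prod_integrable p AE_I2)
      fix q w assume "q \<in> free_pairs \<inter> near_pairs p" "w \<in> space unif_sample"
      then show "rem_term p w * rem_term q w \<le> 4" using rem_term_prod_bound[OF p, of q w] by (simp add: abs_le_iff)
    qed auto
    also have "\<dots> \<le> 28"
      using card_mono[OF near_pairs_card(1), of "free_pairs \<inter> near_pairs p" p] near_pairs_card(2)[of p] by simp
    finally show "(\<Sum>q\<in>free_pairs. \<integral>w. rem_term p w * rem_term q w \<partial>unif_sample) \<le> 28" .
  qed
  also have "\<dots> \<le> 28 * (real n)\<^sup>2"
    using finite_free_pairs(2) by (simp add: power2_eq_square flip: of_nat_mult)
  finally show "(\<integral>w. (rem_sum w)\<^sup>2 \<partial>unif_sample) \<le> 28 * (real n)\<^sup>2" .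
qed

text \<open>From |R| \<le> \<open>R\<^sup>2\<close> / (2 n) + n / 2 the first moment is at most 14 n
  + n / 2.\<close>

lemma rem_sum_abs: assumes n: "0 < n" shows "integrable unif_sample rem_sum" "(\<integral>w. \<bar>rem_sum w\<bar> \<partial>unif_sample) \<le> 15 * real n"
proof -
  show i: "integrable unif_sample rem_sum"
    using rem_sum_sq(1) by (rule U.square_integrable_imp_integrable[OF rem_sum_meas])
  have "\<bar>rem_sum w\<bar> \<le> (rem_sum w)\<^sup>2 / (2 * n) + n / 2" for w
  proof -
    have "0 \<le> (\<bar>rem_sum w\<bar> - n)\<^sup>2" by simp
    then have "2 * n * \<bar>rem_sum w\<bar> \<le> (rem_sum w)\<^sup>2 + (real n)\<^sup>2" by (simp add: power2_diff mult_ac)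
    then have "\<bar>rem_sum w\<bar> \<le> ((rem_sum w)\<^sup>2 + (real n)\<^sup>2) / (2 * n)" using n by (simp add: pos_le_divide_eq mult_ac)
    also have "\<dots> = (rem_sum w)\<^sup>2 / (2 * n) + n / 2" using n by (simp add: add_divide_distrib power2_eq_square)
    finally show ?thesis .
  qed
  then have "(\<integral>w. \<bar>rem_sum w\<bar> \<partial>unif_sample) \<le> (\<integral>w. (rem_sum w)\<^sup>2 / (2 * n) + n / 2 \<partial>unif_sample)"
    using i rem_sum_sq(1) by (intro integral_mono) auto
  also have "\<dots> = (\<integral>w. (rem_sum w)\<^sup>2 \<partial>unif_sample) / (2 * n) + n / 2"
    using rem_sum_sq(1) by (simp add: U.prob_space)
  also have "\<dots> \<le> 28 * (real n)\<^sup>2 / (2 * n) + n / 2"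
    using rem_sum_sq(2) by (intro add_mono divide_right_mono) auto
  also have "\<dots> \<le> 15 * real n" using n by (simp add: power2_eq_square)
  finally show "(\<integral>w. \<bar>rem_sum w\<bar> \<partial>unif_sample) \<le> 15 * real n" .
qed

section \<open>Rank variation in terms of the kernel\<close>

definition rank :: "(nat \<Rightarrow> real) \<Rightarrow> nat \<Rightarrow> nat" where
  "rank w i = card {j. j < n \<and> w j \<le> w i}"

definition rank_variation :: "(nat \<Rightarrow> real) \<Rightarrow> real" where
  "rank_variation w = (\<Sum>i<n - 1. \<bar>real (rank w (i + 1)) - real (rank w i)\<bar>)"

definition rank_stat :: "(nat \<Rightarrow> real) \<Rightarrow> real" where
  "rank_stat w = 1 - 3 * rank_variation w / ((real n)\<^sup>2 - 1)"

definition kern_sum :: "(nat \<Rightarrow> real) \<Rightarrow> real" where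
  "kern_sum w = (\<Sum>i<n - 1. kern (w i) (w (Suc i)))"

text \<open>Ranks are monotone in the value, so all differences of indicators have the same sign and
  the absolute value may be moved inside the sum.\<close>

lemma rank_diff: "\<bar>real (rank w a) - real (rank w b)\<bar> = (\<Sum>j<n. between (w b) (w a) (w j))"
proof -
  have r: "real (rank w i) = (\<Sum>j<n. of_bool (w j \<le> w i))" for i
  proof -
    have "{..<n} \<inter> {j. w j \<le> w i} = {j. j < n \<and> w j \<le> w i}" by auto
    then show ?thesis by (simp add: rank_def sum_of_bool_eq)
  qed
  have *: "\<bar>real (rank w a) - real (rank w b)\<bar> = (\<Sum>j<n. between (w b) (w a) (w j))" if "w b \<le> w a" for a b
  proof -
    have le: "(of_bool (w j \<le> w b) :: real) \<le> of_bool (w j \<le> w a)" for j using that by auto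
    have "\<bar>real (rank w a) - real (rank w b)\<bar> = (\<Sum>j<n. of_bool (w j \<le> w a) - of_bool (w j \<le> w b))"
      unfolding r sum_subtractf[symmetric] using le by (intro abs_of_nonneg sum_nonneg) auto
    also have "\<dots> = (\<Sum>j<n. between (w b) (w a) (w j))"
      using le by (intro sum.cong) (auto simp: between_def)
    finally show ?thesis .
  qed
  have "between x y z = between y x z" for x y z by (simp add: between_def abs_minus_commute)
  then show ?thesis using *[of b a] *[of a b] by (cases "w b \<le> w a") (auto simp: abs_minus_commute)
qed

text \<open>The projection of \<open>between\<close> onto the counted point, summed over all gaps,
  supplies the \<open>hump\<close> terms that turn the sum of |u - v| into \<open>kern_sum\<close>.
  What does not match is of order n: one surplus \<open>hump\<close> sum, the two boundary values,
  and the terms where the counted point is an end of its own gap.\<close>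

lemma rank_sum_decomp:
  assumes n: "2 \<le> n" and w: "w \<in> space unif_sample"
  shows "\<bar>rank_variation w
     - (n * kern_sum w + n * (real n - 1) / 3 + rem_sum w)\<bar> \<le> 6 * n"
proof -
  obtain m where m: "n = Suc m" "0 < m" using n by (cases n) auto
  have n1: "n - 1 = m" by (simp add: m)
  have u: "0 < w j" "w j < 1" if "j < n" for j using space_unif_sample[OF w that] by auto
  let ?r = "\<lambda>i j. between_rem (w i) (w (Suc i)) (w j)"
  \<comment> \<open>The terms excluded from \<open>free_pairs\<close>: here the counted point
    coincides with an end of the gap.\<close>
  define E where "E = (\<Sum>i<m. ?r i i + ?r i (Suc i))"
  have split: "(\<Sum>i<m. \<Sum>j<n. ?r i j) = rem_sum w + E"
  proof -
    have "free_pairs = Sigma {..<m} (\<lambda>i. {..<n} - {i, Suc i})" unfolding free_pairs_def using m(1) by auto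
    then have R: "rem_sum w = (\<Sum>i<m. \<Sum>j\<in>{..<n} - {i, Suc i}. ?r i j)"
      by (simp add: rem_sum_def sum.Sigma rem_term_def case_prod_beta')
    have "(\<Sum>j<n. ?r i j) = (\<Sum>j\<in>{..<n} - {i, Suc i}. ?r i j)
         + (\<Sum>j\<in>{i, Suc i}. ?r i j)" if "i < m" for i
      using that by (intro sum.subset_diff) (auto simp: m)
    then have "(\<Sum>i<m. \<Sum>j<n. ?r i j) = (\<Sum>i<m. (\<Sum>j\<in>{..<n} - {i, Suc i}. ?r i j)
         + (?r i i + ?r i (Suc i)))"
      by (intro sum.cong) auto
    then show ?thesis unfolding R E_def by (simp only: sum.distrib)
  qed
  have E: "\<bar>E\<bar> \<le> 4 * m"
  proof -
    have "\<bar>E\<bar> \<le> (\<Sum>i<m. 4)"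
      unfolding E_def
    proof (rule order_trans[OF sum_abs sum_mono])
      fix i assume "i \<in> {..<m}"
      then have "\<bar>?r i i\<bar> \<le> 2" "\<bar>?r i (Suc i)\<bar> \<le> 2"
        by (auto intro!: between_rem_bound u simp: m)
      then show "\<bar>?r i i + ?r i (Suc i)\<bar> \<le> 4" by linarith
    qed
    then show ?thesis by simp
  qed
  define H where "H = (\<Sum>j<n. hump (w j))"
  define A where "A = (\<Sum>i<m. \<bar>w i - w (Suc i)\<bar>)"
  have "(\<Sum>i<m. hump (w i)) = H - hump (w m)" by (simp add: H_def m)
  moreover have "(\<Sum>i<m. hump (w (Suc i))) = H - hump (w 0)"
    unfolding H_def m(1) by (subst sum.lessThan_Suc_shift) simp
  ultimately have K: "kern_sum w = A + 2 * H - hump (w m) - hump (w 0) - 2 / 3 * m"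
    unfolding kern_sum_def kern_def A_def n1 sum.distrib sum_subtractf by simp
  have "rank_variation w = (\<Sum>i<m. \<Sum>j<n. between (w i) (w (Suc i)) (w j))"
    unfolding rank_variation_def n1 by (simp add: rank_diff)
  also have "\<dots> = (\<Sum>i<m. \<Sum>j<n. \<bar>w i - w (Suc i)\<bar> + 2 * hump (w j) - 1 / 3 + ?r i j)"
    by (simp add: between_rem_def)
  also have "\<dots> = n * A + m * (2 * H) - m * n / 3 + (rem_sum w + E)"
    unfolding split[symmetric]
    by (simp add: sum.distrib sum_subtractf A_def H_def sum_distrib_left)
  finally have T: "rank_variation w = n * A + m * (2 * H) - m * n / 3 + (rem_sum w + E)" .
  have rm: "real n = real m + 1" by (simp add: m)
  have eq: "rank_variation w - (n * kern_sum w + n * (real n - 1) / 3 + rem_sum w)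
     = - 2 * H + n * (hump (w m) + hump (w 0)) + E"
    unfolding T K by (simp add: rm algebra_simps)
  have hb: "0 \<le> hump (w j) \<and> hump (w j) \<le> 1 / 4" if "j < n" for j
    using u[OF that] by (intro hump_bounds) auto
  have "0 \<le> H" "H \<le> n * (1 / 4)"
    unfolding H_def using hb sum_bounded_above[of "{..<n}" "\<lambda>j. hump (w j)" "1 / 4"] by (auto intro!: sum_nonneg)
  moreover have "0 \<le> n * (hump (w m) + hump (w 0))" "n * (hump (w m) + hump (w 0)) \<le> n * (1 / 2)"
    using hb[of m] hb[of 0] m by (auto intro!: mult_left_mono mult_nonneg_nonneg)
  moreover have "real m \<le> real n" by (simp add: rm)
  ultimately show ?thesis unfolding eq using E by (simp add: abs_le_iff)
qed

text \<open>The 43 is 1 + 6 + 36: from the centring n (n - 1) / (\<open>n\<^sup>2\<close> - 1) = 1 -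
  1 / (n + 1), from replacing n / (\<open>n\<^sup>2\<close> - 1) by 1 / n in front of
  \<open>kern_sum\<close>, and from the error 6 n of the decomposition.\<close>

lemma rank_stat_approx:
  assumes n: "2 \<le> n" and w: "w \<in> space unif_sample"
  shows "\<bar>sqrt n * rank_stat w + 3 * kern_sum w / sqrt n\<bar> \<le> 43 / sqrt n + 6 * \<bar>rem_sum w\<bar> / (n * sqrt n)"
proof -
  define T where "T = rank_variation w"
  define m where "m = (real n)\<^sup>2 - 1"
  define q where "q = sqrt n"
  define E where "E = T - (n * kern_sum w + n * (real n - 1) / 3 + rem_sum w)"
  have E: "\<bar>E\<bar> \<le> 6 * n" using rank_sum_decomp[OF n w] by (simp add: E_def T_def)
  have n2: "2 \<le> real n" using n by simp
  have q: "0 < q" "q * q = n" using n by (auto simp: q_def)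
  have "2 * 2 \<le> real n * real n" using n2 by (intro mult_mono) auto
  then have m: "(real n)\<^sup>2 / 2 \<le> m" "0 < m" by (auto simp: m_def power2_eq_square)
  have ks: "\<bar>kern_sum w\<bar> \<le> n"
  proof -
    have "\<bar>kern_sum w\<bar> \<le> (\<Sum>i<n - 1. 1)" unfolding kern_sum_def
      using space_unif_sample[OF w] by (intro order_trans[OF sum_abs sum_mono] kern_bounds) auto
    also have "\<dots> \<le> n" by simp
    finally show ?thesis by simp
  qed
  have mf: "m = (real n - 1) * (real n + 1)" by (simp add: m_def power2_eq_square algebra_simps)
  have "3 * T = 3 * n * kern_sum w + n * (real n - 1) + 3 * (rem_sum w + E)"
    by (simp add: E_def field_simps)
  then have rs: "rank_stat w = 1 - (3 * n * kern_sum w / m + n * (real n - 1) / m + 3 * (rem_sum w + E) / m)"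
    unfolding rank_stat_def T_def[symmetric] m_def[symmetric] by (simp only: add_divide_distrib)
  have nm: "n * (real n - 1) / m = 1 - 1 / (real n + 1)"
  proof -
    have "n * (real n - 1) / m = n * (real n - 1) / ((real n + 1) * (real n - 1))" unfolding mf by (simp only: mult.commute)
    also have "\<dots> = n / (real n + 1)" using n2 by (intro mult_divide_mult_cancel_right) auto
    finally show ?thesis using n2 by (simp add: field_simps)
  qed
  have ksm: "q * (3 * n * kern_sum w / m) - 3 * kern_sum w / q = 3 * kern_sum w / (q * m)"
  proof -
    have "q * (3 * n * kern_sum w / m) - 3 * kern_sum w / q = 3 * kern_sum w * (q * q * n - m) / (q * m)"
      using q m by (simp add: field_simps)
    also have "q * q * n - m = 1" by (simp add: q m_def power2_eq_square)
    finally show ?thesis by simp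
  qed
  have "q * rank_stat w = q / (real n + 1) - q * (3 * n * kern_sum w / m) - q * (3 * (rem_sum w + E) / m)"
    unfolding rs nm by (simp add: right_diff_distrib distrib_left)
  moreover have "q * (3 * (rem_sum w + E) / m) = 3 * q * (rem_sum w + E) / m" by simp
  ultimately have eq: "q * rank_stat w + 3 * kern_sum w / q = q / (real n + 1) - 3 * kern_sum w / (q * m) - 3 * q * (rem_sum w + E) / m"
    using ksm by linarith
  have minv: "1 / m \<le> 2 / (real n)\<^sup>2"
    using m n2 by (simp add: field_simps)
  have b1: "\<bar>q / (real n + 1)\<bar> \<le> 1 / q"
    using q n2 by (simp add: field_simps)
  have b2: "\<bar>3 * kern_sum w / (q * m)\<bar> \<le> 6 / q"
  proof -
    have "\<bar>3 * kern_sum w / (q * m)\<bar> = 3 / q * (\<bar>kern_sum w\<bar> * (1 / m))" using q m by (simp add: abs_mult)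
    also have "\<dots> \<le> 3 / q * (n * (2 / (real n)\<^sup>2))"
      using q m ks minv by (intro mult_left_mono mult_mono) auto
    also have "\<dots> \<le> 6 / q" using n2 q by (simp add: field_simps power2_eq_square)
    finally show ?thesis .
  qed
  have b3: "\<bar>3 * q * (rem_sum w + E) / m\<bar> \<le> 36 / q + 6 * \<bar>rem_sum w\<bar> / (n * q)"
  proof -
    have "\<bar>3 * q * (rem_sum w + E) / m\<bar> = 3 * q * (\<bar>rem_sum w + E\<bar> * (1 / m))" using q m by (simp add: abs_mult)
    also have "\<dots> \<le> 3 * q * ((\<bar>rem_sum w\<bar> + 6 * n) * (2 / (real n)\<^sup>2))"
      using q m E minv by (intro mult_left_mono mult_mono) auto
    also have "\<dots> = 36 / q + 6 * \<bar>rem_sum w\<bar> / (n * q)"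
      using q(1) by (simp add: q(2)[symmetric] field_simps power2_eq_square)
    finally show ?thesis .
  qed
  have split43: "43 / q = 1 / q + 6 / q + 36 / q" by (simp flip: add_divide_distrib)
  have abs3: "\<bar>x - y - z\<bar> \<le> a + b + c" if "\<bar>x\<bar> \<le> a" "\<bar>y\<bar> \<le> b" "\<bar>z\<bar> \<le> c" for x y z a b c :: real
    using that by linarith
  show ?thesis
    unfolding q_def[symmetric] eq by (rule order_trans[OF abs3[OF b1 b2 b3]]) (simp only: split43 add.assoc order_refl)
qed

text \<open>133 = 43 + 6 * 15, the 15 being the first-moment constant of
  \<open>rem_sum\<close>.\<close>

lemma rank_stat_L1:
  assumes n: "2 \<le> n"
  shows "(\<integral>w. 43 / sqrt n + 6 * \<bar>rem_sum w\<bar> / (n * sqrt n) \<partial>unif_sample) \<le> 133 / sqrt n"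
    "integrable unif_sample (\<lambda>w. 43 / sqrt n + 6 * \<bar>rem_sum w\<bar> / (n * sqrt n))"
proof -
  have n0: "0 < n" using n by simp
  show "integrable unif_sample (\<lambda>w. 43 / sqrt n + 6 * \<bar>rem_sum w\<bar> / (n * sqrt n))" using rem_sum_abs[OF n0] by simp
  have "(\<integral>w. 43 / sqrt n + 6 * \<bar>rem_sum w\<bar> / (n * sqrt n) \<partial>unif_sample) = 43 / sqrt n + 6 * (\<integral>w. \<bar>rem_sum w\<bar> \<partial>unif_sample) / (n * sqrt n)"
    using rem_sum_abs[OF n0] by (simp add: U.prob_space)
  also have "\<dots> \<le> 43 / sqrt n + 6 * (15 * real n) / (n * sqrt n)"
    using rem_sum_abs[OF n0] by (intro add_mono divide_right_mono mult_left_mono) auto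
  also have "\<dots> = 133 / sqrt n" using n0 by (simp add: field_simps)
  finally show "(\<integral>w. 43 / sqrt n + 6 * \<bar>rem_sum w\<bar> / (n * sqrt n) \<partial>unif_sample) \<le> 133 / sqrt n" .
qed

end

section \<open>Chatterjee's coefficient as a rank statistic\<close>

lemma insort_key_map: "insort_key f (g x) (map g ys) = map g (insort_key (\<lambda>i. f (g i)) x ys)"
  by (induction ys) auto

lemma sort_key_map: "sort_key f (map g xs) = map g (sort_key (\<lambda>i. f (g i)) xs)"
  by (induction xs) (simp_all add: insort_key_map)

lemma insort_key_cong:
  "f x = g x \<Longrightarrow> (\<And>i. i \<in> set ys \<Longrightarrow> f i = g i) \<Longrightarrow> insort_key f x ys = insort_key g x ys"
  by (induction ys) auto

lemma sort_key_cong: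
  "(\<And>i. i \<in> set xs \<Longrightarrow> f i = g i) \<Longrightarrow> sort_key f xs = sort_key g xs"
proof (induction xs)
  case (Cons x xs)
  have "sort_key f xs = sort_key g xs" by (rule Cons.IH) (simp add: Cons.prems)
  moreover have "insort_key f x (sort_key g xs) = insort_key g x (sort_key g xs)"
    by (rule insort_key_cong) (simp_all add: Cons.prems)
  ultimately show ?case by simp
qed simp

text \<open>The sorting permutation of \<open>x\<close>. Insertion by \<open>sort_key\<close> is
  stable, so ties are broken by index as in \<open>chatterjee\<close>, and the permutation exists
  for every \<open>x\<close>, with or without ties.\<close>

definition order_idx :: "nat \<Rightarrow> (nat \<Rightarrow> real) \<Rightarrow> nat \<Rightarrow> nat" where
  "order_idx n x i = sort_key x [0..<n] ! i"

lemma order_idx_bij: "bij_betw (order_idx n x) {..<n} {..<n}"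
proof -
  have "bij_betw ((!) (sort_key x [0..<n])) {..<length (sort_key x [0..<n])} (set (sort_key x [0..<n]))"
    by (intro bij_betw_nth) auto
  then show ?thesis by (simp add: order_idx_def[abs_def] atLeast0LessThan)
qed

lemma order_idx_less: "i < n \<Longrightarrow> order_idx n x i < n"
  using order_idx_bij[of n x] by (auto simp: bij_betw_def)

text \<open>Separates the two roles of the data: the first coordinates enter only through the
  permutation, the second only through their ranks, and a rank count is unchanged when the sample is
  reindexed by a bijection.\<close>

lemma chatterjee_rank_stat:
  "chatterjee n w = rank_stat n (\<lambda>i. snd (w (order_idx n (\<lambda>i. fst (w i)) i)))"
proof -
  let ?\<pi> = "order_idx n (\<lambda>i. fst (w i))"
  have zs: "sort_key fst (map w [0..<n]) ! i = w (?\<pi> i)" if "i < n" for i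
    using that by (simp add: sort_key_map order_idx_def)
  have card: "card {j. j < n \<and> snd (w j) \<le> a} = card {j. j < n \<and> snd (w (?\<pi> j)) \<le> a}" for a
  proof -
    have "bij_betw ?\<pi> {j. j < n \<and> snd (w (?\<pi> j)) \<le> a} {j. j < n \<and> snd (w j) \<le> a}"
    proof (rule bij_betw_subset[OF order_idx_bij])
      show "?\<pi> ` {j. j < n \<and> snd (w (?\<pi> j)) \<le> a} = {j. j < n \<and> snd (w j) \<le> a}"
      proof (intro equalityI subsetI)
        fix k assume k: "k \<in> {j. j < n \<and> snd (w j) \<le> a}"
        then have "k \<in> ?\<pi> ` {..<n}" using order_idx_bij[of n "\<lambda>i. fst (w i)"] by (simp add: bij_betw_def)
        then obtain j where "j < n" "k = ?\<pi> j" by blast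
        then show "k \<in> ?\<pi> ` {j. j < n \<and> snd (w (?\<pi> j)) \<le> a}" using k by blast
      qed (auto simp: order_idx_less)
    qed auto
    from bij_betw_same_card[OF this] show ?thesis by (rule sym)
  qed
  have R: "rank n (\<lambda>i. snd (w (?\<pi> i))) i = card {j. j < n \<and> snd (w j) \<le> snd (sort_key fst (map w [0..<n]) ! i)}" if "i < n" for i
    unfolding rank_def zs[OF that] by (rule card[symmetric])
  let ?r = "\<lambda>i. card {j. j < n \<and> snd (w j) \<le> snd (sort_key fst (map w [0..<n]) ! i)}"
  have "rank_variation n (\<lambda>i. snd (w (?\<pi> i))) = (\<Sum>i<n - 1. \<bar>real (?r (i + 1)) - real (?r i)\<bar>)"
    unfolding rank_variation_def by (intro sum.cong refl) (simp add: R)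
  then show ?thesis
    unfolding chatterjee_def rank_stat_def Let_def by (simp only:)
qed

lemma rank_stat_eqI:
  assumes "\<And>i. i < n \<Longrightarrow> rank n f i = rank n g i"
  shows "rank_stat n f = rank_stat n g"
proof -
  have "rank_variation n f = rank_variation n g"
    unfolding rank_variation_def by (intro sum.cong refl) (simp add: assms)
  then show ?thesis by (simp only: rank_stat_def)
qed

section \<open>Measurability\<close>

lemma insort_key_measurable:
  fixes f :: "'w \<Rightarrow> nat \<Rightarrow> real"
  assumes f: "\<And>i. (\<lambda>w. f w i) \<in> borel_measurable M"
  shows "(\<lambda>w. insort_key (f w) x ys) \<in> measurable M (count_space UNIV)"
proof (induction ys)
  case (Cons y ys)
  have "(\<lambda>w. y # insort_key (f w) x ys) \<in> measurable M (count_space UNIV)"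
    by (rule measurable_compose[OF Cons]) simp
  moreover have "{w \<in> space M. f w x \<le> f w y} \<in> sets M"
    by (intro borel_measurable_le f)
  ultimately show ?case by (simp add: measurable_If)
qed simp

text \<open>The sorted list of indices takes countably many values, so the discrete space of lists
  suffices and later compositions can be checked for each fixed list.\<close>

lemma sort_key_measurable:
  fixes f :: "'w \<Rightarrow> nat \<Rightarrow> real"
  assumes f: "\<And>i. (\<lambda>w. f w i) \<in> borel_measurable M"
  shows "(\<lambda>w. sort_key (f w) xs) \<in> measurable M (count_space UNIV)"
proof (induction xs)
  case (Cons x xs)
  have "(\<lambda>w. insort_key (f w) x (sort_key (f w) xs)) \<in> measurable M (count_space UNIV)"
    by (rule measurable_compose_countable[OF insort_key_measurable[OF f] Cons])
  then show ?case by simp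
qed simp

lemma rank_stat_measurable:
  assumes f: "\<And>i. (\<lambda>w. f w i) \<in> borel_measurable M"
  shows "(\<lambda>w. rank_stat n (f w)) \<in> borel_measurable M"
proof -
  have r: "(\<lambda>w. real (rank n (f w) i)) \<in> borel_measurable M" for i
  proof -
    have eq: "real (rank n (f w) i) = (\<Sum>j<n. if f w j \<le> f w i then 1 else 0)" for w
    proof -
      have "{..<n} \<inter> {j. f w j \<le> f w i} = {j. j < n \<and> f w j \<le> f w i}" by auto
      then show ?thesis by (simp add: rank_def sum.If_cases)
    qed
    show ?thesis unfolding eq
      by (intro borel_measurable_sum measurable_If borel_measurable_const borel_measurable_le f)
  qed
  show ?thesis unfolding rank_stat_def rank_variation_def
    by (intro borel_measurable_diff borel_measurable_divide borel_measurable_times borel_measurable_const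
      borel_measurable_sum borel_measurable_abs r)
qed

text \<open>Outside \<open>I\<close> a coordinate is constantly \<open>undefined\<close>, hence
  measurable too; this permits statements for all indices without a side condition.\<close>

lemma PiM_coord_total:
  assumes M: "(\<lambda>x. x) \<in> measurable M borel"
  shows "(\<lambda>w. w i) \<in> measurable (PiM I (\<lambda>_. M)) borel"
proof (cases "i \<in> I")
  case True
  show ?thesis
    by (rule measurable_compose[of "\<lambda>w. w i" _ M, OF measurable_component_singleton M]) (rule True)
next
  case False
  then have "w i = undefined" if "w \<in> space (PiM I (\<lambda>_. M))" for w
    using that PiE_arb[of w I _ i] by (simp add: space_PiM)
  then show ?thesis by (subst measurable_cong[where g="\<lambda>_. undefined"]) simp_all
qed

lemma chatterjee_measurable:
  assumes "sets M = sets (borel :: (real \<times> real) measure)"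
  shows "chatterjee n \<in> borel_measurable (PiM {..<n} (\<lambda>_. M))"
proof -
  note c = PiM_coord_total[OF measurable_ident_sets[OF assms]]
  have 1: "(\<lambda>w. fst (w i)) \<in> borel_measurable (PiM {..<n} (\<lambda>_. M))" for i
    by (rule measurable_compose[OF c]) (simp add: borel_prod[symmetric])
  have 2: "(\<lambda>w. snd (w i)) \<in> borel_measurable (PiM {..<n} (\<lambda>_. M))" for i
    by (rule measurable_compose[OF c]) (simp add: borel_prod[symmetric])
  have "(\<lambda>w. rank_stat n (\<lambda>i. snd (w (l ! i)))) \<in> borel_measurable (PiM {..<n} (\<lambda>_. M))" for l
    by (intro rank_stat_measurable 2)
  from measurable_compose_countable[OF this sort_key_measurable[where f="\<lambda>w i. fst (w i)" and xs="[0..<n]", OF 1]]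
  show ?thesis by (simp add: chatterjee_rank_stat[abs_def] order_idx_def)
qed

section \<open>The quantile transform\<close>

definition quantile :: "real measure \<Rightarrow> real \<Rightarrow> real" where
  "quantile \<nu> u = Inf {x. u \<le> cdf \<nu> x}"

context
  fixes \<nu> :: "real measure"
  assumes \<nu>: "real_distribution \<nu>" and atomless: "\<And>x. measure \<nu> {x} = 0"
begin

interpretation \<nu>: cdf_distribution \<nu> unfolding cdf_distribution_def by (rule \<nu>)

lemma quantile_galois: "0 < u \<Longrightarrow> u < 1 \<Longrightarrow> u \<le> cdf \<nu> x \<longleftrightarrow> quantile \<nu> u \<le> x"
  unfolding quantile_def by (rule \<nu>.pseudoinverse)

text \<open>Without atoms the distribution function is continuous, and to the left of the quantile
  it stays below \<open>u\<close>; so it cannot jump over \<open>u\<close>.\<close>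

lemma cdf_quantile: assumes u: "0 < u" "u < 1" shows "cdf \<nu> (quantile \<nu> u) = u"
proof (rule antisym)
  show "u \<le> cdf \<nu> (quantile \<nu> u)" using quantile_galois[OF u] by simp
  have "isCont (cdf \<nu>) (quantile \<nu> u)" using atomless by (simp add: \<nu>.isCont_cdf)
  then have "(cdf \<nu> \<longlongrightarrow> cdf \<nu> (quantile \<nu> u)) (at_left (quantile \<nu> u))"
    by (simp add: isCont_def filterlim_at_split)
  moreover have "\<forall>\<^sub>F x in at_left (quantile \<nu> u). cdf \<nu> x \<le> u"
  proof (rule eventually_at_leftI)
    fix x assume "x \<in> {quantile \<nu> u - 1<..<quantile \<nu> u}"
    then show "cdf \<nu> x \<le> u" using quantile_galois[OF u, of x] by auto
  qed simp
  ultimately show "cdf \<nu> (quantile \<nu> u) \<le> u" by (rule tendsto_upperbound) simp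
qed

text \<open>The quantile function is strictly increasing on (0, 1), so it preserves ranks at every
  sample point and not merely almost surely.\<close>

lemma quantile_le_iff:
  assumes "0 < u" "u < 1" "0 < v" "v < 1" shows "quantile \<nu> u \<le> quantile \<nu> v \<longleftrightarrow> u \<le> v"
  using quantile_galois[OF assms(1,2), of "quantile \<nu> v"] by (simp add: cdf_quantile assms)

lemma quantile_meas: "quantile \<nu> \<in> measurable unif borel"
  using \<nu>.measurable_CI by (simp add: quantile_def[abs_def] cong: measurable_cong_sets)

lemma distr_quantile: "distr unif borel (quantile \<nu>) = \<nu>"
  using \<nu>.distr_I_eq_M by (simp add: quantile_def[abs_def])

lemma chatterjee_quantile:
  assumes u: "\<And>i. i < n \<Longrightarrow> 0 < u i \<and> u i < 1"
  shows "chatterjee n (\<lambda>i\<in>{..<n}. (x i, quantile \<nu> (u i))) = rank_stat n (\<lambda>i. u (order_idx n x i))"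
proof -
  let ?w = "\<lambda>i\<in>{..<n}. (x i, quantile \<nu> (u i))"
  have s: "sort_key (\<lambda>i. fst (?w i)) [0..<n] = sort_key x [0..<n]"
    by (rule sort_key_cong) simp
  then have o: "order_idx n (\<lambda>i. fst (?w i)) = order_idx n x" by (simp add: order_idx_def[abs_def])
  have r: "rank n (\<lambda>i. snd (?w (order_idx n x i))) i = rank n (\<lambda>i. u (order_idx n x i)) i" if "i < n" for i
  proof -
    have "{j. j < n \<and> snd (?w (order_idx n x j)) \<le> snd (?w (order_idx n x i))} = {j. j < n \<and> u (order_idx n x j) \<le> u (order_idx n x i)}"
    proof (rule Collect_cong, rule conj_cong[OF refl])
      fix j assume "j < n"
      then show "(snd (?w (order_idx n x j)) \<le> snd (?w (order_idx n x i))) = (u (order_idx n x j) \<le> u (order_idx n x i))"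
        using that u[of "order_idx n x j"] u[of "order_idx n x i"] by (simp add: order_idx_less quantile_le_iff)
    qed
    then show ?thesis by (simp only: rank_def)
  qed
  then show ?thesis unfolding chatterjee_rank_stat o by (rule rank_stat_eqI)
qed

end

section \<open>The joint limit law\<close>

lemma rank_stat_cong:
  assumes "\<And>i. i < n \<Longrightarrow> f i = g i"
  shows "rank_stat n f = rank_stat n g"
proof -
  have r: "rank n f i = rank n g i" if "i < n" for i
  proof -
    have "{j. j < n \<and> f j \<le> f i} = {j. j < n \<and> g j \<le> g i}"
      by (rule Collect_cong, rule conj_cong[OF refl]) (simp add: assms that)
    then show ?thesis by (simp only: rank_def)
  qed
  then show ?thesis by (rule rank_stat_eqI)
qed

lemma norm_cis_diff: "norm (cis a - cis b) \<le> \<bar>a - b\<bar>"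
proof -
  have "cis a - cis b = cis b * (cis (a - b) - 1)" by (simp add: algebra_simps cis_mult)
  then show ?thesis using cis_bounds(1)[of "a - b"] by (simp add: norm_mult)
qed

text \<open>Replacing the statistic by - 3 \<open>kern_sum\<close> / sqrt n costs 133 |s| / sqrt n,
  as \<open>cis\<close> is 1-Lipschitz. The rest is \<open>walk_char\<close> at c = - 3 s / sqrt n,
  whence the coefficients 6, 36 and 27; \<open>small\<close> is its condition
  \<open>c\<^sup>2 \<le> 2\<close>.\<close>

lemma rank_stat_char_bound:
  fixes e :: "nat \<Rightarrow> real \<Rightarrow> complex" and s :: real
  assumes n: "2 \<le> n" and em: "\<And>j. j < n \<Longrightarrow> e j \<in> borel_measurable unif" and en: "\<And>j x. j < n \<Longrightarrow> norm (e j x) = 1"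
    and small: "9 * s\<^sup>2 \<le> 2 * n"
  defines "\<delta> j \<equiv> (\<integral>u. norm (e j u - 1) \<partial>unif)"
  shows "norm ((\<integral>w. (\<Prod>j<n. e j (w j)) * cis (s * (sqrt n * rank_stat n w)) \<partial>PiM {..<n} (\<lambda>_. unif))
      - (1 - 9 * s\<^sup>2 / n * kern.kvar / 2) ^ (n - 1) * (\<Prod>j<n. \<integral>u. e j u \<partial>unif))
    \<le> 133 * \<bar>s\<bar> / sqrt n + 6 * \<bar>s\<bar> / sqrt n * (\<Sum>j<n. (\<delta> j)\<^sup>2) + 36 * s\<^sup>2 / n * (\<Sum>j<n. \<delta> j) + 27 * \<bar>s\<bar> ^ 3 / sqrt n"
proof -
  interpret U: prob_space "PiM {..<n} (\<lambda>_. unif)" by (rule prob_space_PiM) (rule prob_space_unif)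
  let ?U = "PiM {..<n} (\<lambda>_. unif)"
  define c where "c = - 3 * s / sqrt n"
  have n0: "0 < n" "0 < sqrt n" using n by auto
  have c2: "c\<^sup>2 = 9 * s\<^sup>2 / n" using n0 by (simp add: c_def power_divide power_mult_distrib)
  have cabs: "\<bar>c\<bar> = 3 * \<bar>s\<bar> / sqrt n" using n0 by (simp add: c_def abs_mult)
  have c2le: "c\<^sup>2 \<le> 2" unfolding c2 using small n0 by (simp add: divide_le_eq)
  define W where "W = kern.walk e c n"
  define H where "H w = (\<Prod>j<n. e j (w j)) * cis (s * (sqrt n * rank_stat n w))" for w
  have em': "(\<lambda>w. e j (w j)) \<in> borel_measurable ?U" if "j < n" for j
    using that by (intro measurable_compose[of "\<lambda>w. w j" ?U unif, OF measurable_component_singleton em]) auto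
  have Wm: "W \<in> borel_measurable ?U" unfolding W_def by (rule kern.walk_meas[where n=n]) (auto intro: em en)
  have Wi: "integrable ?U W" unfolding W_def by (rule kern.walk_integrable[where n=n]) (auto intro: em en)
  have rm: "rank_stat n \<in> borel_measurable ?U"
    using rank_stat_measurable[of "\<lambda>w i. w i", OF PiM_coord_total[OF unif_id]] .
  have Hm: "H \<in> borel_measurable ?U"
    unfolding H_def[abs_def] cis_conv_exp
    by (intro borel_measurable_times borel_measurable_prod em' measurable_compose[OF rm]) (simp_all, measurable)
  have pn: "norm (\<Prod>j<n. e j (w j)) = 1" for w unfolding prod_norm[symmetric] by (simp add: en)
  have Hi: "integrable ?U H"
    by (intro U.integrable_const_bound[of _ 1] AE_I2 Hm) (simp add: H_def norm_mult pn)
  have "norm ((\<integral>w. H w \<partial>?U) - (\<integral>w. W w \<partial>?U)) = norm (\<integral>w. H w - W w \<partial>?U)"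
    using Hi Wi by simp
  also have "\<dots> \<le> (\<integral>w. \<bar>s\<bar> * (43 / sqrt n + 6 * \<bar>rem_sum n w\<bar> / (n * sqrt n)) \<partial>?U)"
  proof (rule order_trans[OF integral_norm_bound integral_mono])
    show "integrable ?U (\<lambda>w. norm (H w - W w))" using Hi Wi by (intro integrable_norm Bochner_Integration.integrable_diff)
    show "integrable ?U (\<lambda>w. \<bar>s\<bar> * (43 / sqrt n + 6 * \<bar>rem_sum n w\<bar> / (n * sqrt n)))"
      using rank_stat_L1(2)[OF n] by (rule integrable_mult_right)
    fix w assume w: "w \<in> space ?U"
    have "W w = (\<Prod>j<n. e j (w j)) * cis (c * kern_sum n w)"
      unfolding W_def kern_sum_def by (rule kern.walk_def[where n=n]) (auto intro: em en)
    then have "norm (H w - W w) = norm (cis (s * (sqrt n * rank_stat n w)) - cis (c * kern_sum n w))"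
      by (simp add: H_def norm_mult pn flip: right_diff_distrib)
    also have "\<dots> \<le> \<bar>s * (sqrt n * rank_stat n w) - c * kern_sum n w\<bar>" by (rule norm_cis_diff)
    also have "s * (sqrt n * rank_stat n w) - c * kern_sum n w = s * (sqrt n * rank_stat n w + 3 * kern_sum n w / sqrt n)"
      by (simp add: c_def algebra_simps)
    also have "\<bar>\<dots>\<bar> \<le> \<bar>s\<bar> * (43 / sqrt n + 6 * \<bar>rem_sum n w\<bar> / (n * sqrt n))"
      unfolding abs_mult using rank_stat_approx[OF n w] by (intro mult_left_mono) auto
    finally show "norm (H w - W w) \<le> \<bar>s\<bar> * (43 / sqrt n + 6 * \<bar>rem_sum n w\<bar> / (n * sqrt n))" .
  qed
  also have "\<dots> = \<bar>s\<bar> * (\<integral>w. 43 / sqrt n + 6 * \<bar>rem_sum n w\<bar> / (n * sqrt n) \<partial>?U)" by (rule integral_mult_right_zero)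
  also have "\<dots> \<le> \<bar>s\<bar> * (133 / sqrt n)" by (intro mult_left_mono rank_stat_L1 n) simp
  finally have 1: "norm ((\<integral>w. H w \<partial>?U) - (\<integral>w. W w \<partial>?U)) \<le> 133 * \<bar>s\<bar> / sqrt n" by (simp add: mult.commute)
  have 2: "norm ((\<integral>w. W w \<partial>?U) - (1 - c\<^sup>2 * kern.kvar / 2) ^ (n - 1) * (\<Prod>j<n. \<integral>u. e j u \<partial>unif))
     \<le> 2 * \<bar>c\<bar> * (\<Sum>j<n. (\<delta> j)\<^sup>2) + 4 * c\<^sup>2 * (\<Sum>j<n. \<delta> j) + n * \<bar>c\<bar> ^ 3"
    unfolding W_def \<delta>_def by (rule kern.walk_char) (auto intro: em en c2le n0)
  have e1: "n * \<bar>c\<bar> ^ 3 = 27 * \<bar>s\<bar> ^ 3 / sqrt n"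
  proof -
    have "sqrt n ^ 3 = n * sqrt n" by (simp add: power3_eq_cube)
    then have "(3 * \<bar>s\<bar> / sqrt n) ^ 3 = (3 * \<bar>s\<bar>) ^ 3 / (n * sqrt n)" by (simp only: power_divide)
    then have "n * \<bar>c\<bar> ^ 3 = n * ((3 * \<bar>s\<bar>) ^ 3 / (n * sqrt n))" by (simp only: cabs)
    also have "\<dots> = 27 * \<bar>s\<bar> ^ 3 / sqrt n" using n0 by (simp add: power_mult_distrib)
    finally show ?thesis .
  qed
  have "norm ((\<integral>w. H w \<partial>?U) - (1 - c\<^sup>2 * kern.kvar / 2) ^ (n - 1) * (\<Prod>j<n. \<integral>u. e j u \<partial>unif))
    \<le> norm ((\<integral>w. H w \<partial>?U) - (\<integral>w. W w \<partial>?U)) + norm ((\<integral>w. W w \<partial>?U) - (1 - c\<^sup>2 * kern.kvar / 2) ^ (n - 1) * (\<Prod>j<n. \<integral>u. e j u \<partial>unif))"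
    by (rule order_trans[OF _ norm_triangle_ineq]) simp
  also have "\<dots> \<le> 133 * \<bar>s\<bar> / sqrt n + (2 * \<bar>c\<bar> * (\<Sum>j<n. (\<delta> j)\<^sup>2) + 4 * c\<^sup>2 * (\<Sum>j<n. \<delta> j) + n * \<bar>c\<bar> ^ 3)"
    by (rule add_mono[OF 1 2])
  also have "\<dots> = 133 * \<bar>s\<bar> / sqrt n + 6 * \<bar>s\<bar> / sqrt n * (\<Sum>j<n. (\<delta> j)\<^sup>2) + 36 * s\<^sup>2 / n * (\<Sum>j<n. \<delta> j) + 27 * \<bar>s\<bar> ^ 3 / sqrt n"
    unfolding e1 unfolding c2 cabs by simp
  finally show ?thesis unfolding H_def c2 by simp
qed

lemma integral_PiM_permute:
  fixes F :: "(nat \<Rightarrow> 'a) \<Rightarrow> complex"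
  assumes N: "prob_space N" and \<pi>: "bij_betw \<pi> {..<n} {..<n}" and F: "F \<in> borel_measurable (PiM {..<n} (\<lambda>_. N))"
  shows "(\<integral>\<omega>. F (\<lambda>i\<in>{..<n}. \<omega> (\<pi> i)) \<partial>PiM {..<n} (\<lambda>_. N)) = (\<integral>\<omega>. F \<omega> \<partial>PiM {..<n} (\<lambda>_. N))"
proof -
  have m: "(\<lambda>\<omega>. \<lambda>i\<in>{..<n}. \<omega> (\<pi> i)) \<in> measurable (PiM {..<n} (\<lambda>_. N)) (PiM {..<n} (\<lambda>_. N))"
    using \<pi> by (intro measurable_restrict measurable_component_singleton) (auto simp: bij_betw_def)
  have "distr (PiM {..<n} (\<lambda>_. N)) (PiM {..<n} (\<lambda>_. N)) (\<lambda>\<omega>. \<lambda>i\<in>{..<n}. \<omega> (\<pi> i)) = PiM {..<n} (\<lambda>_. N)"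
    using \<pi> by (intro distr_PiM_reindex N) (auto simp: bij_betw_def)
  then show ?thesis using integral_distr[OF m F] by simp
qed

text \<open>The factor that an observation with first coordinate \<open>x\<close> and uniform
  variable \<open>u\<close> contributes to the characteristic function of the score sum. Its mean
  distance from 1, \<open>dscore\<close>, is the \<delta> of the preceding bounds.\<close>

definition escore :: "real measure \<Rightarrow> (real \<times> real \<Rightarrow> real) \<Rightarrow> real \<Rightarrow> nat \<Rightarrow> real \<Rightarrow> real \<Rightarrow> complex" where
  "escore \<nu> sc t n x u = iexp (t * sc (x, quantile \<nu> u) / sqrt n)"

definition dscore :: "real measure \<Rightarrow> (real \<times> real \<Rightarrow> real) \<Rightarrow> real \<Rightarrow> nat \<Rightarrow> real \<Rightarrow> real" where
  "dscore \<nu> sc t n x = (\<integral>u. norm (escore \<nu> sc t n x u - 1) \<partial>unif)"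

lemma escore_norm: "norm (escore \<nu> sc t n x u) = 1"
  by (simp add: escore_def)

context
  fixes \<nu> :: "real measure" and sc :: "real \<times> real \<Rightarrow> real"
  assumes \<nu>: "real_distribution \<nu>" and atomless: "\<And>x. measure \<nu> {x} = 0"
    and scm: "sc \<in> borel_measurable borel"
begin

lemma escore_meas2: "(\<lambda>(x, u). escore \<nu> sc t n x u) \<in> borel_measurable (borel \<Otimes>\<^sub>M unif)"
proof -
  have "(\<lambda>p. (fst p, quantile \<nu> (snd p))) \<in> measurable (borel \<Otimes>\<^sub>M unif) (borel \<Otimes>\<^sub>M borel)"
    by (intro measurable_Pair measurable_fst measurable_compose[OF measurable_snd quantile_meas[OF \<nu> atomless]])
  then have "(\<lambda>p. sc (fst p, quantile \<nu> (snd p))) \<in> borel_measurable (borel \<Otimes>\<^sub>M unif)"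
    by (rule measurable_compose) (simp add: borel_prod scm)
  then show ?thesis unfolding escore_def case_prod_beta' by measurable
qed

lemma escore_meas: "escore \<nu> sc t n x \<in> borel_measurable unif"
  using measurable_compose[OF measurable_Pair1'[of x borel unif] escore_meas2[of t n]] by simp

text \<open>For fixed \<open>x\<close> the sorting permutation is fixed as well. It is moved from
  the statistic onto the factors \<open>e j\<close>, and the i.i.d. uniform sample is invariant
  under it. Limit and error are symmetric in the factors, so the permutation disappears from the
  conclusion.\<close>

lemma chatterjee_char_bound:
  fixes x :: "nat \<Rightarrow> real"
  assumes n: "2 \<le> n" and small: "9 * s\<^sup>2 \<le> 2 * n"
  defines "\<zeta> \<equiv> \<lambda>u. \<lambda>i\<in>{..<n}. (x i, quantile \<nu> (u i))"
  shows "norm ((\<integral>u. iexp (s * (sqrt n * chatterjee n (\<zeta> u)) + t * ((1 / sqrt n) * (\<Sum>i<n. sc (\<zeta> u i)))) \<partial>PiM {..<n} (\<lambda>_. unif))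
      - (1 - 9 * s\<^sup>2 / n * kern.kvar / 2) ^ (n - 1) * (\<Prod>j<n. \<integral>u. escore \<nu> sc t n (x j) u \<partial>unif))
    \<le> 133 * \<bar>s\<bar> / sqrt n + 6 * \<bar>s\<bar> / sqrt n * (\<Sum>j<n. (dscore \<nu> sc t n (x j))\<^sup>2) + 36 * s\<^sup>2 / n * (\<Sum>j<n. dscore \<nu> sc t n (x j)) + 27 * \<bar>s\<bar> ^ 3 / sqrt n"
proof -
  let ?U = "PiM {..<n} (\<lambda>_. unif)"
  let ?\<pi> = "order_idx n x"
  note \<pi> = order_idx_bij[of n x]
  define e where "e j = escore \<nu> sc t n (x (?\<pi> j))" for j
  define H where "H w = (\<Prod>j<n. e j (w j)) * cis (s * (sqrt n * rank_stat n w))" for w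
  have em: "e j \<in> borel_measurable unif" for j unfolding e_def by (rule escore_meas)
  have en: "norm (e j w) = 1" for j w unfolding e_def by (rule escore_norm)
  have rm: "rank_stat n \<in> borel_measurable ?U"
    using rank_stat_measurable[of "\<lambda>w i. w i", OF PiM_coord_total[OF unif_id]] .
  have Hm: "H \<in> borel_measurable ?U"
    unfolding H_def[abs_def] cis_conv_exp
    by (intro borel_measurable_times borel_measurable_prod measurable_compose[of "\<lambda>w. w j" ?U unif for j, OF measurable_component_singleton em] measurable_compose[OF rm])
      (simp_all, measurable)
  have "(\<integral>u. iexp (s * (sqrt n * chatterjee n (\<zeta> u)) + t * ((1 / sqrt n) * (\<Sum>i<n. sc (\<zeta> u i)))) \<partial>?U)
     = (\<integral>u. H (\<lambda>i\<in>{..<n}. u (?\<pi> i)) \<partial>?U)"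
  proof (rule Bochner_Integration.integral_cong[OF refl])
    fix u assume u: "u \<in> space ?U"
    have rs: "chatterjee n (\<zeta> u) = rank_stat n (\<lambda>i\<in>{..<n}. u (?\<pi> i))"
      unfolding \<zeta>_def using space_unif_sample[OF u] chatterjee_quantile[OF \<nu> atomless, of n u x]
      by (simp add: rank_stat_cong[of n "\<lambda>i\<in>{..<n}. u (?\<pi> i)" "\<lambda>i. u (?\<pi> i)"])
    have "(\<Sum>i<n. sc (\<zeta> u i)) = (\<Sum>i<n. sc (x (?\<pi> i), quantile \<nu> (u (?\<pi> i))))"
      using sum.reindex_bij_betw[OF \<pi>, of "\<lambda>i. sc (x i, quantile \<nu> (u i))"] by (simp add: \<zeta>_def)
    then have "iexp (t * ((1 / sqrt n) * (\<Sum>i<n. sc (\<zeta> u i)))) = (\<Prod>j<n. e j (u (?\<pi> j)))"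
      by (simp add: e_def escore_def exp_sum sum_distrib_left sum_divide_distrib)
    moreover have "iexp (s * (sqrt n * chatterjee n (\<zeta> u)) + t * ((1 / sqrt n) * (\<Sum>i<n. sc (\<zeta> u i))))
      = iexp (t * ((1 / sqrt n) * (\<Sum>i<n. sc (\<zeta> u i)))) * cis (s * (sqrt n * chatterjee n (\<zeta> u)))"
      unfolding cis_conv_exp exp_add[symmetric] by (simp add: algebra_simps)
    ultimately show "iexp (s * (sqrt n * chatterjee n (\<zeta> u)) + t * ((1 / sqrt n) * (\<Sum>i<n. sc (\<zeta> u i)))) = H (\<lambda>i\<in>{..<n}. u (?\<pi> i))"
      by (simp add: H_def rs)
  qed
  also have "\<dots> = (\<integral>w. H w \<partial>?U)" by (rule integral_PiM_permute[OF prob_space_unif \<pi> Hm])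
  finally have I: "(\<integral>u. iexp (s * (sqrt n * chatterjee n (\<zeta> u)) + t * ((1 / sqrt n) * (\<Sum>i<n. sc (\<zeta> u i)))) \<partial>?U) = (\<integral>w. H w \<partial>?U)" .
  have P: "(\<Prod>j<n. \<integral>u. escore \<nu> sc t n (x j) u \<partial>unif) = (\<Prod>j<n. \<integral>u. e j u \<partial>unif)"
    unfolding e_def by (rule prod.reindex_bij_betw[OF \<pi>, symmetric])
  have S: "(\<Sum>j<n. (dscore \<nu> sc t n (x j))\<^sup>2) = (\<Sum>j<n. (\<integral>u. norm (e j u - 1) \<partial>unif)\<^sup>2)"
    unfolding e_def dscore_def by (rule sum.reindex_bij_betw[OF \<pi>, symmetric])
  have S': "(\<Sum>j<n. dscore \<nu> sc t n (x j)) = (\<Sum>j<n. \<integral>u. norm (e j u - 1) \<partial>unif)"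
    unfolding e_def dscore_def by (rule sum.reindex_bij_betw[OF \<pi>, symmetric])
  show ?thesis
    unfolding I P S S' H_def by (rule rank_stat_char_bound[OF n em en]) (use small in simp)
qed

end

lemma (in prob_space) integral_square_le:
  fixes f :: "'a \<Rightarrow> real"
  assumes "integrable M f" "integrable M (\<lambda>x. (f x)\<^sup>2)"
  shows "(\<integral>x. f x \<partial>M)\<^sup>2 \<le> (\<integral>x. (f x)\<^sup>2 \<partial>M)"
  using variance_positive[of f] variance_eq[OF assms] by simp

section \<open>Averaging over the X-sample\<close>

locale independence_family = qmd_family h for h :: "real \<Rightarrow> real \<times> real \<Rightarrow> real" +
  fixes f0 g0 :: "real \<Rightarrow> real"
  assumes f0: "prob_density f0" and g0: "prob_density g0"
    and h0: "\<And>x y. h 0 (x, y) = f0 x * g0 y"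
begin

abbreviation \<mu> :: "real measure" where "\<mu> \<equiv> density lborel (\<lambda>x. ennreal (f0 x))"
abbreviation \<nu> :: "real measure" where "\<nu> \<equiv> density lborel (\<lambda>y. ennreal (g0 y))"

lemma norm_diff_one_meas:
  fixes f :: "'a \<Rightarrow> complex"
  assumes [measurable]: "f \<in> borel_measurable M"
  shows "(\<lambda>x. norm (f x - 1)) \<in> borel_measurable M"
  by measurable

lemma \<mu>: "prob_space \<mu>" by (rule prob_space_density[OF f0])

lemma \<nu>: "real_distribution \<nu>"
proof -
  interpret prob_space \<nu> by (rule prob_space_density[OF g0])
  show ?thesis by standard auto
qed

lemma atomless: "measure \<nu> {x} = 0"
proof -
  have "emeasure \<nu> {x} = (\<integral>\<^sup>+y. ennreal (g0 y) * indicator {x} y \<partial>lborel)"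
    using g0 by (intro emeasure_density) (auto simp: prob_density_def)
  also have "\<dots> = 0"
    using AE_lborel_singleton[of x] by (subst nn_integral_0_iff_AE)
      (use g0 in \<open>auto simp: prob_density_def indicator_def elim: eventually_mono\<close>)
  finally show ?thesis by (simp add: measure_def)
qed

lemma pair_law_eq: "pair_law h 0 = \<mu> \<Otimes>\<^sub>M \<nu>"
proof -
  have "\<mu> \<Otimes>\<^sub>M \<nu> = density (lborel \<Otimes>\<^sub>M lborel) (\<lambda>(x, y). ennreal (f0 x) * ennreal (g0 y))"
    using f0 g0 prob_space_imp_sigma_finite[OF prob_space_density[OF g0]]
    by (intro pair_measure_density) (auto simp: prob_density_def sigma_finite_lborel)
  also have "(\<lambda>(x, y). ennreal (f0 x) * ennreal (g0 y)) = (\<lambda>z. ennreal (h 0 z))"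
    using f0 by (auto simp: h0 prob_density_def ennreal_mult' fun_eq_iff)
  finally show ?thesis by (simp add: pair_law_def lborel_prod)
qed

abbreviation Q :: "real \<Rightarrow> real" where "Q \<equiv> quantile \<nu>"

lemma Q_meas: "Q \<in> measurable unif borel" by (rule quantile_meas[OF \<nu> atomless])

lemma distr_Q: "distr unif borel Q = \<nu>" by (rule distr_quantile[OF \<nu> atomless])

interpretation \<mu>: prob_space \<mu> by (rule \<mu>)
interpretation \<nu>: real_distribution \<nu> by (rule \<nu>)
interpretation pair: pair_prob_space \<mu> \<nu> ..
interpretation mixed: pair_prob_space \<mu> unif ..

lemma map_meas: "(\<lambda>p. (fst p, Q (snd p))) \<in> measurable (\<mu> \<Otimes>\<^sub>M unif) borel"
proof -
  have "(\<lambda>p. (fst p, Q (snd p))) \<in> measurable (\<mu> \<Otimes>\<^sub>M unif) (borel \<Otimes>\<^sub>M borel)"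
    by (intro measurable_Pair measurable_compose[OF measurable_snd Q_meas])
      (rule measurable_compose[OF measurable_fst], simp)
  then show ?thesis by (simp add: borel_prod)
qed

lemma pair_distr: "distr (\<mu> \<Otimes>\<^sub>M unif) borel (\<lambda>p. (fst p, Q (snd p))) = pair_law h 0"
proof -
  have "\<mu> \<Otimes>\<^sub>M \<nu> = distr \<mu> \<mu> (\<lambda>x. x) \<Otimes>\<^sub>M distr unif borel Q"
    by (simp add: distr_Q)
  also have "\<dots> = distr (\<mu> \<Otimes>\<^sub>M unif) (\<mu> \<Otimes>\<^sub>M borel) (\<lambda>(x, u). (x, Q u))"
    using \<nu>.sigma_finite_measure_axioms by (intro pair_measure_distr Q_meas) (auto simp: distr_Q)
  also have "\<dots> = distr (\<mu> \<Otimes>\<^sub>M unif) borel (\<lambda>p. (fst p, Q (snd p)))"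
    by (intro distr_cong) (auto simp: borel_prod[symmetric] cong: sets_pair_measure_cong)
  finally show ?thesis by (simp add: pair_law_eq)
qed

lemma pair_integral:
  fixes g :: "real \<times> real \<Rightarrow> 'b::{banach, second_countable_topology}"
  assumes gm: "g \<in> borel_measurable borel" and g: "integrable (pair_law h 0) g"
  shows "integrable \<mu> (\<lambda>x. \<integral>u. g (x, Q u) \<partial>unif)" "(\<integral>z. g z \<partial>pair_law h 0) = (\<integral>x. (\<integral>u. g (x, Q u) \<partial>unif) \<partial>\<mu>)"
proof -
  have i: "integrable (\<mu> \<Otimes>\<^sub>M unif) (\<lambda>p. g (fst p, Q (snd p)))"
    using g integrable_distr_eq[OF map_meas gm] by (simp add: pair_distr)
  then have i': "integrable (\<mu> \<Otimes>\<^sub>M unif) (\<lambda>(x, u). g (x, Q u))" by (simp add: case_prod_beta')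
  show "integrable \<mu> (\<lambda>x. \<integral>u. g (x, Q u) \<partial>unif)" using mixed.integrable_fst[OF i'] by simp
  have "(\<integral>z. g z \<partial>pair_law h 0) = (\<integral>p. g (fst p, Q (snd p)) \<partial>(\<mu> \<Otimes>\<^sub>M unif))"
    using integral_distr[OF map_meas gm] by (simp add: pair_distr)
  then show "(\<integral>z. g z \<partial>pair_law h 0) = (\<integral>x. (\<integral>u. g (x, Q u) \<partial>unif) \<partial>\<mu>)"
    using mixed.integral_fst[OF i'] by (simp add: case_prod_beta')
qed

lemma sets_pair_law: "sets (pair_law h 0) = sets borel" by (simp add: pair_law_def)

lemma prob_sample: "prob_space (sample_law h n 0)"
  unfolding sample_law_def by (rule prob_space_PiM) (rule prob_pair)

definition \<zeta> :: "nat \<Rightarrow> (nat \<Rightarrow> real) \<Rightarrow> (nat \<Rightarrow> real) \<Rightarrow> nat \<Rightarrow> real \<times> real" where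
  "\<zeta> n x u = (\<lambda>i\<in>{..<n}. (x i, Q (u i)))"

text \<open>The sample is realised by an X-sample and an independent uniform sample, so the inner
  integral is the conditional expectation given the X-values.\<close>

lemma sample_integral:
  fixes F :: "(nat \<Rightarrow> real \<times> real) \<Rightarrow> complex"
  assumes Fm: "F \<in> borel_measurable (sample_law h n 0)" and Fb: "\<And>w. norm (F w) \<le> 1"
  shows "integrable (PiM {..<n} (\<lambda>_. \<mu>)) (\<lambda>x. \<integral>u. F (\<zeta> n x u) \<partial>PiM {..<n} (\<lambda>_. unif))"
    "(\<integral>w. F w \<partial>sample_law h n 0) = (\<integral>x. (\<integral>u. F (\<zeta> n x u) \<partial>PiM {..<n} (\<lambda>_. unif)) \<partial>PiM {..<n} (\<lambda>_. \<mu>))"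
proof -
  let ?X = "PiM {..<n} (\<lambda>_. \<mu>)" and ?U = "PiM {..<n} (\<lambda>_. unif)" and ?T = "PiM {..<n} (\<lambda>_. \<mu> \<Otimes>\<^sub>M borel)"
  interpret X: prob_space ?X by (rule prob_space_PiM) (rule \<mu>)
  interpret U: prob_space ?U by (rule prob_space_PiM) (rule prob_space_unif)
  interpret XU: pair_prob_space ?X ?U ..
  have S: "sample_law h n 0 = distr (?X \<Otimes>\<^sub>M ?U) ?T (\<lambda>(x, u). \<zeta> n x u)"
    unfolding sample_law_def pair_law_eq \<zeta>_def
    by (subst distr_Q[symmetric], rule PiM_pair_distr) (auto intro: \<mu> prob_space_unif Q_meas)
  have m: "(\<lambda>(x, u). \<zeta> n x u) \<in> measurable (?X \<Otimes>\<^sub>M ?U) ?T"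
    unfolding \<zeta>_def case_prod_beta'
    by (intro measurable_restrict measurable_Pair measurable_compose[OF measurable_fst measurable_component_singleton]
      measurable_compose[OF _ Q_meas] measurable_compose[OF measurable_snd measurable_component_singleton])
  have FT: "F \<in> borel_measurable ?T" using Fm by (simp add: S)
  have i: "integrable (?X \<Otimes>\<^sub>M ?U) (\<lambda>(x, u). F (\<zeta> n x u))"
    using measurable_compose[OF m FT] Fb by (intro XU.integrable_const_bound[of _ 1]) (auto simp: case_prod_beta')
  show "integrable ?X (\<lambda>x. \<integral>u. F (\<zeta> n x u) \<partial>?U)" using XU.integrable_fst[OF i] by simp
  have "(\<integral>w. F w \<partial>sample_law h n 0) = (\<integral>p. F (case p of (x, u) \<Rightarrow> \<zeta> n x u) \<partial>(?X \<Otimes>\<^sub>M ?U))"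
    unfolding S by (rule integral_distr[OF m FT])
  then show "(\<integral>w. F w \<partial>sample_law h n 0) = (\<integral>x. (\<integral>u. F (\<zeta> n x u) \<partial>?U) \<partial>?X)"
    using XU.integral_fst[OF i] by (simp add: case_prod_beta')
qed

definition S :: "nat \<Rightarrow> (nat \<Rightarrow> real \<times> real) \<Rightarrow> real" where
  "S n w = (1 / sqrt n) * (\<Sum>i<n. score h (w i))"


lemma chat_meas: "chatterjee n \<in> borel_measurable (sample_law h n 0)"
  unfolding sample_law_def by (rule chatterjee_measurable) (rule sets_pair_law)

lemma S_meas: "S n \<in> borel_measurable (sample_law h n 0)"
proof -
  have "(\<lambda>w. score h (w i)) \<in> borel_measurable (PiM {..<n} (\<lambda>_. pair_law h 0))" for i
    by (rule measurable_compose[OF PiM_coord_total[OF measurable_ident_sets[OF sets_pair_law]] score_meas])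
  then show ?thesis unfolding S_def[abs_def] sample_law_def by (intro borel_measurable_times borel_measurable_sum borel_measurable_const)
qed

abbreviation E :: "real \<Rightarrow> nat \<Rightarrow> real \<Rightarrow> real \<Rightarrow> complex" where "E t n \<equiv> escore \<nu> (score h) t n"
abbreviation D :: "real \<Rightarrow> nat \<Rightarrow> real \<Rightarrow> real" where "D t n \<equiv> dscore \<nu> (score h) t n"

lemmas E_meas2 = escore_meas2[OF \<nu> atomless score_meas]
lemmas E_meas = escore_meas[OF \<nu> atomless score_meas]
lemmas E_norm = escore_norm[of \<nu> "score h"]
lemmas E_def = escore_def[of \<nu> "score h"]
lemmas D_def = dscore_def[of \<nu> "score h"]

lemma D_bounds: "0 \<le> D t n x" "D t n x \<le> 2"
proof -
  have b: "norm (E t n x u - 1) \<le> 2" for u using norm_triangle_ineq4[of "E t n x u" 1] by (simp add: E_norm)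
  show "0 \<le> D t n x" unfolding D_def by simp
  have "(\<lambda>u. norm (E t n x u - 1)) \<in> borel_measurable unif"
    by (intro norm_diff_one_meas E_meas)
  then show "D t n x \<le> 2" unfolding D_def using b
    by (intro unif.integral_le_const unif.integrable_const_bound[of _ 2] AE_I2) auto
qed

lemma D_meas: "D t n \<in> borel_measurable \<mu>"
proof -
  have "(\<lambda>(x, u). norm (E t n x u - 1)) \<in> borel_measurable (borel \<Otimes>\<^sub>M unif)"
    using E_meas2[of t n] unfolding case_prod_beta' by (intro norm_diff_one_meas)
  then have "D t n \<in> borel_measurable borel" unfolding D_def[abs_def] by (rule unif.borel_measurable_lebesgue_integral)
  then show ?thesis by simp
qed

lemma D_int: "integrable \<mu> (D t n)" "integrable \<mu> (\<lambda>x. (D t n x)\<^sup>2)"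
proof -
  show "integrable \<mu> (D t n)" using D_bounds by (intro \<mu>.integrable_const_bound[of _ 2] D_meas) auto
  have "(D t n x)\<^sup>2 \<le> 2\<^sup>2" for x using D_bounds[of t n x] by (intro power_mono) auto
  then show "integrable \<mu> (\<lambda>x. (D t n x)\<^sup>2)" by (intro \<mu>.integrable_const_bound[of _ 4] borel_measurable_power D_meas) auto
qed

lemma phi_int: "integrable \<mu> (\<lambda>x. \<integral>u. E t n x u \<partial>unif)"
    "(\<integral>x. (\<integral>u. E t n x u \<partial>unif) \<partial>\<mu>) = (\<integral>z. iexp (t * score h z / sqrt n) \<partial>pair_law h 0)"
proof -
  interpret P: prob_space "pair_law h 0" by (rule prob_pair)
  have m: "(\<lambda>z. iexp (t * score h z / sqrt n)) \<in> borel_measurable borel" using score_meas by measurable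
  have i: "integrable (pair_law h 0) (\<lambda>z. iexp (t * score h z / sqrt n))"
    using m by (intro P.integrable_const_bound[of _ 1]) (auto cong: measurable_cong_sets simp: sets_pair_law)
  show "integrable \<mu> (\<lambda>x. \<integral>u. E t n x u \<partial>unif)"
    "(\<integral>x. (\<integral>u. E t n x u \<partial>unif) \<partial>\<mu>) = (\<integral>z. iexp (t * score h z / sqrt n) \<partial>pair_law h 0)"
    using pair_integral[OF m i] unfolding E_def by auto
qed

abbreviation "A1 \<equiv> (\<integral>z. \<bar>score h z\<bar> \<partial>pair_law h 0)"
abbreviation "A2 \<equiv> fisher_information_0 h"

text \<open>Both bounds rest on |exp(i v) - 1| \<le> |v|; the second also uses Jensen, because
  \<open>D\<close> is already an average over \<open>u\<close>. Summed over n observations they are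
  of order sqrt n and 1, just what the coefficients in the error absorb.\<close>

lemma D_mean: assumes n: "0 < n"
  shows "(\<integral>x. D t n x \<partial>\<mu>) \<le> \<bar>t\<bar> * A1 / sqrt n" "(\<integral>x. (D t n x)\<^sup>2 \<partial>\<mu>) \<le> t\<^sup>2 * A2 / n"
proof -
  interpret P: prob_space "pair_law h 0" by (rule prob_pair)
  let ?g = "\<lambda>z. norm (iexp (t * score h z / sqrt n) - 1)"
  have m: "?g \<in> borel_measurable borel" using score_meas by measurable
  have m2: "(\<lambda>z. (?g z)\<^sup>2) \<in> borel_measurable borel" using m by measurable
  have mP: "f \<in> borel_measurable (pair_law h 0)" if "f \<in> borel_measurable borel" for f :: "real \<times> real \<Rightarrow> real"
    using that by (simp cong: measurable_cong_sets add: sets_pair_law)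
  have b2: "?g z \<le> 2" for z using norm_triangle_ineq4[of "iexp (t * score h z / sqrt n)" 1] by simp
  have b22: "(?g z)\<^sup>2 \<le> 4" for z using power_mono[OF b2[of z] norm_ge_zero, of 2] by simp
  have i: "integrable (pair_law h 0) ?g"
    using b2 by (intro P.integrable_const_bound[of _ 2] mP m AE_I2) simp
  have i2: "integrable (pair_law h 0) (\<lambda>z. (?g z)\<^sup>2)"
    using b22 by (intro P.integrable_const_bound[of _ 4] mP m2 AE_I2) simp
  have i1: "integrable (pair_law h 0) (score h)"
    by (rule P.square_integrable_imp_integrable[OF mP[OF score_meas] score_sq])
  have gb: "?g z \<le> \<bar>t\<bar> / sqrt n * \<bar>score h z\<bar>" for z
    using iexp_approx1[of "t * score h z / sqrt n" 0] n by (simp add: abs_mult)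
  have gb2: "(?g z)\<^sup>2 \<le> t\<^sup>2 / n * (score h z)\<^sup>2" for z
    using power_mono[OF gb[of z] norm_ge_zero, of 2] n by (simp add: power_mult_distrib power_divide)
  have "(\<integral>x. D t n x \<partial>\<mu>) = (\<integral>z. ?g z \<partial>pair_law h 0)"
    using pair_integral(2)[OF m i] unfolding D_def E_def by simp
  also have "\<dots> \<le> (\<integral>z. \<bar>t\<bar> / sqrt n * \<bar>score h z\<bar> \<partial>pair_law h 0)"
    using i i1 gb by (intro integral_mono) auto
  finally show "(\<integral>x. D t n x \<partial>\<mu>) \<le> \<bar>t\<bar> * A1 / sqrt n" by simp
  have "(\<integral>x. (D t n x)\<^sup>2 \<partial>\<mu>) \<le> (\<integral>x. (\<integral>u. (?g (x, Q u))\<^sup>2 \<partial>unif) \<partial>\<mu>)"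
  proof (rule integral_mono[OF D_int(2) pair_integral(1)[OF m2 i2]])
    fix x
    have mu: "(\<lambda>u. ?g (x, Q u)) \<in> borel_measurable unif"
      using E_meas[of t n x] unfolding E_def[abs_def] by (intro norm_diff_one_meas)
    show "(D t n x)\<^sup>2 \<le> (\<integral>u. (?g (x, Q u))\<^sup>2 \<partial>unif)"
      unfolding D_def E_def
    proof (rule unif.integral_square_le)
      show "integrable unif (\<lambda>u. ?g (x, Q u))" using b2 by (intro unif.integrable_const_bound[of _ 2] mu AE_I2) simp
      show "integrable unif (\<lambda>u. (?g (x, Q u))\<^sup>2)"
        using b22 by (intro unif.integrable_const_bound[of _ 4] borel_measurable_power mu AE_I2) simp
    qed
  qed
  also have "\<dots> = (\<integral>z. (?g z)\<^sup>2 \<partial>pair_law h 0)" by (rule pair_integral(2)[OF m2 i2, symmetric])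
  also have "\<dots> \<le> (\<integral>z. t\<^sup>2 / n * (score h z)\<^sup>2 \<partial>pair_law h 0)"
    using i2 score_sq gb2 by (intro integral_mono) auto
  finally show "(\<integral>x. (D t n x)\<^sup>2 \<partial>\<mu>) \<le> t\<^sup>2 * A2 / n" by (simp add: fisher_information_0_def)
qed

text \<open>The contraction factor does not depend on \<open>x\<close>, and the product of the
  conditional means of the score factors integrates to an n-th power because the X-values are i.i.d.
  The score is thereby restored to its unconditional characteristic function.\<close>

lemma sample_char_bound:
  assumes n: "2 \<le> n" and small: "9 * s\<^sup>2 \<le> 2 * n"
  shows "norm ((\<integral>w. iexp (s * (sqrt n * chatterjee n w) + t * S n w) \<partial>sample_law h n 0)
      - (1 - 9 * s\<^sup>2 / n * kern.kvar / 2) ^ (n - 1) * (\<integral>z. iexp (t * score h z / sqrt n) \<partial>pair_law h 0) ^ n)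
    \<le> (133 * \<bar>s\<bar> + 6 * \<bar>s\<bar> * t\<^sup>2 * A2 + 36 * s\<^sup>2 * \<bar>t\<bar> * A1 + 27 * \<bar>s\<bar> ^ 3) / sqrt n"
proof -
  let ?X = "PiM {..<n} (\<lambda>_. \<mu>)" and ?U = "PiM {..<n} (\<lambda>_. unif)"
  interpret X: prob_space ?X by (rule prob_space_PiM) (rule \<mu>)
  interpret PX: product_prob_space "\<lambda>_. \<mu>" "{..<n}" by (rule product_prob_spaceI) (rule \<mu>)
  define b where "b = 1 - 9 * s\<^sup>2 / n * kern.kvar / 2"
  define F where "F w = iexp (s * (sqrt n * chatterjee n w) + t * S n w)" for w
  have Fm: "F \<in> borel_measurable (sample_law h n 0)"
    unfolding F_def using chat_meas[of n] S_meas[of n] by measurable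
  have Fb: "norm (F w) \<le> 1" for w by (simp add: F_def)
  define G where "G x = (\<integral>u. F (\<zeta> n x u) \<partial>?U)" for x
  define \<Phi> where "\<Phi> x = (\<Prod>j<n. \<integral>u. E t n (x j) u \<partial>unif)" for x
  define B where "B x = 133 * \<bar>s\<bar> / sqrt n + 6 * \<bar>s\<bar> / sqrt n * (\<Sum>j<n. (D t n (x j))\<^sup>2) + 36 * s\<^sup>2 / n * (\<Sum>j<n. D t n (x j)) + 27 * \<bar>s\<bar> ^ 3 / sqrt n" for x
  have n0: "0 < n" "0 < sqrt n" using n by auto
  have Gi: "integrable ?X G" and Ge: "(\<integral>w. F w \<partial>sample_law h n 0) = (\<integral>x. G x \<partial>?X)"
    unfolding G_def using sample_integral[OF Fm Fb] by auto
  have \<Phi>i: "integrable ?X \<Phi>" unfolding \<Phi>_def[abs_def] by (intro PX.product_integrable_prod phi_int) simp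
  have \<Phi>e: "(\<integral>x. \<Phi> x \<partial>?X) = (\<integral>z. iexp (t * score h z / sqrt n) \<partial>pair_law h 0) ^ n"
    unfolding \<Phi>_def by (subst PX.product_integral_prod) (simp_all add: phi_int)
  have comp: "integrable ?X (\<lambda>x. f (x j))" "(\<integral>x. f (x j) \<partial>?X) = (\<integral>x. f x \<partial>\<mu>)" if "j < n" "integrable \<mu> f" for j and f :: "real \<Rightarrow> real"
  proof -
    have fm: "f \<in> borel_measurable \<mu>" using that by auto
    have cm: "(\<lambda>x. x j) \<in> measurable ?X \<mu>" using that by (intro measurable_component_singleton) auto
    have d: "distr ?X \<mu> (\<lambda>x. x j) = \<mu>" using that by (intro distr_PiM_component \<mu>) auto
    show "integrable ?X (\<lambda>x. f (x j))" using integrable_distr_eq[OF cm fm] that unfolding d by simp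
    show "(\<integral>x. f (x j) \<partial>?X) = (\<integral>x. f x \<partial>\<mu>)" using integral_distr[OF cm fm] unfolding d by simp
  qed
  have Bs: "integrable ?X (\<lambda>x. \<Sum>j<n. (D t n (x j))\<^sup>2)" "integrable ?X (\<lambda>x. \<Sum>j<n. D t n (x j))"
    using comp(1)[OF _ D_int(2)] comp(1)[OF _ D_int(1)] by (auto intro!: Bochner_Integration.integrable_sum)
  have Bi: "integrable ?X B" unfolding B_def[abs_def] using Bs by simp
  have s2: "(\<integral>x. (\<Sum>j<n. (D t n (x j))\<^sup>2) \<partial>?X) = n * (\<integral>x. (D t n x)\<^sup>2 \<partial>\<mu>)"
    using comp[OF _ D_int(2)] by (subst Bochner_Integration.integral_sum) auto
  have s1: "(\<integral>x. (\<Sum>j<n. D t n (x j)) \<partial>?X) = n * (\<integral>x. D t n x \<partial>\<mu>)"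
    using comp[OF _ D_int(1)] by (subst Bochner_Integration.integral_sum) auto
  have key: "norm (G x - b ^ (n - 1) * \<Phi> x) \<le> B x" for x
    using chatterjee_char_bound[OF \<nu> atomless score_meas n small, of x t]
    unfolding G_def F_def S_def \<zeta>_def b_def \<Phi>_def B_def by simp
  have "norm ((\<integral>w. F w \<partial>sample_law h n 0) - b ^ (n - 1) * (\<integral>z. iexp (t * score h z / sqrt n) \<partial>pair_law h 0) ^ n)
      = norm (\<integral>x. G x - b ^ (n - 1) * \<Phi> x \<partial>?X)"
    unfolding Ge \<Phi>e[symmetric] using Gi \<Phi>i by simp
  also have "\<dots> \<le> (\<integral>x. B x \<partial>?X)"
    using Gi \<Phi>i Bi key by (intro order_trans[OF integral_norm_bound integral_mono]) auto
  also have "\<dots> = 133 * \<bar>s\<bar> / sqrt n + 6 * \<bar>s\<bar> / sqrt n * (n * (\<integral>x. (D t n x)\<^sup>2 \<partial>\<mu>)) + 36 * s\<^sup>2 / n * (n * (\<integral>x. D t n x \<partial>\<mu>)) + 27 * \<bar>s\<bar> ^ 3 / sqrt n"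
    unfolding B_def s1[symmetric] s2[symmetric] using Bs by (simp add: X.prob_space)
  also have "\<dots> \<le> 133 * \<bar>s\<bar> / sqrt n + 6 * \<bar>s\<bar> / sqrt n * (n * (t\<^sup>2 * A2 / n)) + 36 * s\<^sup>2 / n * (n * (\<bar>t\<bar> * A1 / sqrt n)) + 27 * \<bar>s\<bar> ^ 3 / sqrt n"
    using D_mean[OF n0(1), of t] by (intro add_mono mult_left_mono order_refl) auto
  also have "\<dots> = (133 * \<bar>s\<bar> + 6 * \<bar>s\<bar> * t\<^sup>2 * A2 + 36 * s\<^sup>2 * \<bar>t\<bar> * A1 + 27 * \<bar>s\<bar> ^ 3) / sqrt n"
    using n0 by (simp add: add_divide_distrib mult_ac)
  finally show ?thesis unfolding F_def b_def by simp
qed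

text \<open>The exponent \<open>n - 1\<close> counts gaps. The usual exponential limit has exponent
  \<open>n\<close>; the extra factor is eventually positive and tends to 1.\<close>

lemma kappa_limit: "(\<lambda>n. (1 - 9 * s\<^sup>2 / real n * kern.kvar / 2) ^ (n - 1)) \<longlonglongrightarrow> exp (- ((s * (3 * sqrt kern.kvar))\<^sup>2) / 2)"
proof -
  define y where "y = - ((s * (3 * sqrt kern.kvar))\<^sup>2) / 2"
  have y: "1 - 9 * s\<^sup>2 / real n * kern.kvar / 2 = 1 + y / n" for n :: nat
    using kvar_pos by (simp add: y_def power_mult_distrib)
  have l1: "(\<lambda>n. 1 + y / real n) \<longlonglongrightarrow> 1" by (auto intro!: tendsto_eq_intros lim_const_over_n)
  have ev0: "\<forall>\<^sub>F n in sequentially. 0 < 1 + y / real n" using order_tendstoD(1)[OF l1, of 0] by simp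
  have ev: "\<forall>\<^sub>F n in sequentially. (1 + y / real n) ^ n / (1 + y / real n) = (1 + y / real n) ^ (n - 1)"
    using ev0 eventually_gt_at_top[of 0]
  proof eventually_elim
    case (elim n)
    then show ?case by (cases n) auto
  qed
  have "(\<lambda>n. (1 + y / real n) ^ n / (1 + y / real n)) \<longlonglongrightarrow> exp y / 1"
    by (intro tendsto_divide tendsto_exp_limit_sequentially l1) simp
  then have "(\<lambda>n. (1 + y / real n) ^ (n - 1)) \<longlonglongrightarrow> exp y" using tendsto_cong[OF ev] by simp
  then show ?thesis unfolding y y_def .
qed

lemma sample_char_limit:
  "(\<lambda>n. \<integral>w. iexp (s * (sqrt n * chatterjee n w) + t * S n w) \<partial>sample_law h n 0)
    \<longlonglongrightarrow> char std_normal_distribution (s * (3 * sqrt kern.kvar)) * char std_normal_distribution (t * sqrt A2)"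
proof -
  define C where "C = 133 * \<bar>s\<bar> + 6 * \<bar>s\<bar> * t\<^sup>2 * A2 + 36 * s\<^sup>2 * \<bar>t\<bar> * A1 + 27 * \<bar>s\<bar> ^ 3"
  define L where "L n = complex_of_real ((1 - 9 * s\<^sup>2 / real n * kern.kvar / 2) ^ (n - 1)) * (\<integral>z. iexp (t * score h z / sqrt n) \<partial>pair_law h 0) ^ n" for n
  have "(\<lambda>n. (\<integral>z. iexp (t * score h z / sqrt n) \<partial>pair_law h 0) ^ n) \<longlonglongrightarrow> char std_normal_distribution (t * sqrt A2)"
    using fi by (intro iid_char_conv prob_pair score_meas_pair score_sq score_mean)
      (simp_all add: fisher_information_0_def)
  moreover have "(\<lambda>n. complex_of_real ((1 - 9 * s\<^sup>2 / real n * kern.kvar / 2) ^ (n - 1))) \<longlonglongrightarrow> char std_normal_distribution (s * (3 * sqrt kern.kvar))"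
    unfolding char_std_normal_distribution by (intro tendsto_of_real kappa_limit)
  ultimately have L: "L \<longlonglongrightarrow> char std_normal_distribution (s * (3 * sqrt kern.kvar)) * char std_normal_distribution (t * sqrt A2)"
    unfolding L_def by (intro tendsto_mult)
  have C0: "(\<lambda>n. C / sqrt n) \<longlonglongrightarrow> 0"
    by (intro tendsto_divide_0[OF tendsto_const] filterlim_at_top_imp_at_infinity filterlim_compose[OF sqrt_at_top filterlim_real_sequentially])
  have "(\<lambda>n. (\<integral>w. iexp (s * (sqrt n * chatterjee n w) + t * S n w) \<partial>sample_law h n 0) - L n) \<longlonglongrightarrow> 0"
  proof (rule Lim_null_comparison[OF _ C0])
    show "\<forall>\<^sub>F n in sequentially. norm ((\<integral>w. iexp (s * (sqrt n * chatterjee n w) + t * S n w) \<partial>sample_law h n 0) - L n) \<le> C / sqrt n"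
      \<comment> \<open>Beyond this index \<open>9 * s\<^sup>2 \<le> n\<close>, which is more than
        the smallness condition on the frequency asks for.\<close>
      using eventually_ge_at_top[of "max 2 (nat \<lceil>9 * s\<^sup>2\<rceil>)"]
    proof eventually_elim
      case (elim n)
      then have "2 \<le> n" "9 * s\<^sup>2 \<le> 2 * n" by (auto simp: nat_ceiling_le_eq)
      then show ?case using sample_char_bound[of n s t] unfolding L_def C_def by simp
    qed
  qed
  from tendsto_add[OF this L] show ?thesis by simp
qed

lemma chatterjee_pitman: "has_pitman_efficiency h chatterjee 0"
proof -
  \<comment> \<open>The 3 is the factor in the definition of the coefficient;
    \<open>kern.kvar\<close> is the second moment of the kernel.\<close>
  define \<sigma> where "\<sigma> = 3 * sqrt kern.kvar"
  define \<tau> where "\<tau> = sqrt A2"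
  have \<sigma>: "0 < \<sigma>" using kvar_pos by (simp add: \<sigma>_def)
  interpret N: real_distribution std_normal_distribution by (rule real_dist_normal_dist)
  define \<alpha> where "\<alpha> = distr std_normal_distribution borel (\<lambda>u. \<sigma> * u)"
  define \<beta> where "\<beta> = distr std_normal_distribution borel (\<lambda>v. \<tau> * v)"
  have char_scale: "char (distr std_normal_distribution borel (\<lambda>u. k * u)) s = char std_normal_distribution (s * k)" for k s :: real
    by (simp add: char_def integral_distr mult.assoc)
  interpret asymp_indep "\<lambda>n. sample_law h n 0" "\<lambda>n w. sqrt (real n) * chatterjee n w" S \<alpha> \<beta>
  proof (rule asymp_indep.intro)
    show "prob_space (sample_law h n 0)" for n by (rule prob_sample)
    show "(\<lambda>w. sqrt (real n) * chatterjee n w) \<in> borel_measurable (sample_law h n 0)" for n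
      using chat_meas[of n] by measurable
    show "S n \<in> borel_measurable (sample_law h n 0)" for n by (rule S_meas)
    show "real_distribution \<alpha>" unfolding \<alpha>_def by (rule N.real_distribution_distr) simp
    show "real_distribution \<beta>" unfolding \<beta>_def by (rule N.real_distribution_distr) simp
    show "(\<lambda>n. \<integral>w. iexp (s * (sqrt (real n) * chatterjee n w) + t * S n w) \<partial>sample_law h n 0) \<longlonglongrightarrow> char \<alpha> s * char \<beta> t" for s t
      using sample_char_limit[of s t] by (simp only: \<alpha>_def \<beta>_def char_scale \<sigma>_def \<tau>_def)
  qed
  \<comment> \<open>At correlation 0 the linear map is diagonal, so the image of the product of two
    standard normals is the product of the scaled ones.\<close>
  have biv: "bivariate_normal \<sigma> \<tau> 0 = \<alpha> \<Otimes>\<^sub>M \<beta>"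
  proof -
    have "\<alpha> \<Otimes>\<^sub>M \<beta> = distr (std_normal_distribution \<Otimes>\<^sub>M std_normal_distribution) (borel \<Otimes>\<^sub>M borel) (\<lambda>(u, v). (\<sigma> * u, \<tau> * v))"
      unfolding \<alpha>_def \<beta>_def
    proof (rule pair_measure_distr)
      show "sigma_finite_measure (distr std_normal_distribution borel (\<lambda>v. \<tau> * v))"
        by (intro prob_space_imp_sigma_finite N.prob_space_distr) simp
    qed simp_all
    then show ?thesis by (simp add: bivariate_normal_def borel_prod)
  qed
  have AB: "(\<lambda>w. (sqrt (real n) * chatterjee n w, S n w)) \<in> measurable (sample_law h n 0) borel" for n
    unfolding borel_prod[symmetric] using chat_meas[of n] S_meas[of n] by measurable
  have "weakly_converges (\<lambda>n. distr (sample_law h n 0) borel (\<lambda>w. (sqrt (real n) * chatterjee n w, S n w))) (\<alpha> \<Otimes>\<^sub>M \<beta>)"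
    unfolding weakly_converges_def
  proof (intro allI impI, elim conjE)
    fix f :: "real \<times> real \<Rightarrow> real"
    assume f: "continuous_on UNIV f" "bounded (range f)"
    obtain K where K: "\<And>z. \<bar>f z\<bar> \<le> K" using f(2) unfolding bounded_iff by auto
    have fm: "f \<in> borel_measurable borel" by (rule borel_measurable_continuous_onI[OF f(1)])
    show "(\<lambda>n. \<integral>z. f z \<partial>distr (sample_law h n 0) borel (\<lambda>w. (sqrt (real n) * chatterjee n w, S n w))) \<longlonglongrightarrow> (\<integral>z. f z \<partial>(\<alpha> \<Otimes>\<^sub>M \<beta>))"
      unfolding integral_distr[OF AB fm] by (rule conv_continuous[OF f(1) K])
  qed
  then have "weakly_converges (\<lambda>n. distr (sample_law h n 0) borel
      (\<lambda>w. (sqrt (real n) * chatterjee n w, (1 / sqrt (real n)) * (\<Sum>i<n. score h (w i)))))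
    (bivariate_normal \<sigma> (sqrt (fisher_information_0 h)) 0)"
    unfolding S_def biv[symmetric] \<tau>_def .
  then show ?thesis
    unfolding has_pitman_efficiency_def using \<sigma> chat_meas by (intro conjI allI exI[of _ \<sigma>] exI[of _ 0]) auto
qed

end

theorem proposition4p13:
  fixes h :: "real \<Rightarrow> real \<times> real \<Rightarrow> real" and f0 g0 :: "real \<Rightarrow> real"
  assumes "\<And>\<theta>. \<bar>\<theta>\<bar> < 1 \<Longrightarrow> prob_density (h \<theta>)"
    and "prob_density f0" and "prob_density g0"
    and "\<And>x y. h 0 (x, y) = f0 x * g0 y"
    and "log_density_differentiable h"
    and "qmd_at_0 h"
    and "0 < fisher_information_0 h"
  shows "has_pitman_efficiency h chatterjee 0"
proof -
  interpret independence_family h f0 g0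
    by (intro independence_family.intro qmd_family.intro independence_family_axioms.intro assms)
  show ?thesis by (rule chatterjee_pitman)
qed

end
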